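(* Let $q\in C^1([0,\infty))$, $Q(y)=\int_0^y 2q(x)\,dx$, $\mu(dy)=e^{-Q(y)}\,dy$ on $(0,\infty)$, and let $X$ be the one-dimensional diffusion solving $dX_t=dB_t-q(X_t)\,dt$, $X_0=x>0$, with $B$ a standard one-dimensional Brownian motion. Assume that $$\int_0^\infty e^{Q(y)}\,dy=\infty\qquad\text{and}\qquad \int_0^\infty e^{Q(y)}\left(\int_y^\infty e^{-Q(z)}\,dz\right)dy=\infty .$$ If $$\lim_{x\to\infty}\mu([x,\infty))\int_0^x e^{Q(y)}\,dy=0,$$ then the process $X^\tau$ ($X$ killed at $0$) is $R$-positive.
   Context: $\tau=\inf\{t>0: X_t=0\}$ is the hitting time of $0$, and $X^\tau$ denotes $X$ killed at time $\tau$. The generator of $X$ is $Lu=\tfrac12 u''-q u'$, with formal adjoint $L^*u=\tfrac12 u''+(qu)'$. For real $\lambda$, $\eta_\lambda$ is the solution on $[0,\infty)$ of $L\eta_\lambda=-\lambda\eta_\lambda$, $\eta_\lambda(0)=0$, $\eta_\lambda'(0)=1$, and $\varphi_\lambda=e^{-Q}\eta_\lambda$, which is the solution of $L^*\varphi_\lambda=-\lambda\varphi_\lambda$, $\varphi_\lambda(0)=0$, $\varphi_\lambda'(0)=1$. $\lambda_c$ is the smallest point of increase of the spectral measure $\varrho(\lambda)$ of $L^*$ (with Dirichlet condition at $0$, and the sign convention $L^*\varphi=-\lambda\varphi$); equivalently (a known result of Mandl), $\lambda_c=\sup\{\lambda\in\mathbb R:\varphi_\lambda \text{ does not change sign on }(0,\infty)\}$.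 The process $Y$ ($X$ conditioned never to hit $0$) is the diffusion on $(0,\infty)$ with law $$\mathbb P_x(Y_s\in A)=e^{\lambda_c s}\,\mathbb E_x\!\left(\frac{\eta_{\lambda_c}(X_s)}{\eta_{\lambda_c}(x)};\,X_s\in A,\ \tau>s\right)=\lim_{t\to\infty}\mathbb P_x(X_s\in A\mid\tau>t),$$ i.e. the solution of $dY_t=dB_t-\phi(Y_t)\,dt$ with $\phi(y)=q(y)-\eta_{\lambda_c}'(y)/\eta_{\lambda_c}(y)$; it never reaches $0$. $X^\tau$ is called $R$-positive if $Y$ is positive recurrent, meaning $\mathbb E_x(T^Y_a)<\infty$ for all $x,a\in(0,\infty)$, where $T^Y_a=\inf\{t>0:Y_t=a\}$. *)

theory Defs
  imports "HOL-Probability.Probability"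
begin

definition C1_on_nonneg :: "(real \<Rightarrow> real) \<Rightarrow> bool" where
  "C1_on_nonneg q \<longleftrightarrow> (\<exists>q'. continuous_on {0..} q' \<and>
     (\<forall>x\<ge>0. (q has_real_derivative q' x) (at x within {0..})))"

definition bigQ :: "(real \<Rightarrow> real) \<Rightarrow> real \<Rightarrow> real" where
  "bigQ q y = integral {0..y} (\<lambda>x. 2 * q x)"

definition mu :: "(real \<Rightarrow> real) \<Rightarrow> real measure" where
  "mu q = density lborel (\<lambda>y. ennreal (exp (- bigQ q y)) * indicator {0<..} y)"

text \<open>The Cauchy problem \<open>L u = - l u\<close> on \<open>[0,\<infinity>)\<close>, \<open>u(0) = 0\<close>, \<open>u'(0) = 1\<close>, for
  \<open>L u = u''/2 - q u'\<close>. The derivatives at \<open>0\<close> are one-sided, and \<open>u\<close> is unconstrained on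
  the negative half-line.\<close>

definition eta_solution :: "(real \<Rightarrow> real) \<Rightarrow> real \<Rightarrow> (real \<Rightarrow> real) \<Rightarrow> bool" where
  "eta_solution q l u \<longleftrightarrow> (\<exists>u' u''.
     (\<forall>x\<ge>0. (u has_real_derivative u' x) (at x within {0..}) \<and>
             (u' has_real_derivative u'' x) (at x within {0..}) \<and>
             u'' x / 2 - q x * u' x = - l * u x) \<and>
     u 0 = 0 \<and> u' 0 = 1)"

text \<open>For \<open>q\<close> continuous on \<open>[0,\<infinity>)\<close> the solution is unique on \<open>[0,\<infinity>)\<close>; only its values
  there are used.\<close>

definition eta :: "(real \<Rightarrow> real) \<Rightarrow> real \<Rightarrow> real \<Rightarrow> real" where
  "eta q l = (SOME u. eta_solution q l u)"

definition varphi :: "(real \<Rightarrow> real) \<Rightarrow> real \<Rightarrow> real \<Rightarrow> real" where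
  "varphi q l x = exp (- bigQ q x) * eta q l x"

definition no_sign_change :: "(real \<Rightarrow> real) \<Rightarrow> bool" where
  "no_sign_change f \<longleftrightarrow> (\<forall>x>0. f x \<ge> 0) \<or> (\<forall>x>0. f x \<le> 0)"

text \<open>The bottom of the spectrum, in Mandl's form. The set contains \<open>0\<close> and, by Sturm
  comparison, is bounded above, so the supremum in \<open>real\<close> is the genuine one.\<close>

definition lambda_c :: "(real \<Rightarrow> real) \<Rightarrow> real" where
  "lambda_c q = Sup {l. no_sign_change (varphi q l)}"

definition brownian_motion :: "'w measure \<Rightarrow> (real \<Rightarrow> 'w \<Rightarrow> real) \<Rightarrow> bool" where
  "brownian_motion M W \<longleftrightarrow>
     prob_space M \<and>
     (\<forall>t\<ge>0. W t \<in> borel_measurable M) \<and>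
     (AE \<omega> in M. W 0 \<omega> = 0) \<and>
     (AE \<omega> in M. continuous_on {0..} (\<lambda>t. W t \<omega>)) \<and>
     (\<forall>s t. 0 \<le> s \<and> s < t \<longrightarrow>
        distributed M lborel (\<lambda>\<omega>. W t \<omega> - W s \<omega>) (\<lambda>x. ennreal (normal_density 0 (sqrt (t - s)) x))) \<and>
     (\<forall>(t :: nat \<Rightarrow> real) n. 0 \<le> t 0 \<and> mono t \<longrightarrow>
        prob_space.indep_vars M (\<lambda>_. borel) (\<lambda>i \<omega>. W (t (Suc i)) \<omega> - W (t i) \<omega>) {..<n})"

text \<open>\<open>inf {t > 0. Z t = a}\<close>, which is \<open>\<infinity>\<close> if \<open>a\<close> is never hit.\<close>

definition hitting_time :: "(real \<Rightarrow> 'w \<Rightarrow> real) \<Rightarrow> real \<Rightarrow> 'w \<Rightarrow> ennreal" where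
  "hitting_time Z a \<omega> = (INF t\<in>{t. 0 < t \<and> Z t \<omega> = a}. ennreal t)"

text \<open>A solution of \<open>dX = dB - q(X) dt\<close>, \<open>X 0 = x\<close>. The noise is additive, so the equation is
  pathwise and needs no stochastic integral. As \<open>q\<close> is only given on \<open>[0,\<infinity>)\<close>, the equation is
  imposed up to the hitting time of \<open>0\<close>; what \<open>X\<close> does afterwards is irrelevant for the
  killed process.\<close>

definition diffusion_until_zero ::
  "'w measure \<Rightarrow> (real \<Rightarrow> 'w \<Rightarrow> real) \<Rightarrow> (real \<Rightarrow> real) \<Rightarrow> real \<Rightarrow> (real \<Rightarrow> 'w \<Rightarrow> real) \<Rightarrow> bool" where
  "diffusion_until_zero M B q x X \<longleftrightarrow>
     brownian_motion M B \<and>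
     (\<forall>t\<ge>0. X t \<in> borel_measurable M) \<and>
     (AE \<omega> in M. continuous_on {0..} (\<lambda>t. X t \<omega>)) \<and>
     (AE \<omega> in M. \<forall>t\<ge>0. ennreal t \<le> hitting_time X 0 \<omega> \<longrightarrow>
        X t \<omega> = x + B t \<omega> - integral {0..t} (\<lambda>s. q (X s \<omega>)))"

definition cond_drift :: "(real \<Rightarrow> real) \<Rightarrow> real \<Rightarrow> real" where
  "cond_drift q y = q y - deriv (eta q (lambda_c q)) y / eta q (lambda_c q) y"

text \<open>\<open>Y\<close>, started at \<open>x\<close> and defined on \<open>N\<close>, is a version of the process \<open>X\<close> (started at
  \<open>x\<close>, defined on \<open>M\<close>) conditioned never to hit \<open>0\<close>: it is the diffusion on \<open>(0,\<infinity>)\<close> whose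
  drift is \<open>- cond_drift q\<close>, and its law at time \<open>s\<close> is the \<open>eta\<close>-transform of the law of the
  killed process. The first part already determines the law of \<open>Y\<close>; the second one ties it
  to \<open>X\<close>.\<close>

definition conditioned_process ::
  "(real \<Rightarrow> real) \<Rightarrow> real \<Rightarrow> 'w measure \<Rightarrow> (real \<Rightarrow> 'w \<Rightarrow> real) \<Rightarrow>
   'v measure \<Rightarrow> (real \<Rightarrow> 'v \<Rightarrow> real) \<Rightarrow> bool" where
  "conditioned_process q x M X N Y \<longleftrightarrow>
     (\<forall>t\<ge>0. Y t \<in> borel_measurable N) \<and>
     (AE \<omega> in N. continuous_on {0..} (\<lambda>t. Y t \<omega>)) \<and>
     (AE \<omega> in N. \<forall>t\<ge>0. Y t \<omega> > 0) \<and>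
     (\<exists>W. brownian_motion N W \<and>
        (AE \<omega> in N. \<forall>t\<ge>0.
           Y t \<omega> = x + W t \<omega> - integral {0..t} (\<lambda>s. cond_drift q (Y s \<omega>)))) \<and>
     (\<forall>s\<ge>0. \<forall>A\<in>sets borel.
        emeasure N {\<omega> \<in> space N. Y s \<omega> \<in> A} =
        ennreal (exp (lambda_c q * s)) *
        (\<integral>\<^sup>+\<omega>. ennreal (eta q (lambda_c q) (X s \<omega>) / eta q (lambda_c q) x) *
              indicator {\<omega>. X s \<omega> \<in> A \<and> hitting_time X 0 \<omega> > ennreal s} \<omega> \<partial>M))"

text \<open>Families are indexed by the starting point: \<open>Y x\<close> lives on \<open>N x\<close> and starts at \<open>x\<close>.\<close>

definition positive_recurrent ::
  "(real \<Rightarrow> 'v measure) \<Rightarrow> (real \<Rightarrow> real \<Rightarrow> 'v \<Rightarrow> real) \<Rightarrow> bool" where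
  "positive_recurrent N Y \<longleftrightarrow>
     (\<forall>x>0. \<forall>a>0. (\<integral>\<^sup>+\<omega>. hitting_time (Y x) a \<omega> \<partial>N x) < \<infinity>)"

text \<open>\<open>R\<close>-positivity of the process \<open>X\<close> (with drift \<open>- q\<close>) killed at its hitting time of \<open>0\<close>.
  The \<open>itself\<close> argument only names the type of sample points on which versions of the
  conditioned process may be realised; positive recurrence depends only on their laws.\<close>

definition R_positive ::
  "'v itself \<Rightarrow> (real \<Rightarrow> real) \<Rightarrow> (real \<Rightarrow> 'w measure) \<Rightarrow> (real \<Rightarrow> real \<Rightarrow> 'w \<Rightarrow> real) \<Rightarrow> bool" where
  "R_positive _ q M X \<longleftrightarrow>
     (\<forall>(N :: real \<Rightarrow> 'v measure) Y.
        (\<forall>x>0. conditioned_process q x (M x) (X x) (N x) (Y x)) \<longrightarrow> positive_recurrent N Y)"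

end

theory Submission
  imports Defs
begin

text \<open>
  Write \<open>p = e\<^sup>-\<^sup>Q\<close> for the density of \<open>mu\<close>, \<open>S(x)\<close> for the scale \<open>\<integral>\<^sub>0\<^sup>x e\<^sup>Q\<close>, \<open>l\<close> for the bottom \<open>lambda_c\<close> of the
  spectrum and \<open>\<eta>\<close> for the solution at \<open>l\<close>. The conditioned process has scale density \<open>1 / (\<eta>\<^sup>2 p)\<close> and
  speed density \<open>\<eta>\<^sup>2 p\<close>, so it is positive recurrent as soon as \<open>\<eta>\<close> is square integrable with
  respect to \<open>mu\<close>. Two things have to be shown: this integrability, and that it bounds the expected
  hitting times of every process that solves the equation pathwise.

  Integrability. For \<open>l' > l\<close> the solution \<open>\<eta>\<^sub>l\<^sub>'\<close> changes sign, and as \<open>l'\<close> decreases to \<open>l\<close> its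
  zeros are pushed to infinity, because \<open>\<eta> > 0\<close> (lemma \<open>eta_has_far_zero\<close>). Between a fixed
  point \<open>N\<close> and such a zero, a Hardy inequality of Muckenhoupt type bounds the squared \<open>L\<^sup>2\<close> norm of \<open>\<eta>\<^sub>l\<^sub>'\<close>
  by \<open>l'\<close> times itself times a small constant, plus data at \<open>N\<close> (lemma \<open>hardy_estimate\<close>). The
  constant is small because \<open>mu [x, \<infinity>) S(x)\<close> tends to \<open>0\<close>. The bound is uniform in \<open>l'\<close> and
  passes to the limit (lemma \<open>ground_state_square_integrable\<close>).

  Hitting times. With \<open>G(y) = \<integral>\<^sub>0\<^sup>y \<eta>\<^sup>2 p\<close> and a constant \<open>K\<close>, a function \<open>V\<close> with derivative
  \<open>2 (K - G) / (\<eta>\<^sup>2 p)\<close> satisfies \<open>V'' / 2 - \<phi> V' = -1\<close>. It increases if \<open>K\<close> bounds \<open>G\<close>, which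
  is where integrability enters, and it decreases if \<open>K = 0\<close>. In both cases the expected time to
  leave an interval on which \<open>V \<ge> 1\<close> is at most a multiple of \<open>V(x)\<close>, uniformly in the endpoint
  that is not the target; that endpoint is then sent to \<open>\<infinity>\<close> or to \<open>0\<close>.

  The exit time bound (lemma \<open>exit_time_bound\<close>) does not use stochastic integrals, as no
  filtration is given to which \<open>Y\<close> is adapted. The noise is additive, so the Euler chain of the
  equation is an explicit function of the Brownian increments. Along the chain, \<open>V\<close> decreases on
  average by at least half the step size, and the chain converges to \<open>Y\<close> along almost every path.
  Fatou's lemma transfers the bound to \<open>Y\<close>.
\<close>

section \<open>Calculus on the half-line\<close>

lemma at_within_nonneg: "(x::real) > 0 \<Longrightarrow> at x within {0..} = at x"
  by (rule at_within_interior) auto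

lemma has_real_derivative_integral_from_0:
  fixes f :: "real \<Rightarrow> real"
  assumes "continuous_on {0..} f" "x \<ge> 0"
  shows "((\<lambda>y. integral {0..y} f) has_real_derivative f x) (at x within {0..})"
proof -
  have "((\<lambda>y. integral {0..y} f) has_real_derivative f x) (at x within {0..x+1})"
    by (rule integral_has_real_derivative) (use assms in \<open>auto intro: continuous_on_subset\<close>)
  moreover have "at x within {0..x+1} = at x within {0..}"
    by (rule at_within_nhd[where S = "{..<x+1}"]) auto
  ultimately show ?thesis by simp
qed

lemma integral_bound_power:
  fixes f :: "real \<Rightarrow> real"
  assumes "continuous_on {0..} f" "x \<ge> 0" "\<And>y. 0 \<le> y \<Longrightarrow> y \<le> x \<Longrightarrow> \<bar>f y\<bar> \<le> c * y ^ n"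
  shows "\<bar>integral {0..x} f\<bar> \<le> c * x ^ Suc n / Suc n"
proof -
  have "((\<lambda>y. c * y ^ Suc n / Suc n) has_real_derivative c * y ^ n) (at y within {0..x})" for y
    by (rule derivative_eq_intros refl | simp del: power_Suc of_nat_Suc)+
  then have "((\<lambda>y. c * y ^ n) has_integral (c * x ^ Suc n / Suc n - c * 0 ^ Suc n / Suc n)) {0..x}"
    by (intro fundamental_theorem_of_calculus)
       (use assms(2) in \<open>auto simp: has_real_derivative_iff_has_vector_derivative[symmetric]\<close>)
  moreover have "f integrable_on {0..x}"
    by (rule integrable_continuous_real) (use assms in \<open>auto intro: continuous_on_subset\<close>)
  ultimately
  have "norm (integral {0..x} f) \<le> integral {0..x} (\<lambda>y. c * y ^ n)"
    by (intro integral_norm_bound_integral) (use assms in auto)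
  also have "\<dots> = c * x ^ Suc n / Suc n"
    using \<open>(_ has_integral _) _\<close> by (subst integral_unique) auto
  finally show ?thesis by simp
qed

lemma mono_from_deriv:
  assumes "0 \<le> a" "a \<le> (b::real)"
    and D: "\<And>x. a \<le> x \<Longrightarrow> x \<le> b \<Longrightarrow> (f has_real_derivative f' x) (at x within {0..})"
    and pos: "\<And>x. a \<le> x \<Longrightarrow> x \<le> b \<Longrightarrow> f' x \<ge> 0"
  shows "f a \<le> f b"
proof (rule DERIV_nonneg_imp_increasing_open[OF \<open>a \<le> b\<close>])
  fix x assume x: "a < x" "x < b"
  have "at x within {0..} = at x"
    by (rule at_within_interior) (use x assms in auto)
  then show "\<exists>y. DERIV f x :> y \<and> 0 \<le> y" using D[of x] pos[of x] x by auto
next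
  show "continuous_on {a..b} f"
  proof (rule DERIV_continuous_on)
    fix x assume "x \<in> {a..b}"
    then show "(f has_real_derivative f' x) (at x within {a..b})"
      by (intro has_field_derivative_subset[OF D]) (use assms in auto)
  qed
qed

lemma gronwall_deriv:
  assumes D: "\<And>x. 0 \<le> x \<Longrightarrow> x \<le> b \<Longrightarrow> (E has_real_derivative E' x) (at x within {0..})"
    and le: "\<And>x. 0 \<le> x \<Longrightarrow> x \<le> b \<Longrightarrow> E' x \<le> C * E x + (r::real)"
    and "0 \<le> r" "0 \<le> C" and x: "0 \<le> x" "x \<le> b"
  shows "E x \<le> (E 0 + r * x) * exp (C * x)"
proof -
  have "E 0 + r * 0 - exp (- C * 0) * E 0 \<le> E 0 + r * x - exp (- C * x) * E x"
  proof (rule mono_from_deriv[where f = "\<lambda>x. E 0 + r * x - exp (- C * x) * E x"])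
    fix y assume y: "0 \<le> y" "y \<le> x"
    have Ey: "(E has_real_derivative E' y) (at y within {0..})" using D y x by auto
    show "((\<lambda>x. E 0 + r * x - exp (- C * x) * E x) has_real_derivative
        r - exp (- C * y) * (E' y - C * E y)) (at y within {0..})"
      by (rule derivative_eq_intros refl Ey)+ (auto simp: algebra_simps)
    have "exp (- C * y) * (E' y - C * E y) \<le> exp (- C * y) * r"
      using le[of y] y x by (intro mult_left_mono) auto
    also have "\<dots> \<le> 1 * r" using assms y by (intro mult_right_mono) auto
    finally show "0 \<le> r - exp (- C * y) * (E' y - C * E y)" by simp
  qed (use x in auto)
  then have "exp (- C * x) * E x \<le> E 0 + r * x" by simp
  then have "exp (C * x) * (exp (- C * x) * E x) \<le> exp (C * x) * (E 0 + r * x)"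
    by (intro mult_left_mono) auto
  moreover have "exp (C * x) * (exp (- C * x) * E x) = E x"
    by (simp add: mult.assoc[symmetric] exp_add[symmetric])
  ultimately show ?thesis by (simp only: mult.commute)
qed

lemma abs_bounded_on_Icc:
  fixes g :: "real \<Rightarrow> real"
  assumes "continuous_on {c..d} g"
  shows "\<exists>A. \<forall>y\<in>{c..d}. \<bar>g y\<bar> \<le> A"
proof -
  have "bounded (g ` {c..d})" by (intro compact_imp_bounded compact_continuous_image assms) auto
  then show ?thesis unfolding bounded_iff by auto
qed

section \<open>The Cauchy problem for the generator\<close>

lemma bigQ_deriv:
  assumes "continuous_on {0..} q" "x \<ge> 0"
  shows "(bigQ q has_real_derivative 2 * q x) (at x within {0..})"
proof -
  have "((\<lambda>y. integral {0..y} (\<lambda>x. 2 * q x)) has_real_derivative 2 * q x) (at x within {0..})"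
    by (rule has_real_derivative_integral_from_0) (use assms in \<open>auto intro!: continuous_intros\<close>)
  then show ?thesis by (simp add: bigQ_def [abs_def])
qed

lemma bigQ_0 [simp]: "bigQ q 0 = 0"
  by (simp add: bigQ_def)

lemma continuous_on_bigQ:
  assumes "continuous_on {0..} q"
  shows "continuous_on {0..} (bigQ q)"
  by (rule DERIV_continuous_on) (use bigQ_deriv[OF assms] in auto)

text \<open>The first-order form of the Cauchy problem, with \<open>v = e\<^sup>-\<^sup>Q u'\<close> in place of \<open>u'\<close>. In these
  variables \<open>q\<close> enters only through \<open>Q\<close>, and on bounded intervals all coefficients are bounded.\<close>

definition eta_system :: "(real \<Rightarrow> real) \<Rightarrow> real \<Rightarrow> (real \<Rightarrow> real) \<Rightarrow> (real \<Rightarrow> real) \<Rightarrow> bool" where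
  "eta_system q l u v \<longleftrightarrow> u 0 = 0 \<and> v 0 = 1 \<and>
     (\<forall>x\<ge>0. (u has_real_derivative exp (bigQ q x) * v x) (at x within {0..}) \<and>
             (v has_real_derivative - 2 * l * exp (- bigQ q x) * u x) (at x within {0..}))"

lemma eta_solution_iff_system:
  assumes q: "continuous_on {0..} q"
  shows "eta_solution q l u \<longleftrightarrow> (\<exists>v. eta_system q l u v)"
proof
  assume "eta_solution q l u"
  then obtain u' u'' where D: "\<And>x. x \<ge> 0 \<Longrightarrow> (u has_real_derivative u' x) (at x within {0..})"
     "\<And>x. x \<ge> 0 \<Longrightarrow> (u' has_real_derivative u'' x) (at x within {0..})"
     "\<And>x. x \<ge> 0 \<Longrightarrow> u'' x / 2 - q x * u' x = - l * u x" "u 0 = 0" "u' 0 = 1"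
    unfolding eta_solution_def by blast
  define v where "v = (\<lambda>x. exp (- bigQ q x) * u' x)"
  have "eta_system q l u v"
    unfolding eta_system_def
  proof (intro conjI allI impI)
    fix x :: real assume x: "x \<ge> 0"
    have "exp (bigQ q x) * v x = u' x"
      unfolding v_def by (simp add: mult.assoc[symmetric] exp_add[symmetric])
    then show "(u has_real_derivative exp (bigQ q x) * v x) (at x within {0..})"
      using D(1)[OF x] by simp
    have u'': "u'' x = 2 * (q x * u' x - l * u x)"
      using D(3)[OF x] by simp
    show "(v has_real_derivative - 2 * l * exp (- bigQ q x) * u x) (at x within {0..})"
      unfolding v_def
      by (rule derivative_eq_intros refl bigQ_deriv[OF q x] D(2)[OF x])+
         (simp add: u'' algebra_simps)
  qed (use D in \<open>auto simp: v_def\<close>)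
  then show "\<exists>v. eta_system q l u v" by blast
next
  assume "\<exists>v. eta_system q l u v"
  then obtain v where v: "eta_system q l u v" ..
  show "eta_solution q l u"
    unfolding eta_solution_def
  proof (rule exI[of _ "\<lambda>x. exp (bigQ q x) * v x"],
         rule exI[of _ "\<lambda>x. 2 * q x * exp (bigQ q x) * v x - 2 * l * u x"], intro conjI allI impI)
    fix x :: real assume x: "x \<ge> 0"
    show "(u has_real_derivative exp (bigQ q x) * v x) (at x within {0..})"
      using v x unfolding eta_system_def by auto
    have dv: "(v has_real_derivative - 2 * l * exp (- bigQ q x) * u x) (at x within {0..})"
      using v x unfolding eta_system_def by auto
    have e: "exp (bigQ q x) * exp (- bigQ q x) = 1" by (simp add: exp_add[symmetric])
    have *: "2 * q x * exp (bigQ q x) * v x - 2 * l * u x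
       = (exp (bigQ q x) * (2 * q x)) * v x + (- 2 * l * exp (- bigQ q x) * u x) * exp (bigQ q x)"
    proof -
      have "(- 2 * l * exp (- bigQ q x) * u x) * exp (bigQ q x)
         = - 2 * l * u x * (exp (bigQ q x) * exp (- bigQ q x))" by simp
      also have "\<dots> = - 2 * l * u x" by (simp only: e mult_1_right)
      finally show ?thesis by simp
    qed
    show "((\<lambda>x. exp (bigQ q x) * v x) has_real_derivative
        2 * q x * exp (bigQ q x) * v x - 2 * l * u x) (at x within {0..})"
      unfolding *
      by (rule derivative_eq_intros refl bigQ_deriv[OF q x] dv)+
    show "(2 * q x * exp (bigQ q x) * v x - 2 * l * u x) / 2 - q x * (exp (bigQ q x) * v x)
       = - l * u x" by (simp add: field_simps)
  qed (use v in \<open>auto simp: eta_system_def\<close>)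
qed

text \<open>The solution is a power series in \<open>l\<close>. Its terms are generated by Picard iteration: the \<open>n\<close>-th terms of
  \<open>u\<close> and \<open>v\<close> are \<open>l\<^sup>n\<close> times functions of \<open>x\<close>, and each is an integral of its predecessor.\<close>

fun flux_term :: "(real \<Rightarrow> real) \<Rightarrow> real \<Rightarrow> nat \<Rightarrow> real \<Rightarrow> real" where
  "flux_term q l 0 = (\<lambda>x. 1)"
| "flux_term q l (Suc n) = (\<lambda>x. integral {0..x} (\<lambda>y. - 2 * l * exp (- bigQ q y) *
      integral {0..y} (\<lambda>z. exp (bigQ q z) * flux_term q l n z)))"

definition eta_term :: "(real \<Rightarrow> real) \<Rightarrow> real \<Rightarrow> nat \<Rightarrow> real \<Rightarrow> real" where
  "eta_term q l n x = integral {0..x} (\<lambda>z. exp (bigQ q z) * flux_term q l n z)"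

lemma flux_term_Suc:
  "flux_term q l (Suc n) x = integral {0..x} (\<lambda>y. - 2 * l * exp (- bigQ q y) * eta_term q l n y)"
  by (simp add: eta_term_def)

context
  fixes q :: "real \<Rightarrow> real"
  assumes q: "continuous_on {0..} q"
begin

lemma cont_expQ: "continuous_on {0..} (\<lambda>x. exp (bigQ q x))"
  and cont_expmQ: "continuous_on {0..} (\<lambda>x. exp (- bigQ q x))"
  by (auto intro!: continuous_intros continuous_on_bigQ[OF q])

lemma eta_term_deriv_aux:
  assumes "continuous_on {0..} (flux_term q l n)" "x \<ge> 0"
  shows "(eta_term q l n has_real_derivative exp (bigQ q x) * flux_term q l n x) (at x within {0..})"
  using has_real_derivative_integral_from_0[OF continuous_on_mult[OF cont_expQ assms(1)] assms(2)]
  by (simp add: eta_term_def[abs_def])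

lemma cont_flux_term: "continuous_on {0..} (flux_term q l n)"
proof (induction n)
  case (Suc n)
  have "continuous_on {0..} (eta_term q l n)"
    by (rule DERIV_continuous_on) (use eta_term_deriv_aux[OF Suc] in auto)
  then have "continuous_on {0..} (\<lambda>y. - 2 * l * exp (- bigQ q y) * eta_term q l n y)"
    by (intro continuous_intros cont_expmQ continuous_on_bigQ[OF q])
  then have "continuous_on {0..} (\<lambda>x. integral {0..x} (\<lambda>y. - 2 * l * exp (- bigQ q y) * eta_term q l n y))"
    by (intro DERIV_continuous_on[OF has_real_derivative_integral_from_0]) auto
  then show ?case
    by (subst continuous_on_cong[OF refl flux_term_Suc])
qed auto

lemmas eta_term_deriv = eta_term_deriv_aux[OF cont_flux_term]

lemma cont_eta_term: "continuous_on {0..} (eta_term q l n)"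
  by (rule DERIV_continuous_on) (use eta_term_deriv in auto)

lemma flux_term_deriv:
  assumes "x \<ge> 0"
  shows "(flux_term q l (Suc n) has_real_derivative - 2 * l * exp (- bigQ q x) * eta_term q l n x)
    (at x within {0..})"
proof -
  have "((\<lambda>x. integral {0..x} (\<lambda>y. - 2 * l * exp (- bigQ q y) * eta_term q l n y))
     has_real_derivative - 2 * l * exp (- bigQ q x) * eta_term q l n x) (at x within {0..})"
    by (rule has_real_derivative_integral_from_0)
      (use assms in \<open>auto intro!: continuous_intros continuous_on_bigQ[OF q] cont_eta_term\<close>)
  then show ?thesis
    by (simp add: flux_term_Suc[abs_def] del: flux_term.simps)
qed

lemma exp_bigQ_bound:
  obtains K where "K \<ge> 1" "\<And>x. 0 \<le> x \<Longrightarrow> x \<le> b \<Longrightarrow> exp (bigQ q x) \<le> K"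
    "\<And>x. 0 \<le> x \<Longrightarrow> x \<le> b \<Longrightarrow> exp (- bigQ q x) \<le> K"
proof -
  obtain A where A: "\<And>x. x \<in> {0..b} \<Longrightarrow> \<bar>bigQ q x\<bar> \<le> A"
    using abs_bounded_on_Icc[OF continuous_on_subset[OF continuous_on_bigQ[OF q]], of 0 b]
    by (metis atLeastAtMost_iff atLeast_iff subsetI)
  show ?thesis
    by (rule that[of "exp \<bar>A\<bar>"]) (use A in fastforce)+
qed

text \<open>Every passage from \<open>n\<close> to \<open>n + 1\<close> integrates once more against bounded coefficients; keeping
  only one of the two integrations gives a factor \<open>x / (n + 1)\<close>, hence the factorial. This makes the
  series of the terms and of their derivatives converge uniformly on \<open>{0..b}\<close>.\<close>

lemma flux_term_bound:
  assumes K: "K \<ge> 0" "\<And>x. 0 \<le> x \<Longrightarrow> x \<le> b \<Longrightarrow> exp (bigQ q x) \<le> K"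
    "\<And>x. 0 \<le> x \<Longrightarrow> x \<le> b \<Longrightarrow> 2 * \<bar>l\<bar> * exp (- bigQ q x) \<le> K" and b: "b \<ge> 0"
  shows "0 \<le> x \<Longrightarrow> x \<le> b \<Longrightarrow> \<bar>flux_term q l n x\<bar> \<le> (K\<^sup>2 * b) ^ n * x ^ n / fact n"
    "0 \<le> x \<Longrightarrow> x \<le> b \<Longrightarrow> \<bar>eta_term q l n x\<bar> \<le> K * b * (K\<^sup>2 * b) ^ n * x ^ n / fact n"
proof (induction n arbitrary: x)
  case 0
  { case 1 then show ?case by simp }
  { case 2
    have "\<bar>integral {0..x} (\<lambda>z. exp (bigQ q z) * flux_term q l 0 z)\<bar> \<le> K * x ^ Suc 0 / Suc 0"
      by (rule integral_bound_power) (use 2 K cont_expQ in auto)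
    also have "\<dots> \<le> K * b" using 2 K by (simp add: mult_left_mono)
    finally show ?case by (simp add: eta_term_def) }
next
  case (Suc n)
  have flux: "\<bar>flux_term q l (Suc n) x\<bar> \<le> (K\<^sup>2 * b) ^ Suc n * x ^ Suc n / fact (Suc n)"
    if x: "0 \<le> x" "x \<le> b" for x
  proof -
    have "\<bar>integral {0..x} (\<lambda>y. - 2 * l * exp (- bigQ q y) * eta_term q l n y)\<bar>
       \<le> (K * (K * b * (K\<^sup>2 * b) ^ n) / fact n) * x ^ Suc n / Suc n"
    proof (rule integral_bound_power)
      show "continuous_on {0..} (\<lambda>y. - 2 * l * exp (- bigQ q y) * eta_term q l n y)"
        by (intro continuous_intros continuous_on_bigQ[OF q] cont_eta_term)
      fix y assume y: "0 \<le> y" "y \<le> x"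
      have "\<bar>- 2 * l * exp (- bigQ q y) * eta_term q l n y\<bar>
          = (2 * \<bar>l\<bar> * exp (- bigQ q y)) * \<bar>eta_term q l n y\<bar>" by (simp add: abs_mult)
      also have "\<dots> \<le> K * (K * b * (K\<^sup>2 * b) ^ n * y ^ n / fact n)"
        using y x K b by (intro mult_mono Suc.IH) auto
      finally show "\<bar>- 2 * l * exp (- bigQ q y) * eta_term q l n y\<bar>
         \<le> K * (K * b * (K\<^sup>2 * b) ^ n) / fact n * y ^ n" by simp
    qed (use x in auto)
    then show ?thesis
      by (simp add: flux_term_Suc power2_eq_square field_simps del: flux_term.simps)
  qed
  { case 1 then show ?case by (rule flux) }
  { case 2
    have "\<bar>integral {0..x} (\<lambda>z. exp (bigQ q z) * flux_term q l (Suc n) z)\<bar>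
       \<le> (K * (K\<^sup>2 * b) ^ Suc n / fact (Suc n)) * x ^ Suc (Suc n) / Suc (Suc n)"
    proof (rule integral_bound_power)
      show "continuous_on {0..} (\<lambda>z. exp (bigQ q z) * flux_term q l (Suc n) z)"
        by (intro continuous_on_mult cont_expQ cont_flux_term)
      fix y assume y: "0 \<le> y" "y \<le> x"
      have "\<bar>exp (bigQ q y) * flux_term q l (Suc n) y\<bar> = exp (bigQ q y) * \<bar>flux_term q l (Suc n) y\<bar>"
        by (simp add: abs_mult)
      also have "\<dots> \<le> K * ((K\<^sup>2 * b) ^ Suc n * y ^ Suc n / fact (Suc n))"
        using y 2 K b by (intro mult_mono flux) auto
      finally show "\<bar>exp (bigQ q y) * flux_term q l (Suc n) y\<bar>
          \<le> K * (K\<^sup>2 * b) ^ Suc n / fact (Suc n) * y ^ Suc n" by (simp del: power_Suc fact_Suc)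
    qed (use 2 in auto)
    also have "\<dots> \<le> (K * (K\<^sup>2 * b) ^ Suc n / fact (Suc n)) * x ^ Suc (Suc n) / 1"
      using 2 K b by (intro divide_left_mono mult_nonneg_nonneg) auto
    also have "\<dots> = (K * (K\<^sup>2 * b) ^ Suc n / fact (Suc n)) * x ^ Suc n * x" by simp
    also have "\<dots> \<le> (K * (K\<^sup>2 * b) ^ Suc n / fact (Suc n)) * x ^ Suc n * b"
      using 2 K b by (intro mult_left_mono mult_nonneg_nonneg) auto
    finally show ?case by (simp add: eta_term_def mult_ac del: power_Suc fact_Suc flux_term.simps) }
qed

lemma eta_solution_exists: "\<exists>u. eta_solution q l u"
proof -
  define u where "u = (\<lambda>x. \<Sum>n. eta_term q l n x)"
  define v where "v = (\<lambda>x. \<Sum>n. flux_term q l n x)"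
  have main: "(u has_real_derivative exp (bigQ q x) * v x) (at x within {0..}) \<and>
     (v has_real_derivative - 2 * l * exp (- bigQ q x) * u x) (at x within {0..})"
    if x: "x \<ge> 0" for x
  proof -
    \<comment> \<open>the series are differentiated termwise on \<open>[0, x + 1]\<close>, where the coefficients are bounded\<close>
    define b where "b = x + 1"
    have b: "b \<ge> 0" "x < b" using x by (auto simp: b_def)
    obtain K0 where K0: "K0 \<ge> 1" "\<And>x. 0 \<le> x \<Longrightarrow> x \<le> b \<Longrightarrow> exp (bigQ q x) \<le> K0"
      "\<And>x. 0 \<le> x \<Longrightarrow> x \<le> b \<Longrightarrow> exp (- bigQ q x) \<le> K0" by (rule exp_bigQ_bound[of b]) blast
    define K where "K = (1 + 2 * \<bar>l\<bar>) * K0"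
    have K: "K \<ge> 0" "\<And>x. 0 \<le> x \<Longrightarrow> x \<le> b \<Longrightarrow> exp (bigQ q x) \<le> K"
      "\<And>x. 0 \<le> x \<Longrightarrow> x \<le> b \<Longrightarrow> 2 * \<bar>l\<bar> * exp (- bigQ q x) \<le> K"
    proof -
      show "K \<ge> 0" using K0(1) by (simp add: K_def)
      fix x assume x: "0 \<le> x" "x \<le> b"
      have "0 \<le> \<bar>l\<bar> * K0" using K0(1) by simp
      then show "exp (bigQ q x) \<le> K" using K0(2)[OF x] by (simp add: K_def algebra_simps)
      have "2 * \<bar>l\<bar> * exp (- bigQ q x) \<le> 2 * \<bar>l\<bar> * K0"
        using K0(3)[OF x] by (intro mult_left_mono) auto
      then show "2 * \<bar>l\<bar> * exp (- bigQ q x) \<le> K" using K0(1) by (simp add: K_def algebra_simps)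
    qed
    have bd: "\<bar>flux_term q l n y\<bar> \<le> (K\<^sup>2 * b) ^ n * y ^ n / fact n"
      "\<bar>eta_term q l n y\<bar> \<le> K * b * (K\<^sup>2 * b) ^ n * y ^ n / fact n" if "0 \<le> y" "y \<le> b" for n y
      using flux_term_bound[of K b l y n] K b that by blast+
    define C where "C = K\<^sup>2 * b"
    have C: "C \<ge> 0" using b by (simp add: C_def)
    have smC: "summable (\<lambda>n. D * ((C * b) ^ n / fact n))" for D
      by (intro summable_mult) (use summable_exp[of "C * b"] in \<open>simp add: field_simps\<close>)
    have bd1: "norm (flux_term q l n y) \<le> 1 * ((C * b) ^ n / fact n)"
      if "0 \<le> y" "y \<le> b" for n y
    proof -
      have "norm (flux_term q l n y) \<le> C ^ n * y ^ n / fact n"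
        using bd(1)[OF that] by (simp add: C_def)
      also have "\<dots> \<le> C ^ n * b ^ n / fact n"
        using that C by (intro divide_right_mono mult_left_mono power_mono) auto
      finally show ?thesis by (simp add: power_mult_distrib)
    qed
    have bd2: "norm (eta_term q l n y) \<le> (K * b) * ((C * b) ^ n / fact n)"
      if "0 \<le> y" "y \<le> b" for n y
    proof -
      have "norm (eta_term q l n y) \<le> (K * b * C ^ n) * y ^ n / fact n"
        using bd(2)[OF that] by (simp add: C_def)
      also have "\<dots> \<le> (K * b * C ^ n) * b ^ n / fact n"
        using that C K b by (intro divide_right_mono mult_left_mono power_mono mult_nonneg_nonneg) auto
      finally show ?thesis by (simp add: power_mult_distrib)
    qed
    have sm1: "summable (\<lambda>n. flux_term q l n y)" if "0 \<le> y" "y \<le> b" for y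
      by (rule summable_comparison_test[OF _ smC]) (use bd1[OF that] in blast)
    have sm2: "summable (\<lambda>n. eta_term q l n y)" if "0 \<le> y" "y \<le> b" for y
      by (rule summable_comparison_test[OF _ smC]) (use bd2[OF that] in blast)
    have sub: "at x within {0..b} = at x within {0..}"
      by (rule at_within_nhd[where S = "{..<b}"]) (use b in auto)
    have D1: "(eta_term q l n has_real_derivative exp (bigQ q y) * flux_term q l n y) (at y within {0..b})"
      if "y \<in> {0..b}" for n y
      by (rule has_field_derivative_subset[OF eta_term_deriv]) (use that in auto)
    have D2: "(flux_term q l n has_real_derivative
        (if n = 0 then 0 else - 2 * l * exp (- bigQ q y) * eta_term q l (n - 1) y)) (at y within {0..b})"
      if "y \<in> {0..b}" for n y
    proof (cases n)
      case (Suc m)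
      have "(flux_term q l (Suc m) has_real_derivative - 2 * l * exp (- bigQ q y) * eta_term q l m y) (at y within {0..b})"
        by (rule has_field_derivative_subset[OF flux_term_deriv]) (use that in auto)
      then show ?thesis using Suc by (simp del: flux_term.simps)
    qed auto
    have U1: "uniform_limit {0..b} (\<lambda>n y. \<Sum>i<n. exp (bigQ q y) * flux_term q l i y)
        (\<lambda>y. \<Sum>i. exp (bigQ q y) * flux_term q l i y) sequentially"
    proof (rule Weierstrass_m_test[OF _ smC[of K]])
      fix n y assume y: "y \<in> {0..b}"
      have "norm (exp (bigQ q y) * flux_term q l n y) = exp (bigQ q y) * norm (flux_term q l n y)"
        by (simp add: abs_mult)
      also have "\<dots> \<le> K * (1 * ((C * b) ^ n / fact n))"
        using y K by (intro mult_mono bd1) auto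
      finally show "norm (exp (bigQ q y) * flux_term q l n y) \<le> K * ((C * b) ^ n / fact n)" by simp
    qed
    define g where "g = (\<lambda>y n. if n = 0 then 0 else - 2 * l * exp (- bigQ q y) * eta_term q l (n - 1) y)"
    have U2: "uniform_limit {0..b} (\<lambda>n y. \<Sum>i<n. g y i) (\<lambda>y. \<Sum>i. g y i) sequentially"
    proof (rule Weierstrass_m_test[where M = "\<lambda>n. if n = 0 then 0 else K * (K * b) * ((C * b) ^ (n-1) / fact (n-1))"])
      fix n y assume y: "y \<in> {0..b}"
      have "\<bar>- 2 * l * exp (- bigQ q y) * eta_term q l m y\<bar>
         \<le> K * (K * b) * ((C * b) ^ m / fact m)" for m
      proof -
        have "\<bar>- 2 * l * exp (- bigQ q y) * eta_term q l m y\<bar>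
           = (2 * \<bar>l\<bar> * exp (- bigQ q y)) * norm (eta_term q l m y)"
          by (simp add: abs_mult)
        also have "\<dots> \<le> K * ((K * b) * ((C * b) ^ m / fact m))"
          using y K b by (intro mult_mono bd2) auto
        finally show ?thesis by (simp add: mult_ac)
      qed
      then show "norm (g y n) \<le> (if n = 0 then 0 else K * (K * b) * ((C * b) ^ (n-1) / fact (n-1)))"
        by (simp add: g_def)
    next
      show "summable (\<lambda>n. if n = 0 then 0 else K * (K * b) * ((C * b) ^ (n-1) / fact (n-1)))"
        by (subst summable_Suc_iff[symmetric]) (use smC in simp)
    qed
    obtain u1 where u1: "\<And>y. y \<in> {0..b} \<Longrightarrow> (\<lambda>n. eta_term q l n y) sums u1 y"
      "\<And>y. y \<in> {0..b} \<Longrightarrow> (u1 has_real_derivative (\<Sum>i. exp (bigQ q y) * flux_term q l i y)) (at y within {0..b})"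
      using has_field_derivative_series[OF _ D1 U1, of 0] sm2[of 0] b by fastforce
    obtain v1 where v1: "\<And>y. y \<in> {0..b} \<Longrightarrow> (\<lambda>n. flux_term q l n y) sums v1 y"
      "\<And>y. y \<in> {0..b} \<Longrightarrow> (v1 has_real_derivative (\<Sum>i. g y i)) (at y within {0..b})"
    proof -
      have "\<exists>v1. \<forall>y\<in>{0..b}. (\<lambda>n. flux_term q l n y) sums v1 y \<and>
          (v1 has_real_derivative (\<Sum>i. g y i)) (at y within {0..b})"
      proof (rule has_field_derivative_series[OF _ _ U2])
        show "(flux_term q l n has_real_derivative g y n) (at y within {0..b})" if "y \<in> {0..b}" for n y
          using D2[OF that] by (simp only: g_def)
        show "summable (\<lambda>n. flux_term q l n 0)" "(0::real) \<in> {0..b}" using sm1[of 0] b by auto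
      qed auto
      then show ?thesis using that by blast
    qed
    have uu: "u y = u1 y" and vv: "v y = v1 y" if "y \<in> {0..b}" for y
      using u1(1)[OF that] v1(1)[OF that] by (auto simp: u_def v_def sums_iff)
    have s1: "(\<Sum>i. exp (bigQ q x) * flux_term q l i x) = exp (bigQ q x) * v x"
      unfolding v_def by (rule suminf_mult) (use sm1 b x in auto)
    have s2: "(\<Sum>i. g x i) = - 2 * l * exp (- bigQ q x) * u x"
    proof -
      have "(\<lambda>i. - 2 * l * exp (- bigQ q x) * eta_term q l i x) sums (- 2 * l * exp (- bigQ q x) * u x)"
        unfolding u_def by (intro sums_mult summable_sums sm2) (use b x in auto)
      then have "(\<lambda>i. g x (Suc i)) sums (- 2 * l * exp (- bigQ q x) * u x)"
        by (simp add: g_def)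
      then have "(\<lambda>i. g x i) sums (- 2 * l * exp (- bigQ q x) * u x + g x 0)"
        by (simp only: sums_Suc_iff diff_add_cancel add_diff_cancel_right')
      then show ?thesis by (simp add: sums_iff g_def)
    qed
    have "(u1 has_real_derivative exp (bigQ q x) * v x) (at x within {0..})"
      using u1(2)[of x] x b by (simp add: s1 sub)
    then have 1: "(u has_real_derivative exp (bigQ q x) * v x) (at x within {0..})"
      by (rule has_field_derivative_transform_within[where d = 1]) (use x uu in \<open>auto simp: b_def dist_real_def\<close>)
    have "(v1 has_real_derivative - 2 * l * exp (- bigQ q x) * u x) (at x within {0..})"
      using v1(2)[of x] x b by (simp add: s2 sub)
    then have 2: "(v has_real_derivative - 2 * l * exp (- bigQ q x) * u x) (at x within {0..})"
      by (rule has_field_derivative_transform_within[where d = 1]) (use x vv in \<open>auto simp: b_def dist_real_def\<close>)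
    from 1 2 show ?thesis ..
  qed
  have "u 0 = 0" by (simp add: u_def eta_term_def)
  moreover have "v 0 = 1"
  proof -
    have "flux_term q l n 0 = (if n = 0 then 1 else 0)" for n by (cases n) auto
    then show ?thesis using sums_single[of 0 "\<lambda>_. 1::real"] by (simp add: v_def sums_iff)
  qed
  ultimately have "eta_system q l u v"
    using main unfolding eta_system_def by blast
  then show ?thesis
    using eta_solution_iff_system[OF q] by blast
qed

end

section \<open>Dependence on the spectral parameter\<close>

text \<open>Gronwall's inequality for \<open>E = w\<^sup>2 + z\<^sup>2\<close>, which satisfies \<open>\<bar>E'\<bar> \<le> C E + \<rho>\<^sup>2\<close>; the two parts
  integrate it forward and backward. With \<open>r = 0\<close> the first part bounds solutions locally uniformly in
  \<open>l\<close> and the second one shows that \<open>E\<close> has no zeros unless \<open>E 0 = 0\<close>. The forcing \<open>r\<close> allows \<open>w\<close> to be the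
  difference of two solutions with different \<open>l\<close>, which gives continuity in the parameter.\<close>

lemma energy_estimate:
  assumes K: "\<And>x. 0 \<le> x \<Longrightarrow> x \<le> b \<Longrightarrow> exp (bigQ q x) \<le> K"
    "\<And>x. 0 \<le> x \<Longrightarrow> x \<le> b \<Longrightarrow> exp (- bigQ q x) \<le> K"
    and D: "\<And>x. 0 \<le> x \<Longrightarrow> x \<le> b \<Longrightarrow> (w has_real_derivative exp (bigQ q x) * z x) (at x within {0..})"
    "\<And>x. 0 \<le> x \<Longrightarrow> x \<le> b \<Longrightarrow>
       (z has_real_derivative - 2 * l * exp (- bigQ q x) * w x + r x) (at x within {0..})"
    and r: "\<And>x. 0 \<le> x \<Longrightarrow> x \<le> b \<Longrightarrow> \<bar>r x\<bar> \<le> \<rho>"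
    and l: "\<bar>l\<bar> \<le> \<Lambda>" and x: "0 \<le> x" "x \<le> b"
  shows "(w x)\<^sup>2 + (z x)\<^sup>2 \<le> ((w 0)\<^sup>2 + (z 0)\<^sup>2 + \<rho>\<^sup>2 * b) * exp ((K + 2 * \<Lambda> * K + 1) * b)"
    and "((w 0)\<^sup>2 + (z 0)\<^sup>2) \<le> ((w x)\<^sup>2 + (z x)\<^sup>2 + \<rho>\<^sup>2 * b) * exp ((K + 2 * \<Lambda> * K + 1) * b)"
proof -
  define E where "E = (\<lambda>x. (w x)\<^sup>2 + (z x)\<^sup>2)"
  define C where "C = K + 2 * \<Lambda> * K + 1"
  define E' where "E' = (\<lambda>x. 2 * w x * (exp (bigQ q x) * z x)
        + 2 * z x * (- 2 * l * exp (- bigQ q x) * w x + r x))"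
  have K0: "K > 0" using K(1)[of 0] x exp_gt_zero by (auto intro: less_le_trans[of 0 1])
  have L0: "\<Lambda> \<ge> 0" using l by simp
  have C0: "C \<ge> 0" using K0 L0 by (simp add: C_def)
  have dE: "(E has_real_derivative E' x) (at x within {0..})" if "0 \<le> x" "x \<le> b" for x
    unfolding E_def E'_def
    by (rule derivative_eq_intros refl D that)+ (auto simp: algebra_simps)
  have E'_le: "\<bar>E' x\<bar> \<le> C * E x + \<rho>\<^sup>2" if x: "0 \<le> x" "x \<le> b" for x
  proof -
    have wz: "2 * \<bar>w x\<bar> * \<bar>z x\<bar> \<le> E x"
      using sum_squares_bound[of "\<bar>w x\<bar>" "\<bar>z x\<bar>"] by (simp add: E_def)
    have co: "\<bar>exp (bigQ q x) - 2 * l * exp (- bigQ q x)\<bar> \<le> K + 2 * \<Lambda> * K"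
    proof -
      have "\<bar>exp (bigQ q x) - 2 * l * exp (- bigQ q x)\<bar> \<le> exp (bigQ q x) + 2 * (\<bar>l\<bar> * exp (- bigQ q x))"
        using abs_triangle_ineq4[of "exp (bigQ q x)" "2 * l * exp (- bigQ q x)"] by (simp add: abs_mult)
      also have "\<dots> \<le> K + 2 * (\<Lambda> * K)"
        using K[OF x] l L0 by (intro add_mono mult_left_mono mult_mono) auto
      finally show ?thesis by simp
    qed
    have "2 * \<bar>z x\<bar> * \<bar>r x\<bar> \<le> \<bar>z x\<bar>\<^sup>2 + \<bar>r x\<bar>\<^sup>2" by (rule sum_squares_bound)
    also have "\<dots> \<le> E x + \<rho>\<^sup>2"
    proof -
      have "\<bar>r x\<bar>\<^sup>2 \<le> \<rho>\<^sup>2" using r[OF x] by (intro power_mono) auto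
      then show ?thesis by (simp add: E_def add_increasing)
    qed
    finally have zr: "2 * \<bar>z x\<bar> * \<bar>r x\<bar> \<le> E x + \<rho>\<^sup>2" .
    have "E' x = (2 * w x * z x) * (exp (bigQ q x) - 2 * l * exp (- bigQ q x)) + 2 * z x * r x"
      by (simp add: E'_def algebra_simps)
    then have "\<bar>E' x\<bar> \<le> (2 * \<bar>w x\<bar> * \<bar>z x\<bar>) * \<bar>exp (bigQ q x) - 2 * l * exp (- bigQ q x)\<bar> + 2 * \<bar>z x\<bar> * \<bar>r x\<bar>"
      using abs_triangle_ineq[of "(2 * w x * z x) * (exp (bigQ q x) - 2 * l * exp (- bigQ q x))" "2 * z x * r x"]
      by (simp add: abs_mult mult.assoc)
    also have "\<dots> \<le> E x * (K + 2 * \<Lambda> * K) + (E x + \<rho>\<^sup>2)"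
      using wz co zr by (intro add_mono mult_mono) (auto simp: E_def)
    finally show ?thesis by (simp add: C_def algebra_simps)
  qed
  have b: "b \<ge> 0" using x by simp
  have ee: "exp (C * x) \<le> exp (C * b)" using x C0 by (simp add: mult_left_mono)
  have "E x \<le> (E 0 + \<rho>\<^sup>2 * x) * exp (C * x)"
    by (rule gronwall_deriv[OF dE _ _ C0 x]) (use E'_le in \<open>auto simp: abs_le_iff\<close>)
  also have "\<dots> \<le> (E 0 + \<rho>\<^sup>2 * b) * exp (C * b)"
    using x ee by (intro mult_mono add_mono) (auto simp: E_def mult_left_mono)
  finally show "(w x)\<^sup>2 + (z x)\<^sup>2 \<le> ((w 0)\<^sup>2 + (z 0)\<^sup>2 + \<rho>\<^sup>2 * b) * exp ((K + 2 * \<Lambda> * K + 1) * b)"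
    by (simp add: E_def C_def)
  have "E 0 * exp (C * 0) + \<rho>\<^sup>2 * exp (C * b) * 0 \<le> E x * exp (C * x) + \<rho>\<^sup>2 * exp (C * b) * x"
  proof (rule mono_from_deriv[where f = "\<lambda>x. E x * exp (C * x) + \<rho>\<^sup>2 * exp (C * b) * x"])
    fix y assume y: "0 \<le> y" "y \<le> x"
    have Ey: "(E has_real_derivative E' y) (at y within {0..})" using dE y x by auto
    show "((\<lambda>x. E x * exp (C * x) + \<rho>\<^sup>2 * exp (C * b) * x) has_real_derivative
        exp (C * y) * (E' y + C * E y) + \<rho>\<^sup>2 * exp (C * b)) (at y within {0..})"
      by (rule derivative_eq_intros refl Ey)+ (auto simp: algebra_simps)
    have "- \<rho>\<^sup>2 \<le> E' y + C * E y" using E'_le[of y] y x by (auto simp: abs_le_iff)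
    then have "exp (C * y) * (- \<rho>\<^sup>2) \<le> exp (C * y) * (E' y + C * E y)"
      by (intro mult_left_mono) auto
    moreover have "exp (C * y) * \<rho>\<^sup>2 \<le> exp (C * b) * \<rho>\<^sup>2"
      using y x C0 by (intro mult_right_mono) (auto simp: mult_left_mono)
    ultimately show "0 \<le> exp (C * y) * (E' y + C * E y) + \<rho>\<^sup>2 * exp (C * b)"
      by (simp add: mult.commute)
  qed (use x in auto)
  also have "\<dots> \<le> E x * exp (C * b) + \<rho>\<^sup>2 * exp (C * b) * b"
    using x ee by (intro add_mono mult_left_mono) (auto simp: E_def)
  finally show "((w 0)\<^sup>2 + (z 0)\<^sup>2) \<le> ((w x)\<^sup>2 + (z x)\<^sup>2 + \<rho>\<^sup>2 * b) * exp ((K + 2 * \<Lambda> * K + 1) * b)"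
    by (simp add: E_def C_def algebra_simps)
qed

text \<open>The component \<open>e\<^sup>-\<^sup>Q eta'\<close> of the first-order system.\<close>

definition flux :: "(real \<Rightarrow> real) \<Rightarrow> real \<Rightarrow> real \<Rightarrow> real" where
  "flux q l = (SOME v. eta_system q l (eta q l) v)"

context
  fixes q :: "real \<Rightarrow> real"
  assumes q: "continuous_on {0..} q"
begin

lemma eta_system_eta: "eta_system q l (eta q l) (flux q l)"
proof -
  have "eta_solution q l (eta q l)"
    unfolding eta_def by (rule someI_ex[OF eta_solution_exists[OF q]])
  then show ?thesis
    unfolding flux_def eta_solution_iff_system[OF q] by (rule someI_ex)
qed

lemma eta_0: "eta q l 0 = 0" and flux_0: "flux q l 0 = 1"
  and eta_deriv: "x \<ge> 0 \<Longrightarrow> (eta q l has_real_derivative exp (bigQ q x) * flux q l x) (at x within {0..})"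
  and flux_deriv: "x \<ge> 0 \<Longrightarrow>
     (flux q l has_real_derivative - 2 * l * exp (- bigQ q x) * eta q l x) (at x within {0..})"
  using eta_system_eta[of l] unfolding eta_system_def by auto

lemma continuous_on_eta: "continuous_on {0..} (eta q l)"
  and continuous_on_flux: "continuous_on {0..} (flux q l)"
  by (rule DERIV_continuous_on[OF eta_deriv] DERIV_continuous_on[OF flux_deriv]; simp)+

lemma eta_flux_bounded:
  assumes "b \<ge> 0"
  obtains U where "U \<ge> 0" "\<And>l x. \<bar>l\<bar> \<le> \<Lambda> \<Longrightarrow> 0 \<le> x \<Longrightarrow> x \<le> b \<Longrightarrow> \<bar>eta q l x\<bar> \<le> U"
    "\<And>l x. \<bar>l\<bar> \<le> \<Lambda> \<Longrightarrow> 0 \<le> x \<Longrightarrow> x \<le> b \<Longrightarrow> \<bar>flux q l x\<bar> \<le> U"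
proof -
  obtain K where K: "K \<ge> 1" "\<And>x. 0 \<le> x \<Longrightarrow> x \<le> b \<Longrightarrow> exp (bigQ q x) \<le> K"
    "\<And>x. 0 \<le> x \<Longrightarrow> x \<le> b \<Longrightarrow> exp (- bigQ q x) \<le> K"
    by (rule exp_bigQ_bound[OF q, of b]) blast
  define U where "U = sqrt (exp ((K + 2 * \<Lambda> * K + 1) * b))"
  have U: "(eta q l x)\<^sup>2 + (flux q l x)\<^sup>2 \<le> U\<^sup>2" if "\<bar>l\<bar> \<le> \<Lambda>" "0 \<le> x" "x \<le> b" for l x
  proof -
    have "(eta q l x)\<^sup>2 + (flux q l x)\<^sup>2
       \<le> ((eta q l 0)\<^sup>2 + (flux q l 0)\<^sup>2 + 0\<^sup>2 * b) * exp ((K + 2 * \<Lambda> * K + 1) * b)"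
    proof (rule energy_estimate(1)[where r = "\<lambda>_. 0" and l = l])
      show "(flux q l has_real_derivative - 2 * l * exp (- bigQ q y) * eta q l y + 0) (at y within {0..})"
        if "0 \<le> y" for y
        using flux_deriv[OF that, of l] by simp
    qed (use K eta_deriv that in auto)
    then show ?thesis by (simp add: U_def eta_0 flux_0)
  qed
  show ?thesis
  proof (rule that[of U])
    show "U \<ge> 0" by (simp add: U_def)
    fix l x :: real assume *: "\<bar>l\<bar> \<le> \<Lambda>" "0 \<le> x" "x \<le> b"
    have "(eta q l x)\<^sup>2 \<le> U\<^sup>2" "(flux q l x)\<^sup>2 \<le> U\<^sup>2"
      using U[OF *] by (smt (verit) zero_le_power2)+
    then show "\<bar>eta q l x\<bar> \<le> U" "\<bar>flux q l x\<bar> \<le> U"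
      using \<open>U \<ge> 0\<close> by (auto simp: abs_le_square_iff[symmetric])
  qed
qed

lemma eta_lipschitz_param:
  assumes "b \<ge> 0"
  obtains L where "L \<ge> 0" "\<And>l l' x. \<bar>l\<bar> \<le> \<Lambda> \<Longrightarrow> \<bar>l'\<bar> \<le> \<Lambda> \<Longrightarrow> 0 \<le> x \<Longrightarrow> x \<le> b \<Longrightarrow>
      \<bar>eta q l x - eta q l' x\<bar> \<le> L * \<bar>l - l'\<bar>"
proof -
  obtain K where K: "K \<ge> 1" "\<And>x. 0 \<le> x \<Longrightarrow> x \<le> b \<Longrightarrow> exp (bigQ q x) \<le> K"
    "\<And>x. 0 \<le> x \<Longrightarrow> x \<le> b \<Longrightarrow> exp (- bigQ q x) \<le> K"
    by (rule exp_bigQ_bound[OF q, of b]) blast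
  obtain U where U: "U \<ge> 0" "\<And>l x. \<bar>l\<bar> \<le> \<Lambda> \<Longrightarrow> 0 \<le> x \<Longrightarrow> x \<le> b \<Longrightarrow> \<bar>eta q l x\<bar> \<le> U"
    by (rule eta_flux_bounded[OF assms, of \<Lambda>]) blast
  define A where "A = b * exp ((K + 2 * \<Lambda> * K + 1) * b)"
  have A: "A \<ge> 0" using assms by (simp add: A_def)
  have *: "\<bar>eta q l x - eta q l' x\<bar> \<le> (2 * K * U * sqrt A) * \<bar>l - l'\<bar>"
    if l: "\<bar>l\<bar> \<le> \<Lambda>" "\<bar>l'\<bar> \<le> \<Lambda>" and x: "0 \<le> x" "x \<le> b" for l l' x
  proof -
    define \<rho> where "\<rho> = 2 * \<bar>l - l'\<bar> * K * U"
    define r where "r = (\<lambda>y. - 2 * (l - l') * exp (- bigQ q y) * eta q l' y)"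
    have "(eta q l x - eta q l' x)\<^sup>2 + (flux q l x - flux q l' x)\<^sup>2
       \<le> ((eta q l 0 - eta q l' 0)\<^sup>2 + (flux q l 0 - flux q l' 0)\<^sup>2 + \<rho>\<^sup>2 * b) * exp ((K + 2 * \<Lambda> * K + 1) * b)"
    proof (rule energy_estimate(1)[where r = r and l = l])
      fix y assume y: "0 \<le> y" "y \<le> b"
      show "((\<lambda>x. eta q l x - eta q l' x) has_real_derivative
         exp (bigQ q y) * (flux q l y - flux q l' y)) (at y within {0..})"
        by (rule derivative_eq_intros eta_deriv refl y)+ (simp add: algebra_simps)
      show "((\<lambda>x. flux q l x - flux q l' x) has_real_derivative
         - 2 * l * exp (- bigQ q y) * (eta q l y - eta q l' y) + r y) (at y within {0..})"
        by (rule derivative_eq_intros flux_deriv refl y)+ (simp add: r_def algebra_simps)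
      have "\<bar>r y\<bar> = 2 * \<bar>l - l'\<bar> * (exp (- bigQ q y) * \<bar>eta q l' y\<bar>)"
        unfolding r_def abs_mult by simp
      also have "\<dots> \<le> 2 * \<bar>l - l'\<bar> * (K * U)"
        using K y U l by (intro mult_mono mult_left_mono) auto
      finally show "\<bar>r y\<bar> \<le> \<rho>" by (simp add: \<rho>_def)
    qed (use K l x in auto)
    also have "\<dots> = \<rho>\<^sup>2 * A" by (simp add: A_def eta_0 flux_0)
    finally have "(eta q l x - eta q l' x)\<^sup>2 \<le> \<rho>\<^sup>2 * A" by (smt (verit) zero_le_power2)
    also have "\<dots> = (\<rho> * sqrt A)\<^sup>2" using A by (simp add: power_mult_distrib)
    finally have "\<bar>eta q l x - eta q l' x\<bar> \<le> \<bar>\<rho> * sqrt A\<bar>" by (simp add: abs_le_square_iff)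
    also have "\<dots> = (2 * K * U * sqrt A) * \<bar>l - l'\<bar>"
      using A K U by (simp add: \<rho>_def abs_mult)
    finally show ?thesis .
  qed
  show ?thesis
    by (rule that[of "2 * K * U * sqrt A"]) (use * A K U in auto)
qed

lemma eta_flux_not_both_0:
  assumes "x \<ge> 0" "eta q l x = 0" "flux q l x = 0"
  shows False
proof -
  obtain K where K: "K \<ge> 1" "\<And>y. 0 \<le> y \<Longrightarrow> y \<le> x \<Longrightarrow> exp (bigQ q y) \<le> K"
    "\<And>y. 0 \<le> y \<Longrightarrow> y \<le> x \<Longrightarrow> exp (- bigQ q y) \<le> K"
    by (rule exp_bigQ_bound[OF q, of x]) blast
  have "(eta q l 0)\<^sup>2 + (flux q l 0)\<^sup>2
     \<le> ((eta q l x)\<^sup>2 + (flux q l x)\<^sup>2 + 0\<^sup>2 * x) * exp ((K + 2 * \<bar>l\<bar> * K + 1) * x)"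
  proof (rule energy_estimate(2)[where r = "\<lambda>_. 0" and l = l])
    show "(flux q l has_real_derivative - 2 * l * exp (- bigQ q y) * eta q l y + 0) (at y within {0..})"
      if "0 \<le> y" for y
      using flux_deriv[OF that, of l] by simp
  qed (use K eta_deriv assms(1) in auto)
  then show False using assms by (simp add: eta_0 flux_0)
qed

section \<open>Positivity and the bottom of the spectrum\<close>

text \<open>The flux starts at \<open>1\<close> and its derivative is bounded locally uniformly in \<open>l\<close>, so it stays
  positive on an interval that serves all \<open>l\<close> in a bounded set.\<close>

lemma eta_pos_near_0:
  obtains \<delta> where "\<delta> > 0" "\<And>l x. \<bar>l\<bar> \<le> \<Lambda> \<Longrightarrow> 0 < x \<Longrightarrow> x \<le> \<delta> \<Longrightarrow> eta q l x > 0"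
proof (cases "\<Lambda> \<ge> 0")
  case False
  then show ?thesis using that[of 1] by simp
next
  case True
  obtain K where K: "K \<ge> 1" "\<And>x. 0 \<le> x \<Longrightarrow> x \<le> 1 \<Longrightarrow> exp (bigQ q x) \<le> K"
    "\<And>x. 0 \<le> x \<Longrightarrow> x \<le> 1 \<Longrightarrow> exp (- bigQ q x) \<le> K"
    by (rule exp_bigQ_bound[OF q, of 1]) blast
  obtain U where U: "U \<ge> 0" "\<And>l x. \<bar>l\<bar> \<le> \<Lambda> \<Longrightarrow> 0 \<le> x \<Longrightarrow> x \<le> 1 \<Longrightarrow> \<bar>eta q l x\<bar> \<le> U"
    by (rule eta_flux_bounded[of 1 \<Lambda>]) (simp, blast)
  define c where "c = 2 * \<Lambda> * K * U"
  have c: "c \<ge> 0" using True K U by (simp add: c_def)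
  define \<delta> where "\<delta> = 1 / (c + 2)"
  have \<delta>: "\<delta> > 0" "\<delta> \<le> 1" "c * \<delta> < 1" using c by (auto simp: \<delta>_def field_simps)
  have "eta q l x > 0" if l: "\<bar>l\<bar> \<le> \<Lambda>" and x: "0 < x" "x \<le> \<delta>" for l x
  proof -
    have fl: "flux q l y > 0" if y: "0 \<le> y" "y \<le> \<delta>" for y
    proof -
      have "flux q l 0 + c * 0 \<le> flux q l y + c * y"
      proof (rule mono_from_deriv[where f = "\<lambda>y. flux q l y + c * y"])
        fix z assume z: "0 \<le> z" "z \<le> y"
        show "((\<lambda>y. flux q l y + c * y) has_real_derivative
           - 2 * l * exp (- bigQ q z) * eta q l z + c) (at z within {0..})"
          by (rule derivative_eq_intros flux_deriv refl z)+ simp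
        have "\<bar>- 2 * l * exp (- bigQ q z) * eta q l z\<bar> = 2 * \<bar>l\<bar> * exp (- bigQ q z) * \<bar>eta q l z\<bar>"
          by (simp add: abs_mult)
        also have "\<dots> \<le> 2 * \<Lambda> * K * U"
          using z y \<delta> l K U True by (intro mult_mono) auto
        finally show "0 \<le> - 2 * l * exp (- bigQ q z) * eta q l z + c" by (simp add: c_def abs_le_iff)
      qed (use y in auto)
      moreover have "c * y \<le> c * \<delta>" using y c by (intro mult_left_mono) auto
      ultimately show ?thesis using \<delta> by (simp add: flux_0)
    qed
    have "eta q l 0 < eta q l x"
    proof (rule DERIV_pos_imp_increasing_open[OF x(1)])
      fix y assume y: "0 < y" "y < x"
      have "at y within {0..} = at y" by (rule at_within_interior) (use y in auto)
      then show "\<exists>d. DERIV (eta q l) y :> d \<and> 0 < d"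
        using eta_deriv[of y l] fl[of y] y x by (auto intro!: exI[of _ "exp (bigQ q y) * flux q l y"])
    qed (use x in \<open>auto intro!: continuous_on_subset[OF continuous_on_eta]\<close>)
    then show ?thesis by (simp add: eta_0)
  qed
  then show ?thesis using that[OF \<delta>(1)] by blast
qed

lemma no_sign_change_iff: "no_sign_change (varphi q l) \<longleftrightarrow> (\<forall>x>0. eta q l x \<ge> 0)"
proof -
  obtain \<delta> where "\<delta> > 0" "\<And>l' x. \<bar>l'\<bar> \<le> \<bar>l\<bar> \<Longrightarrow> 0 < x \<Longrightarrow> x \<le> \<delta> \<Longrightarrow> eta q l' x > 0"
    using eta_pos_near_0 by blast
  then have "eta q l \<delta> > 0" by simp
  then show ?thesis
    using \<open>\<delta> > 0\<close> unfolding no_sign_change_def varphi_def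
    by (auto simp: zero_le_mult_iff mult_le_0_iff not_le dest: spec[of _ \<delta>])
qed

text \<open>A zero of a nonnegative solution would be a minimum, so solution and flux would vanish together.\<close>

lemma eta_nonneg_imp_pos:
  assumes "\<forall>x>0. eta q l x \<ge> 0" "x > 0"
  shows "eta q l x > 0"
proof (rule ccontr)
  assume "\<not> eta q l x > 0"
  then have z: "eta q l x = 0" using assms by (meson dual_order.antisym not_le)
  have "at x within {0..} = at x" by (rule at_within_interior) (use assms in auto)
  then have "DERIV (eta q l) x :> exp (bigQ q x) * flux q l x" using eta_deriv[of x l] assms by auto
  then have "exp (bigQ q x) * flux q l x = 0"
    by (rule DERIV_local_min[of _ _ _ x]) (use assms z in auto)
  then show False using eta_flux_not_both_0[of x l] z assms by auto
qed

lemma eta_0_nonneg: "x > 0 \<Longrightarrow> eta q 0 x \<ge> 0"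
proof -
  assume x: "x > 0"
  have fl: "flux q 0 y \<ge> 1" if "y \<ge> 0" for y
    using mono_from_deriv[of 0 y "flux q 0", OF _ _ flux_deriv] that by (simp add: flux_0)
  have "eta q 0 0 \<le> eta q 0 x"
    by (rule mono_from_deriv[OF _ _ eta_deriv]) (use x in \<open>auto intro!: mult_nonneg_nonneg order_trans[OF zero_le_one fl]\<close>)
  then show ?thesis by (simp add: eta_0)
qed

text \<open>If \<open>\<eta> > 0\<close>, then \<open>r = v / \<eta>\<close> solves the Riccati equation \<open>r' = - 2 l p - e\<^sup>Q r\<^sup>2\<close>. With \<open>s\<^sup>2 = 2 l\<close>
  this makes \<open>arctan (r / s)\<close> decrease at a rate of at least \<open>s k\<close> on \<open>[1, 2]\<close>, where \<open>k\<close> is a lower bound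
  of \<open>p\<close> and \<open>e\<^sup>Q\<close>. As \<open>arctan\<close> varies by less than \<open>pi\<close>, \<open>s k \<le> pi\<close>.\<close>

lemma no_sign_change_bdd_above: "bdd_above {l. \<forall>x>0. eta q l x \<ge> 0}"
proof -
  obtain K where K: "K \<ge> 1" "\<And>x. 0 \<le> x \<Longrightarrow> x \<le> 2 \<Longrightarrow> exp (bigQ q x) \<le> K"
    "\<And>x. 0 \<le> x \<Longrightarrow> x \<le> 2 \<Longrightarrow> exp (- bigQ q x) \<le> K"
    by (rule exp_bigQ_bound[OF q, of 2]) blast
  define k where "k = 1 / K"
  have k: "k > 0" "exp (bigQ q x) \<ge> k" "exp (- bigQ q x) \<ge> k" if "0 \<le> x" "x \<le> 2" for x
  proof -
    have "exp (bigQ q x) * exp (- bigQ q x) = 1" by (simp add: exp_add[symmetric])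
    then show "k > 0" "exp (bigQ q x) \<ge> k" "exp (- bigQ q x) \<ge> k"
      using K(1) K(2)[OF that] K(3)[OF that]
      by (simp_all add: k_def exp_minus field_simps)
  qed
  have k0: "k > 0" using k(1)[of 0] by simp
  have "l \<le> (pi / k)\<^sup>2 / 2" if l: "\<forall>x>0. eta q l x \<ge> 0" for l
  proof (cases "l > 0")
    case False
    moreover have "0 \<le> (pi / k)\<^sup>2 / 2" by simp
    ultimately show ?thesis by linarith
  next
    case True
    have pos: "eta q l x > 0" if "x > 0" for x using eta_nonneg_imp_pos[OF l that] .
    define s where "s = sqrt (2 * l)"
    have s: "s > 0" "s\<^sup>2 = 2 * l" using True by (auto simp: s_def)
    define r where "r = (\<lambda>x. flux q l x / eta q l x)"
    have dr: "(r has_real_derivative - s\<^sup>2 * exp (- bigQ q x) - exp (bigQ q x) * (r x)\<^sup>2) (at x within {0..})"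
      if x: "x > 0" for x
    proof -
      have "(r has_real_derivative ((- 2 * l * exp (- bigQ q x) * eta q l x) * eta q l x
          - flux q l x * (exp (bigQ q x) * flux q l x)) / (eta q l x * eta q l x)) (at x within {0..})"
        unfolding r_def using x pos[OF x] by (intro DERIV_divide flux_deriv eta_deriv) auto
      also have "((- 2 * l * exp (- bigQ q x) * eta q l x) * eta q l x
          - flux q l x * (exp (bigQ q x) * flux q l x)) / (eta q l x * eta q l x)
          = - s\<^sup>2 * exp (- bigQ q x) - exp (bigQ q x) * (r x)\<^sup>2"
      proof -
        have "s * s = 2 * l" using s(2) by (simp add: power2_eq_square)
        then show ?thesis
          using pos[OF x] by (simp add: r_def power2_eq_square diff_divide_distrib mult_ac)
      qed
      finally show ?thesis .
    qed
    define t where "t = 1 / s"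
    define G where "G = (\<lambda>x. - arctan (r x * t) - s * k * x)"
    define R where "R = (\<lambda>x. s\<^sup>2 * exp (- bigQ q x) + exp (bigQ q x) * (r x)\<^sup>2)"
    have "G 1 \<le> G 2"
    proof (rule mono_from_deriv[where f = G and a = 1 and b = 2 and f' = "\<lambda>x. s * R x / (s\<^sup>2 + (r x)\<^sup>2) - s * k"])
      fix x :: real assume x: "1 \<le> x" "x \<le> 2"
      have "(G has_real_derivative - (inverse (1 + (r x * t)\<^sup>2) * ((- s\<^sup>2 * exp (- bigQ q x) - exp (bigQ q x) * (r x)\<^sup>2) * t)) - s * k)
          (at x within {0..})"
        unfolding G_def
        by (rule derivative_eq_intros refl dr)+ (use x in auto)
      also have "- (inverse (1 + (r x * t)\<^sup>2) * ((- s\<^sup>2 * exp (- bigQ q x) - exp (bigQ q x) * (r x)\<^sup>2) * t)) - s * k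
          = s * R x / (s\<^sup>2 + (r x)\<^sup>2) - s * k"
      proof -
        have "1 + (r x * t)\<^sup>2 = (s\<^sup>2 + (r x)\<^sup>2) / s\<^sup>2"
          using s(1) by (simp add: t_def power_divide add_divide_distrib)
        moreover have "(- s\<^sup>2 * exp (- bigQ q x) - exp (bigQ q x) * (r x)\<^sup>2) = - R x"
          by (simp add: R_def)
        ultimately show ?thesis using s(1) by (simp add: t_def power2_eq_square)
      qed
      finally show "(G has_real_derivative (s * R x / (s\<^sup>2 + (r x)\<^sup>2) - s * k)) (at x within {0..})" .
      have "k * (s\<^sup>2 + (r x)\<^sup>2) \<le> R x"
      proof -
        have "k * s\<^sup>2 + k * (r x)\<^sup>2 \<le> exp (- bigQ q x) * s\<^sup>2 + exp (bigQ q x) * (r x)\<^sup>2"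
          using k[of x] x by (intro add_mono mult_right_mono) auto
        then show ?thesis by (simp add: R_def algebra_simps)
      qed
      moreover have "s\<^sup>2 + (r x)\<^sup>2 > 0" using s(1) by (simp add: sum_power2_gt_zero_iff)
      ultimately have "k \<le> R x / (s\<^sup>2 + (r x)\<^sup>2)" by (simp add: field_simps)
      then have "s * k \<le> s * (R x / (s\<^sup>2 + (r x)\<^sup>2))" using s by (intro mult_left_mono) auto
      then show "0 \<le> s * R x / (s\<^sup>2 + (r x)\<^sup>2) - s * k" by simp
    qed auto
    then have "s * k \<le> arctan (r 1 * t) - arctan (r 2 * t)" by (simp add: G_def algebra_simps)
    also have "\<dots> \<le> pi" using arctan_bounded[of "r 1 * t"] arctan_bounded[of "r 2 * t"] by simp
    finally have "s \<le> pi / k" using k0 by (simp add: field_simps)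
    then have "s\<^sup>2 \<le> (pi / k)\<^sup>2" using s by (intro power_mono) auto
    then show ?thesis using s by simp
  qed
  then show ?thesis by (intro bdd_aboveI) blast
qed

lemma lambda_c_eq: "lambda_c q = Sup {l. \<forall>x>0. eta q l x \<ge> 0}"
  by (simp add: lambda_c_def no_sign_change_iff)

lemma lambda_c_nonneg: "lambda_c q \<ge> 0"
  unfolding lambda_c_eq by (rule cSup_upper) (use eta_0_nonneg no_sign_change_bdd_above in auto)

lemma sign_change_above_lambda_c:
  assumes "l > lambda_c q"
  obtains x where "x > 0" "eta q l x < 0"
proof -
  have "l \<notin> {l. \<forall>x>0. eta q l x \<ge> 0}"
    using cSup_upper[OF _ no_sign_change_bdd_above, of l] assms unfolding lambda_c_eq by force
  then show ?thesis using that by (auto simp: not_le)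
qed

text \<open>The supremum is attained: nonnegativity passes to the limit from parameters below \<open>lambda_c\<close>.\<close>

lemma eta_lambda_c_pos:
  assumes "x > 0"
  shows "eta q (lambda_c q) x > 0"
proof -
  have "eta q (lambda_c q) x \<ge> 0" if x: "x > 0" for x
  proof (rule ccontr)
    assume neg: "\<not> eta q (lambda_c q) x \<ge> 0"
    obtain L where L: "L \<ge> 0" "\<And>l l' y. \<bar>l\<bar> \<le> \<bar>lambda_c q\<bar> + 1 \<Longrightarrow> \<bar>l'\<bar> \<le> \<bar>lambda_c q\<bar> + 1
        \<Longrightarrow> 0 \<le> y \<Longrightarrow> y \<le> x \<Longrightarrow> \<bar>eta q l y - eta q l' y\<bar> \<le> L * \<bar>l - l'\<bar>"
      by (rule eta_lipschitz_param[of x "\<bar>lambda_c q\<bar> + 1"]) (use x in simp, blast)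
    define e where "e = min 1 (- eta q (lambda_c q) x / (L + 1))"
    have e: "e > 0" using neg L by (simp add: e_def field_simps)
    obtain l where l: "\<forall>x>0. eta q l x \<ge> 0" "l > lambda_c q - e"
      using less_cSupD[of "{l. \<forall>x>0. eta q l x \<ge> 0}" "lambda_c q - e"] e eta_0_nonneg
      unfolding lambda_c_eq by auto
    have l2: "l \<le> lambda_c q"
      unfolding lambda_c_eq by (rule cSup_upper) (use l no_sign_change_bdd_above in auto)
    have ll: "\<bar>l - lambda_c q\<bar> < e" using l l2 by auto
    have "e \<le> 1" by (simp add: e_def)
    have "\<bar>eta q l x - eta q (lambda_c q) x\<bar> \<le> L * \<bar>l - lambda_c q\<bar>"
      by (rule L(2)) (use ll \<open>e \<le> 1\<close> x in auto)
    also have "\<dots> \<le> L * e" using ll L by (intro mult_left_mono) auto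
    also have "\<dots> < (L + 1) * e" using e by simp
    also have "\<dots> \<le> (L + 1) * (- eta q (lambda_c q) x / (L + 1))"
      using L by (intro mult_left_mono) (auto simp: e_def)
    also have "\<dots> = - eta q (lambda_c q) x" using L by simp
    finally show False using l(1) x by (smt (verit))
  qed
  then show ?thesis using eta_nonneg_imp_pos assms by blast
qed

end

section \<open>Square integrability of the ground state\<close>

definition eta_sq_integral :: "(real \<Rightarrow> real) \<Rightarrow> real \<Rightarrow> real \<Rightarrow> real" where
  "eta_sq_integral q l x = integral {0..x} (\<lambda>y. exp (- bigQ q y) * (eta q l y)\<^sup>2)"

definition scale_fn :: "(real \<Rightarrow> real) \<Rightarrow> real \<Rightarrow> real" where
  "scale_fn q x = integral {0..x} (\<lambda>y. exp (bigQ q y))"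

context
  fixes q :: "real \<Rightarrow> real"
  assumes q: "continuous_on {0..} q"
begin

lemma eta_sq_integral_deriv:
  "x \<ge> 0 \<Longrightarrow> (eta_sq_integral q l has_real_derivative exp (- bigQ q x) * (eta q l x)\<^sup>2) (at x within {0..})"
  unfolding eta_sq_integral_def[abs_def]
  by (rule has_real_derivative_integral_from_0)
     (auto intro!: continuous_intros continuous_on_bigQ[OF q] continuous_on_eta[OF q])

lemma eta_sq_integral_mono: "0 \<le> x \<Longrightarrow> x \<le> y \<Longrightarrow> eta_sq_integral q l x \<le> eta_sq_integral q l y"
  by (rule mono_from_deriv[OF _ _ eta_sq_integral_deriv]) auto

lemma scale_fn_deriv: "x \<ge> 0 \<Longrightarrow> (scale_fn q has_real_derivative exp (bigQ q x)) (at x within {0..})"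
  unfolding scale_fn_def[abs_def]
  by (rule has_real_derivative_integral_from_0)
     (auto intro!: continuous_intros continuous_on_bigQ[OF q])

lemma scale_fn_pos:
  assumes "x > 0"
  shows "scale_fn q x > 0"
proof -
  have "scale_fn q 0 < scale_fn q x"
  proof (rule DERIV_pos_imp_increasing_open[OF assms])
    fix y assume y: "0 < y" "y < x"
    have "at y within {0..} = at y" by (rule at_within_interior) (use y in auto)
    then show "\<exists>d. DERIV (scale_fn q) y :> d \<and> 0 < d"
      using scale_fn_deriv[of y] y by (auto intro!: exI[of _ "exp (bigQ q y)"])
  next
    show "continuous_on {0..x} (scale_fn q)"
      by (rule continuous_on_subset[OF DERIV_continuous_on[OF scale_fn_deriv]]) auto
  qed
  then show ?thesis by (simp add: scale_fn_def)
qed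

text \<open>Muckenhoupt's form of Hardy's inequality, for a solution \<open>f\<close> with flux \<open>v = p f'\<close>. The tail
  function \<open>M\<close> is an antiderivative of \<open>- p\<close>. For
  \<open>T = - f\<^sup>2 M - B f\<^sup>2 / S + 4 B v f\<close>, a direct computation gives
  \<open>T' = (1 - 8 B l) p f\<^sup>2 + e\<^sup>Q (B r\<^sup>2 + 4 B v\<^sup>2 - 2 r v (M S + B))\<close> with \<open>r = f / S\<close>, and the last
  bracket is nonnegative because \<open>0 \<le> M S \<le> B\<close>. Hence \<open>T' \<ge> p f\<^sup>2 / 2\<close> once \<open>16 B l \<le> 1\<close>, and \<open>T\<close>
  vanishes at a zero of \<open>f\<close>.\<close>

lemma hardy_estimate:
  assumes N: "N > 0" and B: "B > 0"
    and dM: "\<And>x. x \<ge> N \<Longrightarrow> (M has_real_derivative - exp (- bigQ q x)) (at x within {0..})"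
    and M: "\<And>x. x \<ge> N \<Longrightarrow> M x \<ge> 0" "\<And>x. x \<ge> N \<Longrightarrow> M x * scale_fn q x \<le> B"
    and l: "16 * B * l \<le> 1"
    and z: "N \<le> z" "eta q l z = 0"
  shows "eta_sq_integral q l z - eta_sq_integral q l N
     \<le> 2 * ((eta q l N)\<^sup>2 * (M N + B / scale_fn q N) + 4 * B * \<bar>eta q l N * flux q l N\<bar>)"
proof -
  define f where "f = eta q l"
  define v where "v = flux q l"
  define T where "T = (\<lambda>x. - ((f x)\<^sup>2 * M x) - B * ((f x)\<^sup>2 / scale_fn q x) + 4 * B * (v x * f x))"
  have "T N - eta_sq_integral q l N / 2 \<le> T z - eta_sq_integral q l z / 2"
  proof (rule mono_from_deriv[where f = "\<lambda>x. T x - eta_sq_integral q l x / 2"])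
    fix x assume x: "N \<le> x" "x \<le> z"
    have x0: "x > 0" using x N by simp
    have S: "scale_fn q x > 0" by (rule scale_fn_pos[OF x0])
    note d = eta_deriv[OF q, of x l, folded f_def v_def] flux_deriv[OF q, of x l, folded f_def v_def]
      scale_fn_deriv[of x] dM[of x] eta_sq_integral_deriv[of x l, folded f_def]
    have df: "(f has_real_derivative exp (bigQ q x) * v x) (at x within {0..})" using d(1) x0 by simp
    have dv: "(v has_real_derivative - 2 * l * exp (- bigQ q x) * f x) (at x within {0..})" using d(2) x0 by simp
    have dS: "(scale_fn q has_real_derivative exp (bigQ q x)) (at x within {0..})" using d(3) x0 by simp
    have dM': "(M has_real_derivative - exp (- bigQ q x)) (at x within {0..})" using d(4) x by simp
    have dG: "(eta_sq_integral q l has_real_derivative exp (- bigQ q x) * (f x)\<^sup>2) (at x within {0..})"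
      using d(5) x0 by simp
    define e where "e = exp (bigQ q x)"
    define p where "p = exp (- bigQ q x)"
    have e: "e > 0" "p > 0" by (auto simp: e_def p_def)
    define D where "D = - (2 * f x * (e * v x) * M x + (- p) * (f x)\<^sup>2)
        - B * ((2 * f x * (e * v x) * scale_fn q x - (f x)\<^sup>2 * e) / (scale_fn q x * scale_fn q x))
        + 4 * B * ((- 2 * l * p * f x) * f x + (e * v x) * v x) - p * (f x)\<^sup>2 / 2"
    have df2: "((\<lambda>x. (f x)\<^sup>2) has_real_derivative 2 * f x * (e * v x)) (at x within {0..})"
      by (rule derivative_eq_intros refl df)+ (simp add: e_def)
    show "((\<lambda>x. T x - eta_sq_integral q l x / 2) has_real_derivative D) (at x within {0..})"
      unfolding T_def D_def
      by (intro DERIV_diff DERIV_add DERIV_minus DERIV_cmult DERIV_mult DERIV_divide DERIV_cdivide df2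
          df[folded e_def] dv[folded p_def] dS[folded e_def] dM'[folded p_def] dG[folded p_def])
         (use S in auto)
    define r where "r = f x / scale_fn q x"
    have D: "D = p * (f x)\<^sup>2 * (1 / 2 - 8 * B * l) + e * (B * r\<^sup>2 + 4 * B * (v x)\<^sup>2 - 2 * (r * v x) * (M x * scale_fn q x + B))"
      using S by (simp add: D_def r_def power2_eq_square field_simps)
    have "\<bar>2 * (r * v x) * (M x * scale_fn q x + B)\<bar> \<le> \<bar>2 * (r * v x)\<bar> * (2 * B)"
      unfolding abs_mult[of _ "M x * scale_fn q x + B"]
      using M(1)[of x] M(2)[of x] x S B by (intro mult_left_mono) auto
    also have "\<dots> = B * (2 * \<bar>r\<bar> * \<bar>2 * v x\<bar>)" by (simp add: abs_mult)
    also have "\<dots> \<le> B * (\<bar>r\<bar>\<^sup>2 + \<bar>2 * v x\<bar>\<^sup>2)"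
      using B by (intro mult_left_mono sum_squares_bound) auto
    also have "\<dots> = B * r\<^sup>2 + 4 * B * (v x)\<^sup>2" by (simp add: power_mult_distrib algebra_simps)
    finally have "0 \<le> B * r\<^sup>2 + 4 * B * (v x)\<^sup>2 - 2 * (r * v x) * (M x * scale_fn q x + B)" by simp
    moreover have "0 \<le> p * (f x)\<^sup>2 * (1 / 2 - 8 * B * l)"
      using e l by (intro mult_nonneg_nonneg) auto
    ultimately show "0 \<le> D" using e unfolding D by simp
  qed (use N z in auto)
  moreover have "T z = 0" using z(2) by (simp add: T_def f_def)
  ultimately have "eta_sq_integral q l z - eta_sq_integral q l N \<le> - 2 * T N" by simp
  also have "- 2 * T N = 2 * ((f N)\<^sup>2 * (M N + B / scale_fn q N) + 4 * B * (- (f N * v N)))"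
    by (simp add: T_def algebra_simps)
  also have "\<dots> \<le> 2 * ((f N)\<^sup>2 * (M N + B / scale_fn q N) + 4 * B * \<bar>f N * v N\<bar>)"
    using B by (intro mult_left_mono add_left_mono) auto
  finally show ?thesis by (simp add: f_def v_def)
qed

text \<open>On \<open>(0, n]\<close> the solution at \<open>lambda_c\<close> is positive, so nearby solutions are positive there as
  well: close to \<open>0\<close> by \<open>eta_pos_near_0\<close>, and elsewhere by uniform convergence. Above \<open>lambda_c\<close>
  they do change sign, which can only happen beyond \<open>n\<close>.\<close>

lemma eta_has_far_zero:
  assumes "n > 0"
  obtains \<delta> where "\<delta> > 0"
    "\<And>l. lambda_c q < l \<Longrightarrow> l < lambda_c q + \<delta> \<Longrightarrow> \<exists>z\<ge>n. eta q l z = 0"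
proof -
  let ?\<Lambda> = "lambda_c q + 1"
  have L0: "lambda_c q \<ge> 0" by (rule lambda_c_nonneg[OF q])
  obtain d where d: "d > 0" "\<And>l x. \<bar>l\<bar> \<le> ?\<Lambda> \<Longrightarrow> 0 < x \<Longrightarrow> x \<le> d \<Longrightarrow> eta q l x > 0"
    by (rule eta_pos_near_0[OF q, of ?\<Lambda>]) blast
  obtain L where L: "L \<ge> 0" "\<And>l l' y. \<bar>l\<bar> \<le> ?\<Lambda> \<Longrightarrow> \<bar>l'\<bar> \<le> ?\<Lambda>
        \<Longrightarrow> 0 \<le> y \<Longrightarrow> y \<le> n \<Longrightarrow> \<bar>eta q l y - eta q l' y\<bar> \<le> L * \<bar>l - l'\<bar>"
    by (rule eta_lipschitz_param[OF q, of n ?\<Lambda>]) (use assms in simp, blast)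
  have "\<exists>m>0. \<forall>x\<in>{d..n}. m \<le> eta q (lambda_c q) x"
  proof (cases "{d..n} = {}")
    case False
    have "continuous_on {d..n} (eta q (lambda_c q))"
      by (rule continuous_on_subset[OF continuous_on_eta[OF q]]) (use d in auto)
    then obtain x0 where "x0 \<in> {d..n}" "\<forall>x\<in>{d..n}. eta q (lambda_c q) x0 \<le> eta q (lambda_c q) x"
      using continuous_attains_inf[of "{d..n}"] False by blast
    then show ?thesis using eta_lambda_c_pos[OF q, of x0] d(1) by auto
  qed (auto intro: exI[of _ 1])
  then obtain m where m: "m > 0" "\<And>x. x \<in> {d..n} \<Longrightarrow> m \<le> eta q (lambda_c q) x" by blast
  \<comment> \<open>\<open>L + 1\<close> instead of \<open>L\<close>, as \<open>L\<close> may be \<open>0\<close>\<close>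
  define \<delta> where "\<delta> = min 1 (m / (L + 1))"
  have \<delta>: "\<delta> > 0" "\<delta> \<le> 1" using m L by (auto simp: \<delta>_def)
  have "L * \<delta> < m"
  proof -
    have "L * \<delta> < (L + 1) * \<delta>" using \<delta> by simp
    also have "\<dots> \<le> (L + 1) * (m / (L + 1))" using L by (intro mult_left_mono) (auto simp: \<delta>_def)
    finally show ?thesis using L by simp
  qed
  show ?thesis
  proof (rule that[OF \<delta>(1)])
    fix l assume l: "lambda_c q < l" "l < lambda_c q + \<delta>"
    have la: "\<bar>l\<bar> \<le> ?\<Lambda>" "\<bar>lambda_c q\<bar> \<le> ?\<Lambda>" using l L0 \<delta> by auto
    have pos: "eta q l x > 0" if x: "0 < x" "x \<le> n" for x
    proof (cases "x \<le> d")
      case True then show ?thesis using d la x by auto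
    next
      case False
      have "\<bar>eta q l x - eta q (lambda_c q) x\<bar> \<le> L * \<bar>l - lambda_c q\<bar>"
        by (rule L(2)) (use la x in auto)
      also have "\<dots> \<le> L * \<delta>" using L l by (intro mult_left_mono) auto
      finally show ?thesis using \<open>L * \<delta> < m\<close> m(2)[of x] False x by auto
    qed
    obtain y where y: "y > 0" "eta q l y < 0" using sign_change_above_lambda_c[OF q l(1)] .
    have "n < y" using pos[of y] y by force
    have "\<exists>z. n \<le> z \<and> z \<le> y \<and> eta q l z = 0"
    proof (rule IVT2')
      show "continuous_on {n..y} (eta q l)"
        by (rule continuous_on_subset[OF continuous_on_eta[OF q]]) (use assms in auto)
    qed (use y pos[of n] assms \<open>n < y\<close> in auto)
    then show "\<exists>z\<ge>n. eta q l z = 0" by blast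
  qed
qed

text \<open>For a fixed \<open>n\<close> take \<open>l'\<close> slightly above \<open>lambda_c\<close>, with a zero \<open>z \<ge> n\<close>. By
  \<open>hardy_estimate\<close> the integral of \<open>p eta\<^sub>l\<^sub>'\<^sup>2\<close> over \<open>[N, z]\<close> is bounded in terms of data at \<open>N\<close>, which
  stay bounded as \<open>l'\<close> approaches \<open>lambda_c\<close>. Replacing \<open>l'\<close> by \<open>lambda_c\<close> on \<open>[N, n]\<close> changes the
  integral by at most \<open>1\<close> if \<open>l'\<close> is close enough.\<close>

lemma ground_state_square_integrable:
  assumes N: "N > 0" and B: "B > 0"
    and dM: "\<And>x. x \<ge> N \<Longrightarrow> (M has_real_derivative - exp (- bigQ q x)) (at x within {0..})"
    and M: "\<And>x. x \<ge> N \<Longrightarrow> M x \<ge> 0" "\<And>x. x \<ge> N \<Longrightarrow> M x * scale_fn q x \<le> B"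
    and l: "16 * B * (lambda_c q + 1) \<le> 1"
  obtains C where "\<And>x. x \<ge> 0 \<Longrightarrow> eta_sq_integral q (lambda_c q) x \<le> C"
proof -
  let ?\<Lambda> = "lambda_c q + 1"
  have L0: "lambda_c q \<ge> 0" by (rule lambda_c_nonneg[OF q])
  obtain U where U: "U \<ge> 0" "\<And>l x. \<bar>l\<bar> \<le> ?\<Lambda> \<Longrightarrow> 0 \<le> x \<Longrightarrow> x \<le> N \<Longrightarrow> \<bar>eta q l x\<bar> \<le> U"
    "\<And>l x. \<bar>l\<bar> \<le> ?\<Lambda> \<Longrightarrow> 0 \<le> x \<Longrightarrow> x \<le> N \<Longrightarrow> \<bar>flux q l x\<bar> \<le> U"
    by (rule eta_flux_bounded[OF q, of N ?\<Lambda>]) (use N in simp, blast)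
  define C0 where "C0 = 2 * (U\<^sup>2 * (M N + B / scale_fn q N) + 4 * B * (U * U))"
  have main: "eta_sq_integral q (lambda_c q) n - eta_sq_integral q (lambda_c q) N \<le> C0 + 1" if n: "n \<ge> N" for n
  proof -
    have n0: "n > 0" using n N by simp
    obtain \<delta> where \<delta>: "\<delta> > 0"
      "\<And>l. lambda_c q < l \<Longrightarrow> l < lambda_c q + \<delta> \<Longrightarrow> \<exists>z\<ge>n. eta q l z = 0"
      using eta_has_far_zero[OF n0] by blast
    obtain L where L: "L \<ge> 0" "\<And>l l' y. \<bar>l\<bar> \<le> ?\<Lambda> \<Longrightarrow> \<bar>l'\<bar> \<le> ?\<Lambda>
        \<Longrightarrow> 0 \<le> y \<Longrightarrow> y \<le> n \<Longrightarrow> \<bar>eta q l y - eta q l' y\<bar> \<le> L * \<bar>l - l'\<bar>"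
      by (rule eta_lipschitz_param[OF q, of n ?\<Lambda>]) (use n0 in simp, blast)
    obtain V where V: "V \<ge> 0" "\<And>l x. \<bar>l\<bar> \<le> ?\<Lambda> \<Longrightarrow> 0 \<le> x \<Longrightarrow> x \<le> n \<Longrightarrow> \<bar>eta q l x\<bar> \<le> V"
      by (rule eta_flux_bounded[OF q, of n ?\<Lambda>]) (use n0 in simp, blast)
    obtain K where K: "K \<ge> 1" "\<And>x. 0 \<le> x \<Longrightarrow> x \<le> n \<Longrightarrow> exp (- bigQ q x) \<le> K"
      by (rule exp_bigQ_bound[OF q, of n]) blast
    define A where "A = K * (L * (2 * V))"
    have A: "A \<ge> 0" using K L V by (simp add: A_def)
    \<comment> \<open>the offset of \<open>l'\<close>: on \<open>[N, n]\<close> the integrands at \<open>l'\<close> and \<open>lambda_c\<close> differ by at most \<open>A h\<close>\<close>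
    define h where "h = min (min 1 (\<delta> / 2)) (1 / (A * n + 1))"
    have An: "A * n \<ge> 0" using A n0 by simp
    then have An1: "A * n + 1 > 0" by simp
    have h: "h > 0" "h \<le> 1" "h < \<delta>" using \<delta> An1 by (auto simp: h_def)
    have hA: "A * h * n \<le> 1"
    proof -
      have "(A * n) * h \<le> (A * n) * (1 / (A * n + 1))" using An by (intro mult_left_mono) (auto simp: h_def)
      also have "\<dots> \<le> 1" using An1 An by (simp add: field_simps)
      finally show ?thesis by (simp add: mult_ac)
    qed
    define l' where "l' = lambda_c q + h"
    have l': "lambda_c q < l'" "l' < lambda_c q + \<delta>" "\<bar>l'\<bar> \<le> ?\<Lambda>" "\<bar>lambda_c q\<bar> \<le> ?\<Lambda>" "\<bar>lambda_c q - l'\<bar> = h"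
      using h L0 by (auto simp: l'_def)
    obtain z where z: "z \<ge> n" "eta q l' z = 0" using \<delta>(2)[OF l'(1,2)] by blast
    have ll: "16 * B * l' \<le> 1"
    proof -
      have "16 * B * l' \<le> 16 * B * ?\<Lambda>" using B l' by (intro mult_left_mono) auto
      then show ?thesis using l by simp
    qed
    have "eta_sq_integral q l' n \<le> eta_sq_integral q l' z"
      by (rule eta_sq_integral_mono) (use z n0 in auto)
    moreover have "eta_sq_integral q l' z - eta_sq_integral q l' N
        \<le> 2 * ((eta q l' N)\<^sup>2 * (M N + B / scale_fn q N) + 4 * B * \<bar>eta q l' N * flux q l' N\<bar>)"
      by (rule hardy_estimate[OF N B dM M ll]) (use z n in auto)
    moreover have "2 * ((eta q l' N)\<^sup>2 * (M N + B / scale_fn q N) + 4 * B * \<bar>eta q l' N * flux q l' N\<bar>) \<le> C0"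
    proof -
      have e: "\<bar>eta q l' N\<bar> \<le> U" "\<bar>flux q l' N\<bar> \<le> U" using U(2,3)[OF l'(3), of N] N by auto
      have "\<bar>eta q l' N\<bar>\<^sup>2 \<le> U\<^sup>2" using e by (intro power_mono) auto
      then show ?thesis unfolding C0_def abs_mult
        using e M(1)[of N] B scale_fn_pos[OF N] by (intro mult_left_mono add_mono mult_right_mono mult_mono) auto
    qed
    moreover have "(eta_sq_integral q l' N - eta_sq_integral q (lambda_c q) N) + A * h * N
       \<le> (eta_sq_integral q l' n - eta_sq_integral q (lambda_c q) n) + A * h * n"
    proof (rule mono_from_deriv[where
          f = "\<lambda>x. (eta_sq_integral q l' x - eta_sq_integral q (lambda_c q) x) + A * h * x"])
      fix x assume x: "N \<le> x" "x \<le> n"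
      have x0: "x \<ge> 0" using x N by simp
      show "((\<lambda>x. (eta_sq_integral q l' x - eta_sq_integral q (lambda_c q) x) + A * h * x) has_real_derivative
         (exp (- bigQ q x) * (eta q l' x)\<^sup>2 - exp (- bigQ q x) * (eta q (lambda_c q) x)\<^sup>2) + A * h) (at x within {0..})"
        by (rule derivative_eq_intros refl eta_sq_integral_deriv[OF x0])+ simp
      have d1: "\<bar>eta q (lambda_c q) x - eta q l' x\<bar> \<le> L * h"
        using L(2)[OF l'(4,3) x0 x(2)] l'(5) by simp
      have d2: "\<bar>eta q (lambda_c q) x + eta q l' x\<bar> \<le> 2 * V"
        using V(2)[OF l'(4) x0 x(2)] V(2)[OF l'(3) x0 x(2)] by simp
      have "exp (- bigQ q x) * (eta q (lambda_c q) x)\<^sup>2 - exp (- bigQ q x) * (eta q l' x)\<^sup>2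
        = exp (- bigQ q x) * ((eta q (lambda_c q) x - eta q l' x) * (eta q (lambda_c q) x + eta q l' x))"
        by (simp add: power2_eq_square algebra_simps)
      also have "\<dots> \<le> \<bar>\<dots>\<bar>" by simp
      also have "\<dots> = exp (- bigQ q x) * (\<bar>eta q (lambda_c q) x - eta q l' x\<bar> * \<bar>eta q (lambda_c q) x + eta q l' x\<bar>)"
        by (simp add: abs_mult)
      also have "\<dots> \<le> K * ((L * h) * (2 * V))"
        using d1 d2 K x x0 L h V by (intro mult_mono) auto
      finally show "0 \<le> (exp (- bigQ q x) * (eta q l' x)\<^sup>2 - exp (- bigQ q x) * (eta q (lambda_c q) x)\<^sup>2) + A * h"
        by (simp add: A_def mult_ac)
    qed (use N n in auto)
    moreover have "A * h * N \<ge> 0" using A h N by simp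
    ultimately show ?thesis using hA by linarith
  qed
  show ?thesis
  proof (rule that)
    fix x :: real assume x: "x \<ge> 0"
    have "eta_sq_integral q (lambda_c q) x \<le> eta_sq_integral q (lambda_c q) (max x N)"
      by (rule eta_sq_integral_mono) (use x in auto)
    also have "\<dots> \<le> eta_sq_integral q (lambda_c q) N + (C0 + 1)" using main[of "max x N"] by simp
    finally show "eta_sq_integral q (lambda_c q) x \<le> eta_sq_integral q (lambda_c q) N + (C0 + 1)" .
  qed
qed

text \<open>For large \<open>x\<close> the tail \<open>mu [x, \<infinity>)\<close> is finite, since it is multiplied by a positive number and
  the product is small. The function \<open>M\<close> is the tail continued below \<open>N\<close> as an antiderivative of the
  density, so that its derivative at \<open>N\<close> is not one-sided.\<close>

lemma speed_measure_tail:
  assumes lim: "((\<lambda>x. emeasure (mu q) {x..} * ennreal (integral {0..x} (\<lambda>y. exp (bigQ q y)))) \<longlongrightarrow> 0) at_top"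
    and B: "B > 0"
  obtains N M where "N > 0"
    "\<And>x. x \<ge> N \<Longrightarrow> (M has_real_derivative - exp (- bigQ q x)) (at x within {0..})"
    "\<And>x. x \<ge> N \<Longrightarrow> M x \<ge> 0" "\<And>x. x \<ge> N \<Longrightarrow> M x * scale_fn q x \<le> B"
proof -
  have "\<forall>\<^sub>F x in at_top. emeasure (mu q) {x..} * ennreal (scale_fn q x) < ennreal B"
    using order_tendstoD(2)[OF lim, of "ennreal B"] B by (simp add: scale_fn_def)
  then obtain N0 where N0: "\<And>x. x \<ge> N0 \<Longrightarrow> emeasure (mu q) {x..} * ennreal (scale_fn q x) < ennreal B"
    unfolding eventually_at_top_linorder by blast
  define N where "N = max 1 N0"
  have N: "N > 0" "N \<ge> N0" by (auto simp: N_def)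
  have fin: "emeasure (mu q) {x..} < \<infinity>" if "x \<ge> N" for x
  proof (rule ccontr)
    assume "\<not> emeasure (mu q) {x..} < \<infinity>"
    then have "emeasure (mu q) {x..} = \<infinity>" by (simp add: not_less top_unique)
    moreover have "scale_fn q x > 0" using scale_fn_pos[of x] that N by simp
    ultimately have "emeasure (mu q) {x..} * ennreal (scale_fn q x) = \<infinity>" by (simp add: ennreal_top_mult)
    then show False using N0[of x] that N by simp
  qed
  define p where "p = (\<lambda>y. exp (- bigQ q (max 0 y)))"
  have pm: "p \<in> borel_measurable borel"
  proof (rule borel_measurable_continuous_onI)
    have "continuous_on UNIV (\<lambda>y. bigQ q (max 0 y))"
      by (rule continuous_on_compose2[OF continuous_on_bigQ[OF q]]) (auto intro!: continuous_intros)
    then show "continuous_on UNIV p" unfolding p_def by (intro continuous_intros)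
  qed
  have mu_eq: "mu q = density lborel (\<lambda>y. ennreal (p y) * indicator {0<..} y)"
    unfolding mu_def by (intro arg_cong[where f = "density lborel"] ext) (auto simp: p_def indicator_def)
  define P where "P = (\<lambda>x. integral {0..x} (\<lambda>y. exp (- bigQ q y)))"
  have dP: "(P has_real_derivative exp (- bigQ q x)) (at x within {0..})" if "x \<ge> 0" for x
    unfolding P_def
    by (rule has_real_derivative_integral_from_0) (use that in \<open>auto intro!: continuous_intros continuous_on_bigQ[OF q]\<close>)
  define M where "M = (\<lambda>x. measure (mu q) {N..} + P N - P x)"
  have M_eq: "M x = measure (mu q) {x..}" if x: "x \<ge> N" for x
  proof -
    have "emeasure (mu q) {N..<x} = (\<integral>\<^sup>+y. (ennreal (p y) * indicator {0<..} y) * indicator {N..<x} y \<partial>lborel)"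
      unfolding mu_eq by (rule emeasure_density) (use pm in auto)
    also have "\<dots> = (\<integral>\<^sup>+y. ennreal (p y) * indicator {N..x} y \<partial>lborel)"
    proof (rule nn_integral_cong_AE)
      show "AE y in lborel. (ennreal (p y) * indicator {0<..} y) * indicator {N..<x} y = ennreal (p y) * indicator {N..x} y"
        using AE_lborel_singleton[of x] by eventually_elim (use N in \<open>auto simp: indicator_def\<close>)
    qed
    also have "\<dots> = ennreal (P x - P N)"
    proof (rule nn_integral_FTC_Icc[OF pm])
      fix y assume y: "y \<in> {N..x}"
      show "(P has_real_derivative p y) (at y)"
        using dP[of y] y N by (simp add: at_within_nonneg p_def)
    qed (use x in \<open>auto simp: p_def\<close>)
    finally have e: "emeasure (mu q) {N..<x} = ennreal (P x - P N)" .
    have PN: "P x - P N \<ge> 0"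
      using mono_from_deriv[of N x P, OF _ _ dP] N x by simp
    have "measure (mu q) {N..} = measure (mu q) ({N..<x} \<union> {x..})" using x by (simp add: ivl_disj_un)
    also have "\<dots> = measure (mu q) {N..<x} + measure (mu q) {x..}"
      by (rule measure_Union) (use e fin[OF x] in \<open>auto simp: mu_def\<close>)
    also have "measure (mu q) {N..<x} = P x - P N" using e PN by (simp add: measure_def)
    finally show ?thesis by (simp add: M_def)
  qed
  show ?thesis
  proof (rule that[OF N(1)])
    fix x assume x: "x \<ge> N"
    have "((\<lambda>x. measure (mu q) {N..} + P N - P x) has_real_derivative 0 + 0 - exp (- bigQ q x)) (at x within {0..})"
      by (intro DERIV_diff DERIV_add DERIV_const dP) (use x N in auto)
    then show "(M has_real_derivative - exp (- bigQ q x)) (at x within {0..})"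
      by (simp add: M_def)
    show "M x \<ge> 0" by (simp add: M_eq[OF x])
    have "ennreal (M x * scale_fn q x) = emeasure (mu q) {x..} * ennreal (scale_fn q x)"
      using fin[OF x] scale_fn_pos[of x] x N
      by (simp add: M_eq[OF x] ennreal_mult'' emeasure_eq_ennreal_measure less_top)
    then have "ennreal (M x * scale_fn q x) < ennreal B" using N0[of x] x N by simp
    moreover have "0 \<le> M x * scale_fn q x"
      using scale_fn_pos[of x] x N by (simp add: M_eq[OF x])
    ultimately show "M x * scale_fn q x \<le> B" by (simp add: ennreal_less_iff)
  qed
qed

end

section \<open>Supermartingale estimate for one Gaussian step\<close>

text \<open>An upper Taylor bound for \<open>V\<close> killed outside \<open>[c, d]\<close>, valid for increments \<open>D\<close> of any size.
  For small \<open>D\<close> that stay inside it is Taylor's theorem, with \<open>1 / 8\<close> paying for the oscillation of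
  \<open>V''\<close>. For small \<open>D\<close> that leave the interval the left side is \<open>0\<close>, whereas \<open>V \<ge> 1\<close> keeps the right
  side positive. Large \<open>D\<close> are absorbed by the quartic term. A polynomial bound is what Gaussian
  moments can be applied to.\<close>

lemma second_order_bound:
  fixes V V' V'' :: "real \<Rightarrow> real"
  assumes V: "\<And>y. y \<in> {c..d} \<Longrightarrow> (V has_real_derivative V' y) (at y)"
    "\<And>y. y \<in> {c..d} \<Longrightarrow> (V' has_real_derivative V'' y) (at y)"
    and V'': "continuous_on {c..d} V''"
    and V1: "\<And>y. y \<in> {c..d} \<Longrightarrow> 1 \<le> V y"
  obtains C where "C \<ge> 0" "\<And>z D. z \<in> {c..d} \<Longrightarrow>
     (if z + D \<in> {c..d} then V (z + D) else 0) \<le> V z + V' z * D + (V'' z / 2 + 1 / 8) * D\<^sup>2 + C * D ^ 4"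
proof -
  have cV: "continuous_on {c..d} V" "continuous_on {c..d} V'"
    using V by (meson DERIV_continuous_on has_field_derivative_at_within)+
  obtain A0 A1 A2 where A: "\<And>y. y \<in> {c..d} \<Longrightarrow> \<bar>V y\<bar> \<le> A0" "\<And>y. y \<in> {c..d} \<Longrightarrow> \<bar>V' y\<bar> \<le> A1"
    "\<And>y. y \<in> {c..d} \<Longrightarrow> \<bar>V'' y\<bar> \<le> A2"
    using abs_bounded_on_Icc[OF cV(1)] abs_bounded_on_Icc[OF cV(2)] abs_bounded_on_Icc[OF V''] by blast
  define A where "A = \<bar>A0\<bar> + \<bar>A1\<bar> + \<bar>A2\<bar>"
  have A: "A \<ge> 0" "\<bar>V y\<bar> \<le> A" "\<bar>V' y\<bar> \<le> A" "\<bar>V'' y\<bar> \<le> A" if "y \<in> {c..d}" for y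
    using A[OF that] by (auto simp: A_def)
  have A0: "A \<ge> 0" by (simp add: A_def)
  have "uniformly_continuous_on {c..d} V''"
    by (rule compact_uniformly_continuous[OF V'']) auto
  then obtain \<delta>1 where \<delta>1: "\<delta>1 > 0"
    "\<And>y z. y \<in> {c..d} \<Longrightarrow> z \<in> {c..d} \<Longrightarrow> \<bar>y - z\<bar> < \<delta>1 \<Longrightarrow> \<bar>V'' y - V'' z\<bar> < 1 / 4"
    unfolding uniformly_continuous_on_def by (force simp: dist_real_def dest: spec[of _ "1/4"])
  \<comment> \<open>\<open>A \<delta> \<le> 1 / 2\<close> keeps the Taylor polynomial nonnegative for \<open>\<bar>D\<bar> < \<delta>\<close>, as \<open>V z \<ge> 1\<close>\<close>
  define \<delta> where "\<delta> = min \<delta>1 (1 / (2 * (A + 1)))"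
  have \<delta>: "\<delta> > 0" "\<delta> \<le> \<delta>1" "\<delta> \<le> 1 / 2" "A * \<delta> \<le> 1 / 2"
  proof -
    show "\<delta> > 0" "\<delta> \<le> \<delta>1" using \<delta>1 A0 by (auto simp: \<delta>_def)
    have *: "\<delta> \<le> 1 / (2 * (A + 1))" by (simp add: \<delta>_def)
    also have "\<dots> \<le> 1 / 2" using A0 by (simp add: field_simps)
    finally show "\<delta> \<le> 1 / 2" .
    have "A * \<delta> \<le> A * (1 / (2 * (A + 1)))" using * A0 by (intro mult_left_mono) auto
    also have "\<dots> \<le> 1 / 2" using A0 by (simp add: field_simps)
    finally show "A * \<delta> \<le> 1 / 2" .
  qed
  define C where "C = 3 * A / \<delta> ^ 4"
  have C0: "C \<ge> 0" using A0 \<delta> by (simp add: C_def)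
  show ?thesis
  proof (rule that[OF C0])
    fix z D assume z: "z \<in> {c..d}"
    have CD: "C * D ^ 4 \<ge> 0" using C0 by simp
    have lowD: "- A * \<bar>D\<bar> \<le> V' z * D" "- A * D\<^sup>2 \<le> V'' z * D\<^sup>2"
    proof -
      have "\<bar>V' z * D\<bar> \<le> A * \<bar>D\<bar>" unfolding abs_mult using A(3)[OF z] by (intro mult_right_mono) auto
      then show "- A * \<bar>D\<bar> \<le> V' z * D" by (simp add: abs_le_iff)
      have "\<bar>V'' z * D\<^sup>2\<bar> \<le> A * D\<^sup>2" unfolding abs_mult using A(4)[OF z] by (auto intro!: mult_right_mono)
      then show "- A * D\<^sup>2 \<le> V'' z * D\<^sup>2" by (simp add: abs_le_iff)
    qed
    show "(if z + D \<in> {c..d} then V (z + D) else 0) \<le> V z + V' z * D + (V'' z / 2 + 1 / 8) * D\<^sup>2 + C * D ^ 4"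
    proof (cases "\<bar>D\<bar> < \<delta>")
      case True
      show ?thesis
      proof (cases "z + D \<in> {c..d}")
        case inside: True
        have "V (z + D) \<le> V z + V' z * D + (V'' z / 2 + 1 / 8) * D\<^sup>2"
        proof (cases "D = 0")
          case False
          define diff where "diff = (\<lambda>m::nat. if m = 0 then V else if m = 1 then V' else V'')"
          have "\<exists>t. (if z + D < z then z + D < t \<and> t < z else z < t \<and> t < z + D) \<and>
             V (z + D) = (\<Sum>m<2. diff m z / fact m * (z + D - z) ^ m) + diff 2 t / fact 2 * (z + D - z) ^ 2"
            by (rule Taylor[where a = c and b = d])
               (use z inside False V in \<open>auto simp: diff_def less_2_cases_iff\<close>)
          then obtain t where t: "if D < 0 then z + D < t \<and> t < z else z < t \<and> t < z + D"
            "V (z + D) = V z + V' z * D + V'' t / 2 * D\<^sup>2"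
            by (auto simp: diff_def numeral_2_eq_2)
          have "\<bar>V'' t - V'' z\<bar> < 1 / 4"
            using t(1) z inside True \<delta> by (intro \<delta>1(2)) (auto split: if_splits)
          then have "V'' t / 2 \<le> V'' z / 2 + 1 / 8" by linarith
          then have "V'' t / 2 * D\<^sup>2 \<le> (V'' z / 2 + 1 / 8) * D\<^sup>2" by (intro mult_right_mono) auto
          then show ?thesis using t(2) by simp
        qed simp
        then show ?thesis using inside CD by simp
      next
        case False
        have "A * \<bar>D\<bar> \<le> A * \<delta>" using True A0 by (intro mult_left_mono) auto
        then have AD: "A * \<bar>D\<bar> \<le> 1 / 2" using \<delta> by simp
        have "A * D\<^sup>2 = (A * \<bar>D\<bar>) * \<bar>D\<bar>" by (simp add: power2_eq_square)
        also have "\<dots> \<le> (1 / 2) * (1 / 2)" using AD True \<delta> A0 by (intro mult_mono) auto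
        finally have "A * D\<^sup>2 \<le> 1 / 4" by simp
        then have "0 \<le> V z + V' z * D + V'' z * D\<^sup>2 / 2"
          using lowD AD V1[OF z] by simp
        also have "\<dots> \<le> V z + V' z * D + (V'' z / 2 + 1 / 8) * D\<^sup>2 + C * D ^ 4"
          using CD by (simp add: algebra_simps)
        finally show ?thesis unfolding if_not_P[OF False] .
      qed
    next
      case False
      \<comment> \<open>\<open>r \<ge> 1\<close>, and \<open>1\<close>, \<open>\<bar>D\<bar>\<close> and \<open>D\<^sup>2\<close> are all at most \<open>r\<^sup>4\<close>, a multiple of \<open>D\<^sup>4\<close>\<close>
      define r where "r = \<bar>D\<bar> / \<delta>"
      have r: "1 \<le> r" using False \<delta> by (simp add: r_def)
      have Dr: "\<bar>D\<bar> \<le> r" "\<bar>D\<bar> = r * \<delta>"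
      proof -
        show e: "\<bar>D\<bar> = r * \<delta>" using \<delta> by (simp add: r_def)
        show "\<bar>D\<bar> \<le> r" unfolding e using r \<delta> by (simp add: mult_left_le)
      qed
      have p: "1 \<le> r ^ 4" "\<bar>D\<bar> \<le> r ^ 4" "D\<^sup>2 \<le> r ^ 4"
      proof -
        show "1 \<le> r ^ 4" using r by simp
        have "r ^ 1 \<le> r ^ 4" "r ^ 2 \<le> r ^ 4" using r by (intro power_increasing; simp)+
        moreover have "\<bar>D\<bar>\<^sup>2 \<le> r\<^sup>2" using Dr(1) by (intro power_mono) auto
        ultimately show "\<bar>D\<bar> \<le> r ^ 4" "D\<^sup>2 \<le> r ^ 4" using Dr(1) by auto
      qed
      have "C * D ^ 4 = 3 * (A * r ^ 4)"
      proof -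
        have "D ^ 4 = \<bar>D\<bar> ^ 4" by simp
        also have "\<dots> = r ^ 4 * \<delta> ^ 4" by (simp only: Dr power_mult_distrib)
        finally show ?thesis using \<delta> by (simp add: C_def)
      qed
      moreover have "A * 1 \<le> A * r ^ 4" "A * \<bar>D\<bar> \<le> A * r ^ 4" "A * D\<^sup>2 \<le> A * r ^ 4"
        using p A0 by (intro mult_left_mono; simp)+
      moreover have "(if z + D \<in> {c..d} then V (z + D) else 0) \<le> A"
        using A(2)[of "z + D"] A0 by auto
      moreover have "0 \<le> D\<^sup>2" "0 \<le> A * D\<^sup>2" using A0 by auto
      ultimately have "(if z + D \<in> {c..d} then V (z + D) else 0)
          \<le> V z + V' z * D + V'' z * D\<^sup>2 / 2 + D\<^sup>2 / 8 + C * D ^ 4"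
        using lowD V1[OF z] by linarith
      then show ?thesis by (simp add: algebra_simps)
    qed
  qed
qed

lemma normal_expectation_quartic:
  assumes h: "h > 0"
  shows "has_bochner_integral lborel
    (\<lambda>y. normal_density 0 (sqrt h) y * (a0 + a1 * (y - m) + a2 * (y - m)\<^sup>2 + a4 * (y - m) ^ 4))
    (a0 - a1 * m + a2 * (h + m\<^sup>2) + a4 * (3 * h\<^sup>2 + 6 * h * m\<^sup>2 + m ^ 4))"
proof -
  let ?n = "normal_density 0 (sqrt h)"
  have s: "sqrt h > 0" using h by simp
  have m0: "has_bochner_integral lborel (\<lambda>y. ?n y * 1) 1"
    using normal_moment_even[OF s, of 0 0] by simp
  have m1: "has_bochner_integral lborel (\<lambda>y. ?n y * y) 0"
    using normal_moment_odd[OF s, of 0 0] by simp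
  have m2: "has_bochner_integral lborel (\<lambda>y. ?n y * y ^ 2) h"
    using normal_moment_even[OF s, of 0 1] h by (simp add: fact_numeral)
  have m3: "has_bochner_integral lborel (\<lambda>y. ?n y * y ^ 3) 0"
    using normal_moment_odd[OF s, of 0 1] by (simp add: numeral_3_eq_3)
  have m4: "has_bochner_integral lborel (\<lambda>y. ?n y * y ^ 4) (3 * h\<^sup>2)"
  proof -
    have "(fact (2 * 2) / ((2 / (sqrt h)\<^sup>2)\<^sup>2 * fact 2) :: real) = 3 * h\<^sup>2"
      using h by (simp add: fact_numeral power_divide)
    then show ?thesis using normal_moment_even[OF s, of 0 2] by simp
  qed
  define b0 where "b0 = a0 - a1 * m + a2 * m\<^sup>2 + a4 * m ^ 4"
  define b1 where "b1 = a1 - 2 * a2 * m - 4 * a4 * m ^ 3"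
  define b2 where "b2 = a2 + 6 * a4 * m\<^sup>2"
  define b3 where "b3 = - 4 * a4 * m"
  have "has_bochner_integral lborel (\<lambda>y. b0 * (?n y * 1) + b1 * (?n y * y) + b2 * (?n y * y ^ 2)
      + b3 * (?n y * y ^ 3) + a4 * (?n y * y ^ 4)) (b0 * 1 + b1 * 0 + b2 * h + b3 * 0 + a4 * (3 * h\<^sup>2))"
    by (intro has_bochner_integral_add has_bochner_integral_mult_right m0 m1 m2 m3 m4)
  moreover have "b0 * (?n y * 1) + b1 * (?n y * y) + b2 * (?n y * y ^ 2)
      + b3 * (?n y * y ^ 3) + a4 * (?n y * y ^ 4)
      = ?n y * (a0 + a1 * (y - m) + a2 * (y - m)\<^sup>2 + a4 * (y - m) ^ 4)" for y
    unfolding b0_def b1_def b2_def b3_def by algebra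
  moreover have "b0 * 1 + b1 * 0 + b2 * h + b3 * 0 + a4 * (3 * h\<^sup>2)
     = a0 - a1 * m + a2 * (h + m\<^sup>2) + a4 * (3 * h\<^sup>2 + 6 * h * m\<^sup>2 + m ^ 4)"
    unfolding b0_def b1_def b2_def b3_def by algebra
  ultimately show ?thesis by simp
qed

text \<open>One step of the Euler chain has drift \<open>- h f z\<close> and variance \<open>h\<close>. Inserting the Gaussian moments
  into \<open>second_order_bound\<close>, the terms of order \<open>h\<close> are \<open>h (V'' / 2 - f V') + h / 8 \<le> - 7 h / 8\<close>, and
  the others are of order \<open>h\<^sup>2\<close>. So the killed \<open>V\<close> loses at least \<open>h / 2\<close> on average.\<close>

lemma gaussian_step_decreases:
  fixes V V' V'' f :: "real \<Rightarrow> real"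
  assumes V: "\<And>y. y \<in> {c..d} \<Longrightarrow> (V has_real_derivative V' y) (at y)"
    "\<And>y. y \<in> {c..d} \<Longrightarrow> (V' has_real_derivative V'' y) (at y)"
    and V'': "continuous_on {c..d} V''"
    and V1: "\<And>y. y \<in> {c..d} \<Longrightarrow> 1 \<le> V y"
    and f: "continuous_on {c..d} f"
    and LV: "\<And>y. y \<in> {c..d} \<Longrightarrow> V'' y / 2 - f y * V' y \<le> - 1"
  obtains h0 where "h0 > 0" "\<And>h z. 0 < h \<Longrightarrow> h < h0 \<Longrightarrow> z \<in> {c..d} \<Longrightarrow>
     (\<integral>\<^sup>+y. ennreal (normal_density 0 (sqrt h) y) *
        ennreal (if z - h * f z + y \<in> {c..d} then V (z - h * f z + y) else 0) \<partial>lborel) + ennreal (h / 2)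
     \<le> ennreal (V z)"
proof -
  obtain C where C: "C \<ge> 0" "\<And>z D. z \<in> {c..d} \<Longrightarrow>
     (if z + D \<in> {c..d} then V (z + D) else 0) \<le> V z + V' z * D + (V'' z / 2 + 1 / 8) * D\<^sup>2 + C * D ^ 4"
    using second_order_bound[OF V V'' V1] by blast
  obtain A F where A: "\<And>y. y \<in> {c..d} \<Longrightarrow> \<bar>V'' y\<bar> \<le> A" and F: "\<And>y. y \<in> {c..d} \<Longrightarrow> \<bar>f y\<bar> \<le> F"
    using abs_bounded_on_Icc[OF V''] abs_bounded_on_Icc[OF f] by blast
  define R where "R = \<bar>A\<bar> * F\<^sup>2 + F\<^sup>2 + C * (3 + 6 * F\<^sup>2 + F ^ 4)"
  have R: "R \<ge> 0" using C by (simp add: R_def)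
  \<comment> \<open>\<open>R\<close> collects the coefficients of the terms of order \<open>h\<^sup>2\<close> and higher\<close>
  define h0 where "h0 = min 1 (1 / (8 * (R + 1)))"
  show ?thesis
  proof (rule that[of h0])
    show "h0 > 0" using R by (simp add: h0_def)
    fix h z assume h: "0 < h" "h < h0" and z: "z \<in> {c..d}"
    have h1: "h \<le> 1" and hR: "h * (R + 1) \<le> 1 / 8"
    proof -
      show "h \<le> 1" using h by (simp add: h0_def)
      have "h \<le> 1 / (8 * (R + 1))" using h by (simp add: h0_def)
      then show "h * (R + 1) \<le> 1 / 8" using R by (simp add: field_simps)
    qed
    define m where "m = h * f z"
    define P where "P = (\<lambda>y. V z + V' z * (y - m) + (V'' z / 2 + 1 / 8) * (y - m)\<^sup>2 + C * (y - m) ^ 4)"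
    define I where "I = V z - V' z * m + (V'' z / 2 + 1 / 8) * (h + m\<^sup>2) + C * (3 * h\<^sup>2 + 6 * h * m\<^sup>2 + m ^ 4)"
    have hb: "has_bochner_integral lborel (\<lambda>y. normal_density 0 (sqrt h) y * P y) I"
      unfolding P_def I_def by (rule normal_expectation_quartic[OF h(1)])
    have le: "(if z - h * f z + y \<in> {c..d} then V (z - h * f z + y) else 0) \<le> P y" for y
    proof -
      have e: "z + (y - m) = z - h * f z + y" by (simp add: m_def)
      show ?thesis using C(2)[OF z, of "y - m"] unfolding e P_def .
    qed
    have P0: "P y \<ge> 0" for y
    proof -
      have "0 \<le> (if z - h * f z + y \<in> {c..d} then V (z - h * f z + y) else 0)"
        using V1[of "z - h * f z + y"] by auto
      then show ?thesis using le[of y] by linarith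
    qed
    have I: "I + h / 2 \<le> V z"
    proof -
      have f2: "(f z)\<^sup>2 \<le> F\<^sup>2" using power_mono[OF F[OF z], of 2] by simp
      have f4: "(f z) ^ 4 \<le> F ^ 4" using power_mono[OF F[OF z], of 4] by simp
      have h2: "h ^ 3 \<le> h\<^sup>2" "h ^ 4 \<le> h\<^sup>2" using h h1 by (auto intro!: power_decreasing)
      have t1: "(V'' z / 2 + 1 / 8) * m\<^sup>2 \<le> h\<^sup>2 * (\<bar>A\<bar> * F\<^sup>2 + F\<^sup>2)"
      proof -
        have "(V'' z / 2 + 1 / 8) * m\<^sup>2 \<le> (\<bar>A\<bar> + 1) * m\<^sup>2"
          using A[OF z] by (intro mult_right_mono) auto
        also have "\<dots> = h\<^sup>2 * ((\<bar>A\<bar> + 1) * (f z)\<^sup>2)" by (simp add: m_def power_mult_distrib)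
        also have "\<dots> \<le> h\<^sup>2 * ((\<bar>A\<bar> + 1) * F\<^sup>2)" using f2 by (intro mult_left_mono) auto
        finally show ?thesis by (simp add: algebra_simps)
      qed
      have t2: "C * (3 * h\<^sup>2 + 6 * h * m\<^sup>2 + m ^ 4) \<le> h\<^sup>2 * (C * (3 + 6 * F\<^sup>2 + F ^ 4))"
      proof -
        have "h * m\<^sup>2 \<le> h\<^sup>2 * F\<^sup>2"
        proof -
          have "h * m\<^sup>2 = h ^ 3 * (f z)\<^sup>2" by (simp add: m_def power_mult_distrib power2_eq_square power3_eq_cube)
          also have "\<dots> \<le> h\<^sup>2 * F\<^sup>2" using h2 f2 h by (intro mult_mono) auto
          finally show ?thesis .
        qed
        moreover have "m ^ 4 \<le> h\<^sup>2 * F ^ 4"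
          unfolding m_def power_mult_distrib using h2 f4 by (intro mult_mono) auto
        ultimately have "3 * h\<^sup>2 + 6 * h * m\<^sup>2 + m ^ 4 \<le> h\<^sup>2 * (3 + 6 * F\<^sup>2 + F ^ 4)"
          by (simp add: algebra_simps)
        then have "C * (3 * h\<^sup>2 + 6 * h * m\<^sup>2 + m ^ 4) \<le> C * (h\<^sup>2 * (3 + 6 * F\<^sup>2 + F ^ 4))"
          using C(1) by (rule mult_left_mono)
        then show ?thesis by (simp add: mult_ac)
      qed
      have "I = V z + h * (V'' z / 2 - f z * V' z) + h / 8 + ((V'' z / 2 + 1 / 8) * m\<^sup>2
          + C * (3 * h\<^sup>2 + 6 * h * m\<^sup>2 + m ^ 4))"
        by (simp add: I_def m_def algebra_simps)
      also have "\<dots> \<le> V z + h * (- 1) + h / 8 + h\<^sup>2 * R"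
      proof -
        have "h * (V'' z / 2 - f z * V' z) \<le> h * (- 1)" using LV[OF z] h by (intro mult_left_mono) auto
        then show ?thesis using t1 t2 by (simp add: R_def algebra_simps)
      qed
      also have "h\<^sup>2 * R \<le> h * (h * (R + 1))" using h by (simp add: power2_eq_square)
      also have "h * (h * (R + 1)) \<le> h * (1 / 8)" using hR h by (intro mult_left_mono) auto
      finally show ?thesis using h by simp
    qed
    have "(\<integral>\<^sup>+y. ennreal (normal_density 0 (sqrt h) y) *
        ennreal (if z - h * f z + y \<in> {c..d} then V (z - h * f z + y) else 0) \<partial>lborel)
      \<le> (\<integral>\<^sup>+y. ennreal (normal_density 0 (sqrt h) y * P y) \<partial>lborel)"
      by (intro nn_integral_mono) (use le in \<open>auto simp: ennreal_mult' intro!: mult_left_mono ennreal_leI simp del: if_split_asm split del: if_split\<close>)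
    also have "\<dots> = ennreal I"
    proof (subst nn_integral_eq_integral)
      show "integrable lborel (\<lambda>y. normal_density 0 (sqrt h) y * P y)"
        using hb by (rule integrable.intros)
      show "AE y in lborel. 0 \<le> normal_density 0 (sqrt h) y * P y"
        using P0 by (intro AE_I2) auto
      show "ennreal (\<integral>y. normal_density 0 (sqrt h) y * P y \<partial>lborel) = ennreal I"
        using hb by (simp add: has_bochner_integral_integral_eq)
    qed
    finally have "(\<integral>\<^sup>+y. ennreal (normal_density 0 (sqrt h) y) *
        ennreal (if z - h * f z + y \<in> {c..d} then V (z - h * f z + y) else 0) \<partial>lborel) + ennreal (h / 2)
        \<le> ennreal I + ennreal (h / 2)" by (rule add_right_mono)
    also have "\<dots> = ennreal (I + h / 2)"
    proof (rule ennreal_plus[symmetric])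
      have "0 \<le> (\<integral>y. normal_density 0 (sqrt h) y * P y \<partial>lborel)"
        by (rule integral_nonneg_AE) (use P0 in \<open>auto intro!: AE_I2\<close>)
      then show "0 \<le> I" using hb by (simp add: has_bochner_integral_integral_eq)
    qed (use h in auto)
    also have "\<dots> \<le> ennreal (V z)" using I by (rule ennreal_leI)
    finally show "(\<integral>\<^sup>+y. ennreal (normal_density 0 (sqrt h) y) *
        ennreal (if z - h * f z + y \<in> {c..d} then V (z - h * f z + y) else 0) \<partial>lborel) + ennreal (h / 2)
        \<le> ennreal (V z)" .
  qed
qed

section \<open>The Euler chain driven by Brownian increments\<close>

text \<open>The noise increments \<open>w\<close> are an argument of the chain, and its value at time \<open>k\<close> depends on them
  only below \<open>k\<close>. This is what makes the next increment independent of the chain's past.\<close>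

primrec euler :: "(real \<Rightarrow> real) \<Rightarrow> real \<Rightarrow> real \<Rightarrow> (nat \<Rightarrow> real) \<Rightarrow> nat \<Rightarrow> real" where
  "euler f h x w 0 = x"
| "euler f h x w (Suc k) = euler f h x w k - h * f (euler f h x w k) + w k"

definition euler_alive :: "real \<Rightarrow> real \<Rightarrow> (real \<Rightarrow> real) \<Rightarrow> real \<Rightarrow> real \<Rightarrow> (nat \<Rightarrow> real) \<Rightarrow> nat \<Rightarrow> bool" where
  "euler_alive c d f h x w k \<longleftrightarrow> (\<forall>j\<le>k. euler f h x w j \<in> {c..d})"

lemma euler_cong:
  "(\<And>j. j < k \<Longrightarrow> w j = w' j) \<Longrightarrow> euler f h x w k = euler f h x w' k"
  by (induction k) auto

lemma euler_alive_cong: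
  "(\<And>j. j < k \<Longrightarrow> w j = w' j) \<Longrightarrow> euler_alive c d f h x w k = euler_alive c d f h x w' k"
proof -
  assume "\<And>j. j < k \<Longrightarrow> w j = w' j"
  then have "euler f h x w j = euler f h x w' j" if "j \<le> k" for j
    using that by (intro euler_cong) auto
  then show ?thesis unfolding euler_alive_def by auto
qed

lemma measurable_euler:
  assumes "f \<in> borel_measurable borel" "\<And>j. j < k \<Longrightarrow> (\<lambda>v. w v j) \<in> borel_measurable N"
  shows "(\<lambda>v. euler f h x (w v) k) \<in> borel_measurable N"
  using assms(2)
proof (induction k)
  case (Suc k)
  have "(\<lambda>v. euler f h x (w v) k) \<in> borel_measurable N" using Suc by simp
  moreover have "(\<lambda>v. w v k) \<in> borel_measurable N" using Suc.prems by simp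
  moreover have "(\<lambda>v. f (euler f h x (w v) k)) \<in> borel_measurable N"
    using measurable_compose[OF calculation(1) assms(1)] .
  ultimately show ?case by simp
qed simp

lemma measurable_euler_alive:
  assumes "f \<in> borel_measurable borel" "\<And>j. j < k \<Longrightarrow> (\<lambda>v. w v j) \<in> borel_measurable N"
  shows "Measurable.pred N (\<lambda>v. euler_alive c d f h x (w v) k)"
proof -
  have "Measurable.pred N (\<lambda>v. euler f h x (w v) j \<in> {c..d})" if "j \<le> k" for j
    using measurable_euler[OF assms(1), of j w N h x] assms(2) that by (intro pred_sets2[of "{c..d}" borel]) auto
  then have "Measurable.pred N (\<lambda>v. \<forall>j\<in>{..k}. euler f h x (w v) j \<in> {c..d})"
    by (intro pred_intros_finite) auto
  moreover have "(\<lambda>v. \<forall>j\<in>{..k}. euler f h x (w v) j \<in> {c..d}) = (\<lambda>v. euler_alive c d f h x (w v) k)"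
    unfolding euler_alive_def by auto
  ultimately show ?thesis by simp
qed

text \<open>The next increment is Gaussian and independent of the vector of the previous ones, so it can be
  integrated out with the past fixed.\<close>

lemma brownian_increments_step:
  assumes bm: "brownian_motion N W" and h: "h > 0"
    and g: "g \<in> borel_measurable (PiM {..<k} (\<lambda>_. borel) \<Otimes>\<^sub>M borel)"
  defines "D \<equiv> \<lambda>(i::nat) \<omega>. W (real (Suc i) * h) \<omega> - W (real i * h) \<omega>"
  shows "(\<integral>\<^sup>+\<omega>. g (restrict (\<lambda>i. D i \<omega>) {..<k}, D k \<omega>) \<partial>N)
    = (\<integral>\<^sup>+\<omega>. (\<integral>\<^sup>+y. ennreal (normal_density 0 (sqrt h) y) * g (restrict (\<lambda>i. D i \<omega>) {..<k}, y) \<partial>lborel) \<partial>N)"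
proof -
  interpret prob_space N using bm by (simp add: brownian_motion_def)
  let ?P = "PiM {..<k} (\<lambda>_. borel) :: (nat \<Rightarrow> real) measure"
  let ?X = "\<lambda>\<omega>. \<lambda>i\<in>{..<k}. D i \<omega>"
  have ind: "indep_vars (\<lambda>_. borel) D {..<Suc k}"
  proof -
    have "\<forall>(t :: nat \<Rightarrow> real) n. 0 \<le> t 0 \<and> mono t \<longrightarrow>
        indep_vars (\<lambda>_. borel) (\<lambda>i \<omega>. W (t (Suc i)) \<omega> - W (t i) \<omega>) {..<n}"
      using bm by (simp add: brownian_motion_def)
    note this[rule_format, of "\<lambda>i. real i * h" "Suc k"]
    moreover have "mono (\<lambda>i::nat. real i * h)" using h by (auto simp: mono_def intro: mult_right_mono)
    ultimately have "indep_vars (\<lambda>_. borel) (\<lambda>i \<omega>. W (real (Suc i) * h) \<omega> - W (real i * h) \<omega>) {..<Suc k}"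
      by simp
    then show ?thesis by (simp add: D_def)
  qed
  have dist: "distributed N lborel (D k) (\<lambda>x. ennreal (normal_density 0 (sqrt h) x))"
  proof -
    have "\<forall>s t. 0 \<le> s \<and> s < t \<longrightarrow>
        distributed N lborel (\<lambda>\<omega>. W t \<omega> - W s \<omega>) (\<lambda>x. ennreal (normal_density 0 (sqrt (t - s)) x))"
      using bm by (simp add: brownian_motion_def)
    note this[rule_format, of "real k * h" "real (Suc k) * h"]
    then have "distributed N lborel (\<lambda>\<omega>. W (real (Suc k) * h) \<omega> - W (real k * h) \<omega>)
        (\<lambda>x. ennreal (normal_density 0 (sqrt (real (Suc k) * h - real k * h)) x))"
      using h by (simp add: mult_strict_right_mono)
    moreover have "real (Suc k) * h - real k * h = h" by (simp add: algebra_simps)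
    ultimately show ?thesis by (simp add: D_def)
  qed
  let ?K = "PiM {k} (\<lambda>_. borel) :: (nat \<Rightarrow> real) measure"
  let ?Y = "\<lambda>\<omega>. restrict (\<lambda>i. D i \<omega>) {k}"
  have "indep_var ?P ?X ?K ?Y"
    by (rule indep_var_restrict[OF ind]) auto
  note rv = this[unfolded indep_var_distribution_eq]
  have X: "?X \<in> measurable N ?P" and Y: "?Y \<in> measurable N ?K" using rv by auto
  interpret S: sigma_finite_measure "distr N ?K ?Y"
    using prob_space_distr[OF Y] by (simp add: prob_space_imp_sigma_finite)
  define g' where "g' = (\<lambda>(v, u :: nat \<Rightarrow> real). g (v, u k))"
  have g'm: "g' \<in> borel_measurable (?P \<Otimes>\<^sub>M ?K)"
  proof -
    have "(\<lambda>(v, u). (v, u k)) \<in> measurable (?P \<Otimes>\<^sub>M ?K) (?P \<Otimes>\<^sub>M borel)" by measurable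
    from measurable_compose[OF this g] show ?thesis by (simp add: g'_def case_prod_beta')
  qed
  have "(\<integral>\<^sup>+\<omega>. g (?X \<omega>, D k \<omega>) \<partial>N) = (\<integral>\<^sup>+\<omega>. g' (?X \<omega>, ?Y \<omega>) \<partial>N)"
    by (simp add: g'_def)
  also have "\<dots> = (\<integral>\<^sup>+z. g' z \<partial>distr N (?P \<Otimes>\<^sub>M ?K) (\<lambda>\<omega>. (?X \<omega>, ?Y \<omega>)))"
    by (subst nn_integral_distr) (use X Y g'm in auto)
  also have "\<dots> = (\<integral>\<^sup>+z. g' z \<partial>(distr N ?P ?X \<Otimes>\<^sub>M distr N ?K ?Y))"
    using rv by simp
  also have "\<dots> = (\<integral>\<^sup>+v. \<integral>\<^sup>+u. g' (v, u) \<partial>distr N ?K ?Y \<partial>distr N ?P ?X)"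
    by (rule S.nn_integral_fst[symmetric]) (use g'm in simp)
  also have "\<dots> = (\<integral>\<^sup>+\<omega>. \<integral>\<^sup>+u. g' (?X \<omega>, u) \<partial>distr N ?K ?Y \<partial>N)"
    by (rule nn_integral_distr[OF X]) (rule S.borel_measurable_nn_integral_fst, use g'm in simp)
  also have "\<dots> = (\<integral>\<^sup>+\<omega>. (\<integral>\<^sup>+y. ennreal (normal_density 0 (sqrt h) y) * g (?X \<omega>, y) \<partial>lborel) \<partial>N)"
  proof (intro nn_integral_cong)
    fix \<omega> assume "\<omega> \<in> space N"
    then have sp: "?X \<omega> \<in> space ?P" using X by (auto dest: measurable_space)
    have gx: "(\<lambda>y. g (?X \<omega>, y)) \<in> borel_measurable borel"
      by (rule measurable_compose[OF measurable_Pair1'[OF sp] g])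
    have gx': "(\<lambda>u. g' (?X \<omega>, u)) \<in> borel_measurable ?K"
      by (rule measurable_compose[OF measurable_Pair1'[OF sp] g'm])
    have "(\<integral>\<^sup>+u. g' (?X \<omega>, u) \<partial>distr N ?K ?Y) = (\<integral>\<^sup>+\<omega>'. g' (?X \<omega>, ?Y \<omega>') \<partial>N)"
      by (rule nn_integral_distr[OF Y]) (use gx' in simp)
    also have "\<dots> = (\<integral>\<^sup>+\<omega>'. g (?X \<omega>, D k \<omega>') \<partial>N)" by (simp add: g'_def)
    also have "\<dots> = (\<integral>\<^sup>+y. ennreal (normal_density 0 (sqrt h) y) * g (?X \<omega>, y) \<partial>lborel)"
      by (rule distributed_nn_integral[OF dist, symmetric]) (use gx in simp)
    finally show "(\<integral>\<^sup>+u. g' (?X \<omega>, u) \<partial>distr N ?K ?Y)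
       = (\<integral>\<^sup>+y. ennreal (normal_density 0 (sqrt h) y) * g (?X \<omega>, y) \<partial>lborel)" .
  qed
  finally show ?thesis .
qed

text \<open>Summing the one-step loss: the expectation of \<open>V\<close> along the surviving chain starts at \<open>V x\<close>, is
  never negative, and in each step loses at least \<open>h / 2\<close> times the probability of being alive.\<close>

lemma euler_expected_lifetime:
  fixes V V' V'' f :: "real \<Rightarrow> real"
  assumes bm: "brownian_motion N W"
    and V: "\<And>y. y \<in> {c..d} \<Longrightarrow> (V has_real_derivative V' y) (at y)"
    "\<And>y. y \<in> {c..d} \<Longrightarrow> (V' has_real_derivative V'' y) (at y)"
    and V'': "continuous_on {c..d} V''"
    and V1: "\<And>y. y \<in> {c..d} \<Longrightarrow> 1 \<le> V y"
    and f: "continuous_on UNIV f"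
    and LV: "\<And>y. y \<in> {c..d} \<Longrightarrow> V'' y / 2 - f y * V' y \<le> - 1"
    and x: "x \<in> {c..d}"
  obtains h0 where "h0 > 0" "\<And>h n. 0 < h \<Longrightarrow> h < h0 \<Longrightarrow>
     (\<integral>\<^sup>+\<omega>. (\<Sum>k<n. ennreal h * indicator {\<omega>. euler_alive c d f h x
         (\<lambda>i. W (real (Suc i) * h) \<omega> - W (real i * h) \<omega>) k} \<omega>) \<partial>N) \<le> ennreal (2 * V x)"
proof -
  obtain h0 where h0: "h0 > 0" "\<And>h z. 0 < h \<Longrightarrow> h < h0 \<Longrightarrow> z \<in> {c..d} \<Longrightarrow>
     (\<integral>\<^sup>+y. ennreal (normal_density 0 (sqrt h) y) *
        ennreal (if z - h * f z + y \<in> {c..d} then V (z - h * f z + y) else 0) \<partial>lborel) + ennreal (h / 2)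
     \<le> ennreal (V z)"
    using gaussian_step_decreases[OF V V'' V1 continuous_on_subset[OF f] LV] by blast
  interpret prob_space N using bm by (simp add: brownian_motion_def)
  have fm: "f \<in> borel_measurable borel" using f by (rule borel_measurable_continuous_onI)
  define G where "G = (\<lambda>y. if y \<in> {c..d} then V y else 0)"
  have Gm: "G \<in> borel_measurable borel"
  proof -
    have "continuous_on {c..d} V"
      using V by (meson DERIV_continuous_on has_field_derivative_at_within)
    then have "(\<lambda>y. indicator {c..d} y *\<^sub>R V y) \<in> borel_measurable borel"
      by (intro borel_measurable_continuous_on_indicator) auto
    moreover have "(\<lambda>y. indicator {c..d} y *\<^sub>R V y) = G" by (auto simp: G_def indicator_def)
    ultimately show ?thesis by simp
  qed
  show ?thesis
  proof (rule that[OF h0(1)])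
    fix h :: real and n :: nat assume h: "0 < h" "h < h0"
    define D where "D = (\<lambda>(i::nat) \<omega>. W (real (Suc i) * h) \<omega> - W (real i * h) \<omega>)"
    have Dm: "D i \<in> borel_measurable N" for i
      using bm h unfolding brownian_motion_def D_def by (intro borel_measurable_diff) auto
    define al where "al = (\<lambda>w k. euler_alive c d f h x w k)"
    define Z where "Z = (\<lambda>w k. euler f h x w k)"
    have alm: "Measurable.pred N (\<lambda>\<omega>. al (\<lambda>i. D i \<omega>) k)" for k
      unfolding al_def by (rule measurable_euler_alive[OF fm]) (use Dm in auto)
    have Zm: "(\<lambda>\<omega>. Z (\<lambda>i. D i \<omega>) k) \<in> borel_measurable N" for k
      unfolding Z_def by (rule measurable_euler[OF fm]) (use Dm in auto)
    define a where "a = (\<lambda>k. \<integral>\<^sup>+\<omega>. (if al (\<lambda>i. D i \<omega>) k then ennreal (G (Z (\<lambda>i. D i \<omega>) k)) else 0) \<partial>N)"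
    define b where "b = (\<lambda>k. \<integral>\<^sup>+\<omega>. (if al (\<lambda>i. D i \<omega>) k then ennreal (h / 2) else 0) \<partial>N)"
    have step: "a (Suc k) + b k \<le> a k" for k
    proof -
      let ?X = "\<lambda>\<omega>. \<lambda>i\<in>{..<k}. D i \<omega>"
      define g where "g = (\<lambda>(v, y). if al v k then ennreal (G (Z v k - h * f (Z v k) + y)) else 0)"
      let ?P = "PiM {..<k} (\<lambda>_. borel) :: (nat \<Rightarrow> real) measure"
      have "Measurable.pred ?P (\<lambda>v. al v k)" and Zp: "(\<lambda>v. Z v k) \<in> borel_measurable ?P"
        unfolding al_def Z_def by (auto intro!: measurable_euler_alive measurable_euler fm)
      note [measurable] = this Gm fm
      have gm: "g \<in> borel_measurable (?P \<Otimes>\<^sub>M borel)"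
        unfolding g_def by measurable
      have XD: "al (?X \<omega>) k = al (\<lambda>i. D i \<omega>) k" "Z (?X \<omega>) k = Z (\<lambda>i. D i \<omega>) k" for \<omega>
        unfolding al_def Z_def by (auto intro!: euler_alive_cong euler_cong)
      have "a (Suc k) = (\<integral>\<^sup>+\<omega>. g (?X \<omega>, D k \<omega>) \<partial>N)"
        unfolding a_def
      proof (intro nn_integral_cong)
        fix \<omega>
        have "al (\<lambda>i. D i \<omega>) (Suc k) \<longleftrightarrow> al (\<lambda>i. D i \<omega>) k \<and> Z (\<lambda>i. D i \<omega>) (Suc k) \<in> {c..d}"
          by (auto simp: al_def Z_def euler_alive_def le_Suc_eq simp del: euler.simps)
        moreover have "Z (\<lambda>i. D i \<omega>) (Suc k) = Z (\<lambda>i. D i \<omega>) k - h * f (Z (\<lambda>i. D i \<omega>) k) + D k \<omega>"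
          by (simp add: Z_def)
        ultimately show "(if al (\<lambda>i. D i \<omega>) (Suc k) then ennreal (G (Z (\<lambda>i. D i \<omega>) (Suc k))) else 0) = g (?X \<omega>, D k \<omega>)"
          by (auto simp: g_def XD G_def)
      qed
      also have "\<dots> = (\<integral>\<^sup>+\<omega>. (\<integral>\<^sup>+y. ennreal (normal_density 0 (sqrt h) y) * g (?X \<omega>, y) \<partial>lborel) \<partial>N)"
        using brownian_increments_step[OF bm h(1) gm] by (simp only: D_def)
      finally have "a (Suc k) + b k = (\<integral>\<^sup>+\<omega>. (\<integral>\<^sup>+y. ennreal (normal_density 0 (sqrt h) y) * g (?X \<omega>, y) \<partial>lborel)
           + (if al (\<lambda>i. D i \<omega>) k then ennreal (h / 2) else 0) \<partial>N)"
      proof (subst nn_integral_add)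
        have "(\<lambda>v. \<integral>\<^sup>+y. ennreal (normal_density 0 (sqrt h) y) * g (v, y) \<partial>lborel) \<in> borel_measurable ?P"
          using gm by measurable
        moreover have "?X \<in> measurable N ?P" using Dm by (intro measurable_restrict) auto
        ultimately show "(\<lambda>\<omega>. \<integral>\<^sup>+y. ennreal (normal_density 0 (sqrt h) y) * g (?X \<omega>, y) \<partial>lborel) \<in> borel_measurable N"
          by (rule measurable_compose[rotated])
        show "(\<lambda>\<omega>. if al (\<lambda>i. D i \<omega>) k then ennreal (h / 2) else 0) \<in> borel_measurable N"
          using alm[of k] by measurable
      qed (simp add: b_def)
      also have "\<dots> \<le> a k"
        unfolding a_def
      proof (intro nn_integral_mono)
        fix \<omega> assume "\<omega> \<in> space N"
        show "(\<integral>\<^sup>+y. ennreal (normal_density 0 (sqrt h) y) * g (?X \<omega>, y) \<partial>lborel)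
           + (if al (\<lambda>i. D i \<omega>) k then ennreal (h / 2) else 0)
           \<le> (if al (\<lambda>i. D i \<omega>) k then ennreal (G (Z (\<lambda>i. D i \<omega>) k)) else 0)"
        proof (cases "al (\<lambda>i. D i \<omega>) k")
          case True
          then have "Z (\<lambda>i. D i \<omega>) k \<in> {c..d}" by (simp add: al_def Z_def euler_alive_def)
          from h0(2)[OF h this] this True show ?thesis
            by (simp add: g_def XD G_def)
        next
          case False
          then show ?thesis by (simp add: g_def XD)
        qed
      qed
      finally show ?thesis .
    qed
    have tele: "a n + (\<Sum>k<n. b k) \<le> a 0" for n
    proof (induction n)
      case (Suc n)
      have "a (Suc n) + (\<Sum>k<Suc n. b k) = (a (Suc n) + b n) + (\<Sum>k<n. b k)" by (simp add: ac_simps)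
      also have "\<dots> \<le> a n + (\<Sum>k<n. b k)" by (rule add_right_mono[OF step])
      also have "\<dots> \<le> a 0" by (rule Suc)
      finally show ?case .
    qed simp
    have a0: "a 0 = ennreal (V x)"
      using x by (simp add: a_def al_def Z_def euler_alive_def G_def emeasure_space_1)
    have bsum: "(\<Sum>k<n. b k) \<le> ennreal (V x)"
      using tele[of n] unfolding a0 by (meson add_increasing order_trans order_refl zero_le)
    have "(\<integral>\<^sup>+\<omega>. (\<Sum>k<n. ennreal h * indicator {\<omega>. al (\<lambda>i. D i \<omega>) k} \<omega>) \<partial>N)
        = (\<integral>\<^sup>+\<omega>. (\<Sum>k<n. 2 * (if al (\<lambda>i. D i \<omega>) k then ennreal (h / 2) else 0)) \<partial>N)"
    proof (intro nn_integral_cong sum.cong refl)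
      fix \<omega> k
      have "2 * ennreal (h / 2) = ennreal h"
        using h by (simp add: ennreal_mult'[symmetric] flip: ennreal_numeral)
      then show "ennreal h * indicator {\<omega>. al (\<lambda>i. D i \<omega>) k} \<omega> = 2 * (if al (\<lambda>i. D i \<omega>) k then ennreal (h / 2) else 0)"
        by (auto simp: indicator_def)
    qed
    also have "\<dots> = (\<Sum>k<n. 2 * b k)"
    proof (subst nn_integral_sum)
      show "(\<lambda>\<omega>. 2 * (if al (\<lambda>i. D i \<omega>) k then ennreal (h / 2) else 0)) \<in> borel_measurable N" for k
        using alm[of k] by measurable
      show "(\<Sum>k<n. \<integral>\<^sup>+\<omega>. 2 * (if al (\<lambda>i. D i \<omega>) k then ennreal (h / 2) else 0) \<partial>N) = (\<Sum>k<n. 2 * b k)"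
        unfolding b_def using alm by (intro sum.cong refl nn_integral_cmult) measurable
    qed
    also have "\<dots> = 2 * (\<Sum>k<n. b k)" by (simp add: sum_distrib_left)
    also have "\<dots> \<le> 2 * ennreal (V x)" by (intro mult_left_mono bsum) auto
    also have "\<dots> = ennreal (2 * V x)" by (simp add: ennreal_mult')
    finally show "(\<integral>\<^sup>+\<omega>. (\<Sum>k<n. ennreal h * indicator {\<omega>. euler_alive c d f h x
         (\<lambda>i. W (real (Suc i) * h) \<omega> - W (real i * h) \<omega>) k} \<omega>) \<partial>N) \<le> ennreal (2 * V x)"
      by (simp add: al_def D_def)
  qed
qed

section \<open>Expected exit times\<close>

text \<open>Convergence of the Euler scheme along a single path. The noise is additive and cancels in the
  difference of chain and path, so the error \<open>e\<^sub>k\<close> satisfies \<open>e\<^sub>k\<^sub>+\<^sub>1 \<le> (1 + h L) e\<^sub>k + h L \<rho>\<close> with the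
  modulus of continuity \<open>\<rho>\<close> of the path. A path that stays in the open interval up to time \<open>T\<close> keeps
  a positive distance from its endpoints, so the chain stays inside as well.\<close>

lemma euler_stays_inside:
  fixes f y w :: "real \<Rightarrow> real"
  assumes T: "T \<ge> 0" and y: "continuous_on {0..T} y"
    and lip: "\<And>a b. \<bar>f a - f b\<bar> \<le> L * \<bar>a - b\<bar>"
    and eq: "\<And>t. 0 \<le> t \<Longrightarrow> t \<le> T \<Longrightarrow> y t = x + w t - integral {0..t} (\<lambda>s. f (y s))"
    and w0: "w 0 = 0"
    and inside: "\<And>t. 0 \<le> t \<Longrightarrow> t \<le> T \<Longrightarrow> c < y t \<and> y t < d"
  obtains h0 where "h0 > 0" "\<And>h k. 0 < h \<Longrightarrow> h < h0 \<Longrightarrow> real k * h \<le> T \<Longrightarrow>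
     euler_alive c d f h x (\<lambda>i. w (real (Suc i) * h) - w (real i * h)) k"
proof -
  have L: "L \<ge> 0" using lip[of 0 1] by simp
  have ne: "{0..T} \<noteq> {}" using T by simp
  obtain t1 t2 where t1: "t1 \<in> {0..T}" "\<And>t. t \<in> {0..T} \<Longrightarrow> y t1 \<le> y t"
    and t2: "t2 \<in> {0..T}" "\<And>t. t \<in> {0..T} \<Longrightarrow> y t \<le> y t2"
    using continuous_attains_inf[OF compact_Icc ne y] continuous_attains_sup[OF compact_Icc ne y] by blast
  define \<epsilon> where "\<epsilon> = min (y t1 - c) (d - y t2)"
  have \<epsilon>: "\<epsilon> > 0" using inside[of t1] inside[of t2] t1 t2 by (simp add: \<epsilon>_def)
  define \<rho> where "\<rho> = \<epsilon> / exp (L * T)"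
  have \<rho>: "\<rho> > 0" using \<epsilon> by (simp add: \<rho>_def)
  have "uniformly_continuous_on {0..T} y" by (rule compact_uniformly_continuous[OF y]) auto
  then obtain h0 where h0: "h0 > 0"
    "\<And>s t. s \<in> {0..T} \<Longrightarrow> t \<in> {0..T} \<Longrightarrow> \<bar>s - t\<bar> < h0 \<Longrightarrow> \<bar>y s - y t\<bar> < \<rho>"
    unfolding uniformly_continuous_on_def dist_real_def using \<rho> by blast
  have fc: "continuous_on UNIV f"
  proof (rule lipschitz_on_continuous_on)
    show "L-lipschitz_on UNIV f"
      by (rule lipschitz_onI) (use lip L in \<open>auto simp: dist_real_def\<close>)
  qed
  have fy: "continuous_on {0..T} (\<lambda>s. f (y s))"
    by (rule continuous_on_compose2[OF fc y]) auto
  show ?thesis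
  proof (rule that[of "h0 / 2"])
    show "h0 / 2 > 0" using h0 by simp
    fix h k assume h: "0 < h" "h < h0 / 2" and k: "real k * h \<le> T"
    define dw where "dw = (\<lambda>i::nat. w (real (Suc i) * h) - w (real i * h))"
    define Z where "Z = euler f h x dw"
    have err: "\<bar>Z j - y (real j * h)\<bar> \<le> \<rho> * (1 + h * L) ^ j - \<rho>" if "real j * h \<le> T" for j
      using that
    proof (induction j)
      case 0
      have "y 0 = x" using eq[of 0] T w0 by simp
      then show ?case by (simp add: Z_def)
    next
      case (Suc j)
      define s0 where "s0 = real j * h"
      define s1 where "s1 = real (Suc j) * h"
      have s: "0 \<le> s0" "s0 \<le> s1" "s1 \<le> T" "s1 - s0 = h"
        using h Suc.prems by (auto simp: s0_def s1_def algebra_simps)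
      have IH: "\<bar>Z j - y s0\<bar> \<le> \<rho> * (1 + h * L) ^ j - \<rho>" using Suc.IH s by (simp add: s0_def)
      have fys: "continuous_on {s0..s1} (\<lambda>s. f (y s))"
        by (rule continuous_on_subset[OF fy]) (use s in auto)
      have "integral {0..s1} (\<lambda>s. f (y s)) = integral {0..s0} (\<lambda>s. f (y s)) + integral {s0..s1} (\<lambda>s. f (y s))"
        by (rule Henstock_Kurzweil_Integration.integral_combine[symmetric])
           (use s in \<open>auto intro!: integrable_continuous_real continuous_on_subset[OF fy]\<close>)
      then have "y s1 = y s0 + dw j - integral {s0..s1} (\<lambda>s. f (y s))"
        using eq[of s0] eq[of s1] s by (simp add: dw_def s0_def s1_def)
      moreover have "Z (Suc j) = Z j - h * f (Z j) + dw j" by (simp add: Z_def)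
      moreover have "integral {s0..s1} (\<lambda>s. f (y s) - f (Z j)) = integral {s0..s1} (\<lambda>s. f (y s)) - h * f (Z j)"
        using s fys by (subst integral_diff) (auto intro!: integrable_continuous_real simp: mult.commute)
      ultimately have "Z (Suc j) - y s1 = (Z j - y s0) + integral {s0..s1} (\<lambda>s. f (y s) - f (Z j))"
        by simp
      moreover have "\<bar>integral {s0..s1} (\<lambda>s. f (y s) - f (Z j))\<bar> \<le> (L * (\<rho> + \<bar>Z j - y s0\<bar>)) * (s1 - s0)"
      proof -
        have "norm (integral {s0..s1} (\<lambda>s. f (y s) - f (Z j))) \<le> (L * (\<rho> + \<bar>Z j - y s0\<bar>)) * (s1 - s0)"
        proof (rule integral_bound)
          fix r assume r: "r \<in> {s0..s1}"
          have "\<bar>y r - y s0\<bar> < \<rho>" by (rule h0(2)) (use r s h in auto)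
          then have "\<bar>y r - Z j\<bar> \<le> \<rho> + \<bar>Z j - y s0\<bar>" by linarith
          then have "L * \<bar>y r - Z j\<bar> \<le> L * (\<rho> + \<bar>Z j - y s0\<bar>)" using L by (rule mult_left_mono)
          then show "norm (f (y r) - f (Z j)) \<le> L * (\<rho> + \<bar>Z j - y s0\<bar>)"
            using lip[of "y r" "Z j"] by simp
        qed (use s fys in \<open>auto intro!: continuous_intros\<close>)
        then show ?thesis by simp
      qed
      ultimately have "\<bar>Z (Suc j) - y s1\<bar> \<le> \<bar>Z j - y s0\<bar> + (L * (\<rho> + \<bar>Z j - y s0\<bar>)) * h"
        using s(4) abs_triangle_ineq[of "Z j - y s0" "integral {s0..s1} (\<lambda>s. f (y s) - f (Z j))"]
        by simp
      also have "\<dots> = (1 + h * L) * \<bar>Z j - y s0\<bar> + h * L * \<rho>" by (simp add: algebra_simps)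
      also have "\<dots> \<le> (1 + h * L) * (\<rho> * (1 + h * L) ^ j - \<rho>) + h * L * \<rho>"
        using IH h L by (intro add_right_mono mult_left_mono) auto
      also have "\<dots> = \<rho> * (1 + h * L) ^ Suc j - \<rho>" by (simp add: algebra_simps)
      finally show ?case by (simp add: s1_def)
    qed
    have "Z j \<in> {c..d}" if "j \<le> k" for j
    proof -
      have "real j * h \<le> real k * h" using that h by (intro mult_right_mono) auto
      then have j: "real j * h \<le> T" using k by simp
      have "(1 + h * L) ^ j \<le> exp (h * L) ^ j" using h L by (intro power_mono) auto
      also have "\<dots> = exp (L * (real j * h))" by (simp add: exp_of_nat_mult[symmetric] mult_ac)
      also have "\<dots> \<le> exp (L * T)" using j L by (simp add: mult_left_mono)
      finally have "\<rho> * (1 + h * L) ^ j \<le> \<rho> * exp (L * T)" using \<rho> by (intro mult_left_mono) auto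
      also have "\<dots> = \<epsilon>" by (simp add: \<rho>_def)
      finally have "\<bar>Z j - y (real j * h)\<bar> \<le> \<epsilon>" using err[OF j] \<rho> by simp
      moreover have "y t1 \<le> y (real j * h)" "y (real j * h) \<le> y t2"
        using t1(2)[of "real j * h"] t2(2)[of "real j * h"] j h by auto
      moreover have "\<epsilon> \<le> y t1 - c" "\<epsilon> \<le> d - y t2" by (auto simp: \<epsilon>_def)
      ultimately show ?thesis by auto
    qed
    then show "euler_alive c d f h x (\<lambda>i. w (real (Suc i) * h) - w (real i * h)) k"
      unfolding euler_alive_def Z_def dw_def by blast
  qed
qed

text \<open>Let \<open>\<tau>\<^sub>n\<close> be the lifetime of the Euler chain with step \<open>h\<^sub>n = 1 / (n + 1)\<close>. Its expectation is at
  most \<open>2 V x\<close>, and its lower limit dominates the time that \<open>Y\<close> spends in the open interval before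
  leaving it. The chain uses \<open>\<phi>\<close> frozen outside \<open>[c, d]\<close>, which makes it globally Lipschitz and
  does not affect paths inside.\<close>

lemma exit_time_bound:
  fixes V V' V'' \<phi> :: "real \<Rightarrow> real" and Y :: "real \<Rightarrow> 'v \<Rightarrow> real"
  assumes bm: "brownian_motion N W"
    and Yc: "AE \<omega> in N. continuous_on {0..} (\<lambda>t. Y t \<omega>)"
    and eq: "AE \<omega> in N. \<forall>t\<ge>0. Y t \<omega> = x + W t \<omega> - integral {0..t} (\<lambda>s. \<phi> (Y s \<omega>))"
    and V: "\<And>y. y \<in> {c..d} \<Longrightarrow> (V has_real_derivative V' y) (at y)"
    "\<And>y. y \<in> {c..d} \<Longrightarrow> (V' has_real_derivative V'' y) (at y)"
    and V'': "continuous_on {c..d} V''"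
    and V1: "\<And>y. y \<in> {c..d} \<Longrightarrow> 1 \<le> V y"
    and lip: "\<And>a b. a \<in> {c..d} \<Longrightarrow> b \<in> {c..d} \<Longrightarrow> \<bar>\<phi> a - \<phi> b\<bar> \<le> L * \<bar>a - b\<bar>"
    and LV: "\<And>y. y \<in> {c..d} \<Longrightarrow> V'' y / 2 - \<phi> y * V' y \<le> - 1"
    and x: "x \<in> {c..d}"
  obtains g where "g \<in> borel_measurable N" "(\<integral>\<^sup>+\<omega>. g \<omega> \<partial>N) \<le> ennreal (2 * V x)"
    "AE \<omega> in N. \<forall>t\<ge>0. (\<forall>s\<in>{0..t}. c < Y s \<omega> \<and> Y s \<omega> < d) \<longrightarrow> ennreal t \<le> g \<omega>"
proof -
  interpret prob_space N using bm by (simp add: brownian_motion_def)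
  define f where "f = (\<lambda>y. \<phi> (max c (min d y)))"
  have cd: "c \<le> d" using x by simp
  have f_lip: "\<bar>f a - f b\<bar> \<le> \<bar>L\<bar> * \<bar>a - b\<bar>" for a b
  proof -
    have "\<bar>f a - f b\<bar> \<le> L * \<bar>max c (min d a) - max c (min d b)\<bar>"
      unfolding f_def by (rule lip) (use cd in auto)
    also have "\<dots> \<le> \<bar>L\<bar> * \<bar>a - b\<bar>" by (intro mult_mono) auto
    finally show ?thesis .
  qed
  have f_eq: "f y = \<phi> y" if "y \<in> {c..d}" for y using that by (simp add: f_def)
  have fc: "continuous_on UNIV f"
  proof (rule lipschitz_on_continuous_on)
    show "\<bar>L\<bar>-lipschitz_on UNIV f"
      by (rule lipschitz_onI) (use f_lip in \<open>auto simp: dist_real_def\<close>)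
  qed
  have fm: "f \<in> borel_measurable borel" using fc by (rule borel_measurable_continuous_onI)
  have LV': "V'' y / 2 - f y * V' y \<le> - 1" if "y \<in> {c..d}" for y
    using LV[OF that] f_eq[OF that] by simp
  obtain h0 where h0: "h0 > 0" "\<And>h n. 0 < h \<Longrightarrow> h < h0 \<Longrightarrow>
     (\<integral>\<^sup>+\<omega>. (\<Sum>k<n. ennreal h * indicator {\<omega>. euler_alive c d f h x
         (\<lambda>i. W (real (Suc i) * h) \<omega> - W (real i * h) \<omega>) k} \<omega>) \<partial>N) \<le> ennreal (2 * V x)"
    using euler_expected_lifetime[OF bm V V'' V1 fc LV' x] by blast
  define h where "h = (\<lambda>n::nat. 1 / real (Suc n))"
  have h: "h n > 0" for n by (simp add: h_def)
  have h_lim: "h \<longlonglongrightarrow> 0" unfolding h_def by (rule LIMSEQ_Suc) (rule lim_1_over_n)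
  define al where "al = (\<lambda>n k. {\<omega>. euler_alive c d f (h n) x
      (\<lambda>i. W (real (Suc i) * h n) \<omega> - W (real i * h n) \<omega>) k})"
  \<comment> \<open>\<open>(n + 1)\<^sup>2\<close> steps of size \<open>1 / (n + 1)\<close>, so the time horizon grows to infinity\<close>
  define \<tau> where "\<tau> = (\<lambda>n \<omega>. \<Sum>k<(Suc n)\<^sup>2. ennreal (h n) * indicator (al n k) \<omega>)"
  have \<tau>m: "\<tau> n \<in> borel_measurable N" for n
  proof -
    have [measurable]: "Measurable.pred N (\<lambda>\<omega>. \<omega> \<in> al n k)" for k
      unfolding al_def mem_Collect_eq
      by (rule measurable_euler_alive[OF fm])
         (use bm h[of n] in \<open>auto simp: brownian_motion_def intro!: borel_measurable_diff\<close>)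
    have "(\<lambda>\<omega>. \<Sum>k<(Suc n)\<^sup>2. ennreal (h n) * (if \<omega> \<in> al n k then 1 else 0)) \<in> borel_measurable N"
      by measurable
    moreover have "(\<lambda>\<omega>. \<Sum>k<(Suc n)\<^sup>2. ennreal (h n) * (if \<omega> \<in> al n k then 1 else 0)) = \<tau> n"
      unfolding \<tau>_def indicator_def of_bool_def by simp
    ultimately show ?thesis by simp
  qed
  define g where "g = (\<lambda>\<omega>. liminf (\<lambda>n. \<tau> n \<omega>))"
  show ?thesis
  proof (rule that)
    show "g \<in> borel_measurable N" unfolding g_def using \<tau>m by measurable
    have "(\<integral>\<^sup>+\<omega>. g \<omega> \<partial>N) \<le> liminf (\<lambda>n. \<integral>\<^sup>+\<omega>. \<tau> n \<omega> \<partial>N)"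
      unfolding g_def by (rule nn_integral_liminf[OF \<tau>m])
    also have "\<dots> \<le> liminf (\<lambda>n. ennreal (2 * V x))"
    proof (rule Liminf_mono)
      show "\<forall>\<^sub>F n in sequentially. (\<integral>\<^sup>+\<omega>. \<tau> n \<omega> \<partial>N) \<le> ennreal (2 * V x)"
        using order_tendstoD(2)[OF h_lim h0(1)]
        by eventually_elim (use h0(2)[OF h] in \<open>simp add: \<tau>_def al_def\<close>)
    qed
    also have "\<dots> = ennreal (2 * V x)" by (simp add: Liminf_const)
    finally show "(\<integral>\<^sup>+\<omega>. g \<omega> \<partial>N) \<le> ennreal (2 * V x)" .
    have W0: "AE \<omega> in N. W 0 \<omega> = 0" using bm by (simp add: brownian_motion_def)
    show "AE \<omega> in N. \<forall>t\<ge>0. (\<forall>s\<in>{0..t}. c < Y s \<omega> \<and> Y s \<omega> < d) \<longrightarrow> ennreal t \<le> g \<omega>"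
      using Yc eq W0
    proof eventually_elim
      case (elim \<omega>)
      show ?case
      proof (intro allI impI)
        fix T :: real assume T: "T \<ge> 0" and ins: "\<forall>s\<in>{0..T}. c < Y s \<omega> \<and> Y s \<omega> < d"
        have eqf: "Y t \<omega> = x + W t \<omega> - integral {0..t} (\<lambda>s. f (Y s \<omega>))" if "0 \<le> t" "t \<le> T" for t
        proof -
          have "integral {0..t} (\<lambda>s. \<phi> (Y s \<omega>)) = integral {0..t} (\<lambda>s. f (Y s \<omega>))"
            by (rule integral_cong) (use ins that in \<open>force simp: f_eq less_imp_le\<close>)
          then show ?thesis using elim(2) that by simp
        qed
        obtain h1 where h1: "h1 > 0" "\<And>h k. 0 < h \<Longrightarrow> h < h1 \<Longrightarrow> real k * h \<le> T \<Longrightarrow>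
           euler_alive c d f h x (\<lambda>i. W (real (Suc i) * h) \<omega> - W (real i * h) \<omega>) k"
          by (rule euler_stays_inside[OF T _ f_lip eqf elim(3), of c d])
             (use ins elim(1) in \<open>auto intro: continuous_on_subset\<close>)
        have ev: "\<forall>\<^sub>F n in sequentially. real n \<ge> T"
          using filterlim_real_sequentially unfolding filterlim_at_top by blast
        show "ennreal T \<le> g \<omega>"
          unfolding g_def
        proof (rule Liminf_bounded)
          show "\<forall>\<^sub>F n in sequentially. ennreal T \<le> \<tau> n \<omega>"
            using order_tendstoD(2)[OF h_lim h1(1)] ev
          proof eventually_elim
            case (elim n)
            \<comment> \<open>the number of grid times up to \<open>T\<close>\<close>
            define m where "m = Suc (nat \<lfloor>T * Suc n\<rfloor>)"
            have Tn: "T * Suc n \<ge> 0" using T by simp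
            have fl: "real (nat \<lfloor>T * Suc n\<rfloor>) \<le> T * Suc n" "T * Suc n \<le> real m"
              using Tn by (auto simp: m_def of_nat_nat) linarith+
            have al: "\<omega> \<in> al n k" if "k < m" for k
            proof -
              have "real k \<le> real (nat \<lfloor>T * Suc n\<rfloor>)" using that by (simp add: m_def)
              also have "\<dots> \<le> T * Suc n" by (rule fl)
              finally have "real k * h n \<le> T" by (simp add: h_def field_simps)
              then show ?thesis unfolding al_def mem_Collect_eq using elim h by (intro h1(2)) auto
            qed
            have "real m \<le> real ((Suc n)\<^sup>2)"
            proof -
              have "T * Suc n \<le> real n * Suc n" using elim by (intro mult_right_mono) auto
              then have "real m \<le> real n * Suc n + 1" using fl(1) unfolding m_def of_nat_Suc by linarith
              then show ?thesis by (simp add: power2_eq_square algebra_simps)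
            qed
            then have m: "m \<le> (Suc n)\<^sup>2" by (simp only: of_nat_le_iff)
            have "T \<le> real m * h n" using fl(2) by (simp add: h_def field_simps)
            then have "ennreal T \<le> ennreal (real m * h n)" by (rule ennreal_leI)
            also have "\<dots> = (\<Sum>k<m. ennreal (h n) * indicator (al n k) \<omega>)"
              using al h[of n] by (simp add: ennreal_mult ennreal_of_nat_eq_real_of_nat)
            also have "\<dots> \<le> \<tau> n \<omega>"
              unfolding \<tau>_def by (rule sum_mono2) (use m in auto)
            finally show ?case .
          qed
        qed
      qed
    qed
  qed
qed

section \<open>Hitting times of the conditioned process\<close>

context
  fixes q :: "real \<Rightarrow> real"
  assumes q: "continuous_on {0..} q"
begin

lemma cond_drift_eq:
  assumes "x > 0"
  shows "cond_drift q x = q x - exp (bigQ q x) * flux q (lambda_c q) x / eta q (lambda_c q) x"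
proof -
  have "DERIV (eta q (lambda_c q)) x :> exp (bigQ q x) * flux q (lambda_c q) x"
    using eta_deriv[OF q, of x "lambda_c q"] assms by (simp add: at_within_nonneg)
  then show ?thesis unfolding cond_drift_def by (simp add: DERIV_imp_deriv)
qed

lemma cond_drift_deriv:
  assumes q': "continuous_on {0..} q'" "\<And>x. x \<ge> 0 \<Longrightarrow> (q has_real_derivative q' x) (at x within {0..})"
  obtains \<phi>' where "continuous_on {0<..} \<phi>'"
    "\<And>x. x > 0 \<Longrightarrow> (cond_drift q has_real_derivative \<phi>' x) (at x)"
proof -
  let ?u = "eta q (lambda_c q)" and ?v = "flux q (lambda_c q)" and ?e = "\<lambda>x. exp (bigQ q x)"
  define \<phi>' where "\<phi>' = (\<lambda>x. q' x -
     (((?e x * (2 * q x)) * ?v x + (- 2 * lambda_c q * exp (- bigQ q x) * ?u x) * ?e x) * ?u x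
       - ?e x * ?v x * (?e x * ?v x)) / (?u x * ?u x))"
  have sub: "{0<..} \<subseteq> {0::real..}" by auto
  note cs = continuous_on_subset[OF _ sub]
  show ?thesis
  proof (rule that)
    show "continuous_on {0<..} \<phi>'"
      unfolding \<phi>'_def
      by (intro continuous_intros cs[OF q] cs[OF q'(1)] cs[OF continuous_on_bigQ[OF q]]
          cs[OF continuous_on_eta[OF q]] cs[OF continuous_on_flux[OF q]])
         (use eta_lambda_c_pos[OF q] in force)
    fix x :: real assume x: "x > 0"
    have u: "?u x \<noteq> 0" using eta_lambda_c_pos[OF q x] by simp
    note d = q'(2)[of x] bigQ_deriv[OF q, of x] eta_deriv[OF q, of x "lambda_c q"] flux_deriv[OF q, of x "lambda_c q"]
    have dq: "(q has_real_derivative q' x) (at x)" and dQ: "(bigQ q has_real_derivative 2 * q x) (at x)"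
      and du: "(?u has_real_derivative ?e x * ?v x) (at x)"
      and dv: "(?v has_real_derivative - 2 * lambda_c q * exp (- bigQ q x) * ?u x) (at x)"
      using d x by (simp_all add: at_within_nonneg)
    have de: "(?e has_real_derivative ?e x * (2 * q x)) (at x)" by (rule DERIV_fun_exp[OF dQ])
    have "((\<lambda>x. q x - ?e x * ?v x / ?u x) has_real_derivative \<phi>' x) (at x)"
      unfolding \<phi>'_def by (intro DERIV_diff DERIV_divide DERIV_mult dq de du dv u)
    then show "(cond_drift q has_real_derivative \<phi>' x) (at x)"
      by (rule has_field_derivative_transform_within_open[of _ _ _ "{0<..}"])
         (use x cond_drift_eq in auto)
  qed
qed

lemma cond_drift_lipschitz:
  assumes q': "continuous_on {0..} q'" "\<And>x. x \<ge> 0 \<Longrightarrow> (q has_real_derivative q' x) (at x within {0..})"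
    and c: "c > 0"
  obtains L where "\<And>a b. a \<in> {c..d} \<Longrightarrow> b \<in> {c..d} \<Longrightarrow> \<bar>cond_drift q a - cond_drift q b\<bar> \<le> L * \<bar>a - b\<bar>"
proof -
  obtain \<phi>' where \<phi>': "continuous_on {0<..} \<phi>'"
    "\<And>x. x > 0 \<Longrightarrow> (cond_drift q has_real_derivative \<phi>' x) (at x)"
    using cond_drift_deriv[OF q'] by blast
  have "continuous_on {c..d} \<phi>'" by (rule continuous_on_subset[OF \<phi>'(1)]) (use c in auto)
  then obtain L where L: "\<And>x. x \<in> {c..d} \<Longrightarrow> \<bar>\<phi>' x\<bar> \<le> L"
    using abs_bounded_on_Icc by blast
  show ?thesis
  proof (rule that[of L])
    fix a b assume ab: "a \<in> {c..d}" "b \<in> {c..d}"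
    have "norm (cond_drift q a - cond_drift q b) \<le> L * norm (a - b)"
    proof (rule field_differentiable_bound)
      show "convex {c..d}" by simp
      show "(cond_drift q has_real_derivative \<phi>' x) (at x within {c..d})" if "x \<in> {c..d}" for x
        by (rule has_field_derivative_at_within[OF \<phi>'(2)]) (use that c in auto)
    qed (use ab L in auto)
    then show "\<bar>cond_drift q a - cond_drift q b\<bar> \<le> L * \<bar>a - b\<bar>" by simp
  qed
qed

text \<open>The conditioned process has scale density \<open>e\<^sup>Q / \<eta>\<^sup>2\<close> and speed density \<open>\<eta>\<^sup>2 e\<^sup>-\<^sup>Q\<close>. Hence \<open>V' = 2 (K - G) e\<^sup>Q / \<eta>\<^sup>2\<close>,
  where \<open>G\<close> is the integral of the speed density, solves \<open>V'' / 2 - \<phi> V' = - 1\<close> for every constant \<open>K\<close>.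
  The choice of \<open>K\<close> decides on which side of the target \<open>V \<ge> 1\<close>.\<close>

lemma expected_exit_time_solution:
  assumes q': "continuous_on {0..} q'" "\<And>x. x \<ge> 0 \<Longrightarrow> (q has_real_derivative q' x) (at x within {0..})"
  obtains V V' V'' where
    "\<And>y. y > 0 \<Longrightarrow> (V has_real_derivative V' y) (at y)"
    "\<And>y. y > 0 \<Longrightarrow> (V' has_real_derivative V'' y) (at y)"
    "continuous_on {0<..} V''"
    "\<And>y. y > 0 \<Longrightarrow> V'' y / 2 - cond_drift q y * V' y \<le> - 1"
    "\<And>y. V' y = 2 * (K - eta_sq_integral q (lambda_c q) y) * (exp (bigQ q y) / (eta q (lambda_c q) y)\<^sup>2)"
    "V a = 1"
proof -
  let ?u = "eta q (lambda_c q)" and ?v = "flux q (lambda_c q)" and ?e = "\<lambda>x. exp (bigQ q x)"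
    and ?G = "eta_sq_integral q (lambda_c q)"
  define w where "w = (\<lambda>y. 2 * (K - ?G y) * (?e y / (?u y)\<^sup>2))"
  define w' where "w' = (\<lambda>y. 2 * cond_drift q y * w y - 2)"
  have dw: "(w has_real_derivative w' y) (at y)" if y: "y > 0" for y
  proof -
    have u: "?u y > 0" using eta_lambda_c_pos[OF q y] .
    note d = bigQ_deriv[OF q, of y] eta_deriv[OF q, of y "lambda_c q"] eta_sq_integral_deriv[OF q, of y "lambda_c q"]
    have dQ: "(bigQ q has_real_derivative 2 * q y) (at y)"
      and du: "(?u has_real_derivative ?e y * ?v y) (at y)"
      and dG: "(?G has_real_derivative exp (- bigQ q y) * (?u y)\<^sup>2) (at y)"
      using d y by (simp_all add: at_within_nonneg)
    have de: "(?e has_real_derivative ?e y * (2 * q y)) (at y)" by (rule DERIV_fun_exp[OF dQ])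
    have du2: "((\<lambda>y. (?u y)\<^sup>2) has_real_derivative 2 * ?u y * (?e y * ?v y)) (at y)"
      by (rule derivative_eq_intros refl du)+ simp
    have "(w has_real_derivative (2 * (0 - exp (- bigQ q y) * (?u y)\<^sup>2)) * (?e y / (?u y)\<^sup>2)
        + ((?e y * (2 * q y)) * (?u y)\<^sup>2 - ?e y * (2 * ?u y * (?e y * ?v y))) / ((?u y)\<^sup>2 * (?u y)\<^sup>2) * (2 * (K - ?G y))) (at y)"
      unfolding w_def
      by (intro DERIV_mult DERIV_cmult DERIV_diff DERIV_const DERIV_divide dG de du2) (use u in auto)
    also have "(2 * (0 - exp (- bigQ q y) * (?u y)\<^sup>2)) * (?e y / (?u y)\<^sup>2)
        + ((?e y * (2 * q y)) * (?u y)\<^sup>2 - ?e y * (2 * ?u y * (?e y * ?v y))) / ((?u y)\<^sup>2 * (?u y)\<^sup>2) * (2 * (K - ?G y))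
        = w' y"
    proof -
      have "(2 * (0 - exp (- bigQ q y) * (?u y)\<^sup>2)) * (?e y / (?u y)\<^sup>2) = - 2 * (exp (- bigQ q y) * ?e y)"
        using u by simp
      also have "exp (- bigQ q y) * ?e y = 1" by (simp add: exp_add[symmetric])
      finally have 1: "(2 * (0 - exp (- bigQ q y) * (?u y)\<^sup>2)) * (?e y / (?u y)\<^sup>2) = - 2" by simp
      have 2: "((?e y * (2 * q y)) * (?u y)\<^sup>2 - ?e y * (2 * ?u y * (?e y * ?v y))) / ((?u y)\<^sup>2 * (?u y)\<^sup>2)
         = 2 * cond_drift q y * (?e y / (?u y)\<^sup>2)"
        using u by (simp add: cond_drift_eq[OF y] power2_eq_square field_simps)
      show ?thesis unfolding 1 2 by (simp add: w'_def w_def)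
    qed
    finally show ?thesis .
  qed
  obtain \<phi>' where \<phi>': "\<And>x. x > 0 \<Longrightarrow> (cond_drift q has_real_derivative \<phi>' x) (at x)"
    using cond_drift_deriv[OF q'] by blast
  have cw': "continuous_on {0<..} w'"
  proof -
    have "continuous_on {0<..} w" "continuous_on {0<..} (cond_drift q)"
      using dw \<phi>' by (meson DERIV_continuous_on has_field_derivative_at_within greaterThan_iff)+
    then show ?thesis unfolding w'_def by (intro continuous_intros)
  qed
  have "\<exists>H. \<forall>y::real. ereal 0 < y \<longrightarrow> y < \<infinity> \<longrightarrow> (H has_vector_derivative w y) (at y)"
    by (rule einterval_antiderivative) (use dw in \<open>auto intro!: DERIV_isCont\<close>)
  then obtain H where H: "\<And>y. y > 0 \<Longrightarrow> (H has_real_derivative w y) (at y)"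
    by (auto simp: has_real_derivative_iff_has_vector_derivative)
  show ?thesis
  proof (rule that)
    show "((\<lambda>y. 1 + H y - H a) has_real_derivative w y) (at y)" if "y > 0" for y
      by (rule derivative_eq_intros refl H that)+ simp
    show "(w has_real_derivative w' y) (at y)" if "y > 0" for y by (rule dw[OF that])
    show "continuous_on {0<..} w'" by (rule cw')
    show "w' y / 2 - cond_drift q y * w y \<le> - 1" for y by (simp add: w'_def diff_divide_distrib)
    show "w y = 2 * (K - ?G y) * (?e y / (?u y)\<^sup>2)" for y by (simp add: w_def)
  qed simp
qed

end

lemma less_hitting_timeD:
  assumes "ennreal t < hitting_time Y a \<omega>" "0 < s" "s \<le> t"
  shows "Y s \<omega> \<noteq> a"
proof
  assume "Y s \<omega> = a"
  then have "hitting_time Y a \<omega> \<le> ennreal s"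
    unfolding hitting_time_def using assms by (intro INF_lower) auto
  also have "\<dots> \<le> ennreal t" using assms by (intro ennreal_leI)
  finally show False using assms(1) by simp
qed

lemma ennreal_le_if_all_less:
  assumes "\<And>t. t \<ge> 0 \<Longrightarrow> ennreal t < a \<Longrightarrow> ennreal t \<le> b"
  shows "a \<le> b"
proof (rule dense_le)
  fix y assume y: "y < a"
  then have "y < top" using top.not_eq_extremum by fastforce
  then have "y = ennreal (enn2real y)" by simp
  then show "y \<le> b" using assms[of "enn2real y"] y by simp
qed

text \<open>Hitting times are infima over uncountable sets of times, so measurability is avoided by working
  with measurable majorants. Before hitting \<open>a\<close> the path has only seen a compact part of its side of
  \<open>a\<close>, which lies in all but finitely many of the intervals.\<close>

lemma hitting_time_majorant_from_exits:
  fixes c d :: "nat \<Rightarrow> real"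
  assumes exit: "\<And>n. \<exists>g\<in>borel_measurable N. (\<integral>\<^sup>+\<omega>. g \<omega> \<partial>N) \<le> ennreal C \<and>
      (AE \<omega> in N. \<forall>t\<ge>0. (\<forall>s\<in>{0..t}. c n < Y s \<omega> \<and> Y s \<omega> < d n) \<longrightarrow> ennreal t \<le> g \<omega>)"
    and inside: "AE \<omega> in N. \<forall>t\<ge>0. ennreal t < hitting_time Y a \<omega> \<longrightarrow>
      (\<forall>\<^sub>F n in sequentially. \<forall>s\<in>{0..t}. c n < Y s \<omega> \<and> Y s \<omega> < d n)"
  shows "\<exists>g\<in>borel_measurable N. (\<integral>\<^sup>+\<omega>. g \<omega> \<partial>N) < \<infinity> \<and> (AE \<omega> in N. hitting_time Y a \<omega> \<le> g \<omega>)"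
proof -
  define good where "good = (\<lambda>n g. g \<in> borel_measurable N \<and> (\<integral>\<^sup>+\<omega>. g \<omega> \<partial>N) \<le> ennreal C \<and>
      (AE \<omega> in N. \<forall>t\<ge>0. (\<forall>s\<in>{0..t}. c n < Y s \<omega> \<and> Y s \<omega> < d n) \<longrightarrow> ennreal t \<le> g \<omega>))"
  have "\<forall>n. \<exists>g. good n g" using exit unfolding good_def Bex_def by simp
  then obtain g where "\<And>n. good n (g n)" using choice[of good] by auto
  then have g: "\<And>n. g n \<in> borel_measurable N" "\<And>n. (\<integral>\<^sup>+\<omega>. g n \<omega> \<partial>N) \<le> ennreal C"
    "\<And>n. AE \<omega> in N. \<forall>t\<ge>0. (\<forall>s\<in>{0..t}. c n < Y s \<omega> \<and> Y s \<omega> < d n) \<longrightarrow> ennreal t \<le> g n \<omega>"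
    unfolding good_def by auto
  define G where "G = (\<lambda>\<omega>. liminf (\<lambda>n. g n \<omega>))"
  have "(\<integral>\<^sup>+\<omega>. G \<omega> \<partial>N) \<le> liminf (\<lambda>n. \<integral>\<^sup>+\<omega>. g n \<omega> \<partial>N)"
    unfolding G_def by (rule nn_integral_liminf[OF g(1)])
  also have "\<dots> \<le> liminf (\<lambda>n. ennreal C)" by (intro Liminf_mono always_eventually allI g(2))
  also have "\<dots> = ennreal C" by (simp add: Liminf_const)
  also have "\<dots> < \<infinity>" by simp
  finally have fin: "(\<integral>\<^sup>+\<omega>. G \<omega> \<partial>N) < \<infinity>" .
  have "AE \<omega> in N. \<forall>n. \<forall>t\<ge>0. (\<forall>s\<in>{0..t}. c n < Y s \<omega> \<and> Y s \<omega> < d n) \<longrightarrow> ennreal t \<le> g n \<omega>"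
    unfolding AE_all_countable using g(3) by blast
  then have "AE \<omega> in N. hitting_time Y a \<omega> \<le> G \<omega>"
    using inside
  proof eventually_elim
    case (elim \<omega>)
    show ?case
    proof (rule ennreal_le_if_all_less)
      fix t :: real assume t: "t \<ge> 0" "ennreal t < hitting_time Y a \<omega>"
      then have "\<forall>\<^sub>F n in sequentially. \<forall>s\<in>{0..t}. c n < Y s \<omega> \<and> Y s \<omega> < d n" using elim(2) by blast
      then have "\<forall>\<^sub>F n in sequentially. ennreal t \<le> g n \<omega>"
        by eventually_elim (use elim(1) t in blast)
      then show "ennreal t \<le> G \<omega>" unfolding G_def by (rule Liminf_bounded)
    qed
  qed
  moreover have "G \<in> borel_measurable N" unfolding G_def using g(1) by measurable
  ultimately show ?thesis using fin by blast
qed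

text \<open>A path that has visited both \<open>a\<close> and \<open>c\<close> has passed through the level \<open>b\<close> between them.\<close>

lemma hitting_time_le_sum:
  assumes cont: "continuous_on {0..} (\<lambda>t. Y t \<omega>)" and abc: "a < b" "b < c"
  shows "hitting_time Y b \<omega> \<le> hitting_time Y a \<omega> + hitting_time Y c \<omega>"
proof (rule ennreal_le_if_all_less)
  fix t :: real assume t: "t \<ge> 0" "ennreal t < hitting_time Y b \<omega>"
  show "ennreal t \<le> hitting_time Y a \<omega> + hitting_time Y c \<omega>"
  proof (rule ccontr)
    assume "\<not> ennreal t \<le> hitting_time Y a \<omega> + hitting_time Y c \<omega>"
    then have lt: "hitting_time Y a \<omega> + hitting_time Y c \<omega> < ennreal t" by simp
    have "hitting_time Y a \<omega> < ennreal t" "hitting_time Y c \<omega> < ennreal t"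
      using lt by (auto intro: le_less_trans[rotated] simp: add_increasing add_increasing2)
    then obtain r s where r: "0 < r" "Y r \<omega> = a" "ennreal r < ennreal t"
      and s: "0 < s" "Y s \<omega> = c" "ennreal s < ennreal t"
      unfolding hitting_time_def INF_less_iff by blast
    have rs: "r < t" "s < t" using r s by (auto simp: ennreal_less_iff)
    have "\<exists>z. min r s \<le> z \<and> z \<le> max r s \<and> Y z \<omega> = b"
    proof (cases "r \<le> s")
      case True
      then have "\<exists>z. r \<le> z \<and> z \<le> s \<and> Y z \<omega> = b"
        using r s abc by (intro IVT') (auto intro: continuous_on_subset[OF cont])
      then show ?thesis using True by auto
    next
      case False
      then have "\<exists>z. s \<le> z \<and> z \<le> r \<and> Y z \<omega> = b"
        using r s abc by (intro IVT2') (auto intro: continuous_on_subset[OF cont])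
      then show ?thesis using False by auto
    qed
    then obtain z where "min r s \<le> z" "z \<le> max r s" "Y z \<omega> = b" by blast
    then show False using less_hitting_timeD[OF t(2), of z] r s rs by auto
  qed
qed

text \<open>Starting above the target, the intervals are \<open>(a, x + 1 + n)\<close>, and \<open>V\<close> increases because \<open>K\<close>
  bounds \<open>G\<close>; starting below it, they are \<open>(x / (n + 2), a)\<close>, and \<open>V\<close> decreases because \<open>K\<close> is
  replaced by \<open>0\<close>. In both cases the bound \<open>2 V x\<close> does not depend on \<open>n\<close>.\<close>

lemma hitting_time_majorant:
  assumes C1: "C1_on_nonneg q"
    and G: "\<And>x. x \<ge> 0 \<Longrightarrow> eta_sq_integral q (lambda_c q) x \<le> K"
    and Y: "conditioned_process q x M X N Y"
    and x: "x > 0" and a: "a > 0" "x \<noteq> a"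
  shows "\<exists>g\<in>borel_measurable N. (\<integral>\<^sup>+\<omega>. g \<omega> \<partial>N) < \<infinity> \<and> (AE \<omega> in N. hitting_time Y a \<omega> \<le> g \<omega>)"
proof -
  obtain q' where q': "continuous_on {0..} q'" "\<And>x. x \<ge> 0 \<Longrightarrow> (q has_real_derivative q' x) (at x within {0..})"
    using C1 unfolding C1_on_nonneg_def by blast
  have q: "continuous_on {0..} q" by (rule DERIV_continuous_on) (use q'(2) in auto)
  let ?G = "eta_sq_integral q (lambda_c q)"
  obtain W where Yc: "AE \<omega> in N. continuous_on {0..} (\<lambda>t. Y t \<omega>)" and Yp: "AE \<omega> in N. \<forall>t\<ge>0. Y t \<omega> > 0"
    and W: "brownian_motion N W"
    and eq: "AE \<omega> in N. \<forall>t\<ge>0. Y t \<omega> = x + W t \<omega> - integral {0..t} (\<lambda>s. cond_drift q (Y s \<omega>))"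
    using Y unfolding conditioned_process_def by blast
  have W0: "AE \<omega> in N. W 0 \<omega> = 0" using W by (simp add: brownian_motion_def)
  have Y0: "AE \<omega> in N. Y 0 \<omega> = x" using eq W0 by eventually_elim auto
  define k where "k = (if a < x then K else 0)"
  obtain V V' V'' where V: "\<And>y. y > 0 \<Longrightarrow> (V has_real_derivative V' y) (at y)"
    "\<And>y. y > 0 \<Longrightarrow> (V' has_real_derivative V'' y) (at y)"
    "continuous_on {0<..} V''"
    "\<And>y. y > 0 \<Longrightarrow> V'' y / 2 - cond_drift q y * V' y \<le> - 1"
    "\<And>y. V' y = 2 * (k - ?G y) * (exp (bigQ q y) / (eta q (lambda_c q) y)\<^sup>2)"
    "V a = 1"
    using expected_exit_time_solution[OF q q', of k a] by blast
  have exit: "\<exists>g\<in>borel_measurable N. (\<integral>\<^sup>+\<omega>. g \<omega> \<partial>N) \<le> ennreal (2 * V x) \<and>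
      (AE \<omega> in N. \<forall>t\<ge>0. (\<forall>s\<in>{0..t}. c < Y s \<omega> \<and> Y s \<omega> < d) \<longrightarrow> ennreal t \<le> g \<omega>)"
    if cd: "0 < c" "x \<in> {c..d}" and V1: "\<And>y. y \<in> {c..d} \<Longrightarrow> 1 \<le> V y" for c d
  proof -
    obtain L where L: "\<And>a b. a \<in> {c..d} \<Longrightarrow> b \<in> {c..d} \<Longrightarrow> \<bar>cond_drift q a - cond_drift q b\<bar> \<le> L * \<bar>a - b\<bar>"
      using cond_drift_lipschitz[OF q q' cd(1)] by blast
    show ?thesis
    proof (rule exit_time_bound[OF W Yc eq, of c d V V' V'' L])
      show "continuous_on {c..d} V''" by (rule continuous_on_subset[OF V(3)]) (use cd in auto)
    qed (use V V1 L cd in auto)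
  qed
  show ?thesis
  proof (cases "a < x")
    case True
    have mono: "1 \<le> V y" if "a \<le> y" for y
    proof -
      have "V a \<le> V y"
      proof (rule mono_from_deriv[where f' = V' and a = a and b = y and f = V])
        fix z assume z: "a \<le> z" "z \<le> y"
        show "(V has_real_derivative V' z) (at z within {0..})"
          by (rule has_field_derivative_at_within[OF V(1)]) (use z a in auto)
        show "0 \<le> V' z" using G[of z] z a True by (simp add: V(5) k_def)
      qed (use a that in auto)
      then show ?thesis using V(6) by simp
    qed
    show ?thesis
    proof (rule hitting_time_majorant_from_exits[where c = "\<lambda>_. a" and d = "\<lambda>n. x + 1 + real n"])
      show "\<exists>g\<in>borel_measurable N. (\<integral>\<^sup>+\<omega>. g \<omega> \<partial>N) \<le> ennreal (2 * V x) \<and>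
         (AE \<omega> in N. \<forall>t\<ge>0. (\<forall>s\<in>{0..t}. a < Y s \<omega> \<and> Y s \<omega> < x + 1 + real n) \<longrightarrow> ennreal t \<le> g \<omega>)" for n
        by (rule exit) (use a True mono in auto)
      show "AE \<omega> in N. \<forall>t\<ge>0. ennreal t < hitting_time Y a \<omega> \<longrightarrow>
        (\<forall>\<^sub>F n in sequentially. \<forall>s\<in>{0..t}. a < Y s \<omega> \<and> Y s \<omega> < x + 1 + real n)"
        using Yc Y0
      proof eventually_elim
        case (elim \<omega>)
        show ?case
        proof (intro allI impI)
          fix t :: real assume t: "t \<ge> 0" "ennreal t < hitting_time Y a \<omega>"
          have ct: "continuous_on {0..t} (\<lambda>s. Y s \<omega>)" by (rule continuous_on_subset[OF elim(1)]) auto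
          have low: "a < Y s \<omega>" if s: "s \<in> {0..t}" for s
          proof (rule ccontr)
            assume "\<not> a < Y s \<omega>"
            then have "\<exists>z. 0 \<le> z \<and> z \<le> s \<and> Y z \<omega> = a"
              using s elim(2) True by (intro IVT2') (auto intro: continuous_on_subset[OF elim(1)])
            then obtain z where z: "0 \<le> z" "z \<le> s" "Y z \<omega> = a" by blast
            have "z \<noteq> 0" using z elim(2) a by auto
            then show False using less_hitting_timeD[OF t(2), of z] z s by auto
          qed
          obtain s0 where s0: "s0 \<in> {0..t}" "\<And>s. s \<in> {0..t} \<Longrightarrow> Y s \<omega> \<le> Y s0 \<omega>"
            using continuous_attains_sup[OF compact_Icc _ ct] t by auto
          have "\<forall>\<^sub>F n in sequentially. real n \<ge> Y s0 \<omega>"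
            using filterlim_real_sequentially unfolding filterlim_at_top by blast
          then show "\<forall>\<^sub>F n in sequentially. \<forall>s\<in>{0..t}. a < Y s \<omega> \<and> Y s \<omega> < x + 1 + real n"
            by eventually_elim (use low s0(2) x in force)
        qed
      qed
    qed
  next
    case False
    then have xa: "x < a" using a by simp
    have mono: "1 \<le> V y" if "0 < y" "y \<le> a" for y
    proof -
      have "- V y \<le> - V a"
      proof (rule mono_from_deriv[where f' = "\<lambda>y. - V' y" and a = y and b = a and f = "\<lambda>y. - V y"])
        fix z assume z: "y \<le> z" "z \<le> a"
        show "((\<lambda>y. - V y) has_real_derivative - V' z) (at z within {0..})"
          by (rule DERIV_minus, rule has_field_derivative_at_within[OF V(1)]) (use z that in auto)
        have "?G 0 \<le> ?G z" by (rule eta_sq_integral_mono[OF q]) (use z that in auto)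
        moreover have "?G 0 = 0" by (simp add: eta_sq_integral_def)
        ultimately show "0 \<le> - V' z" using False by (simp add: V(5) k_def mult_nonneg_nonneg)
      qed (use that in auto)
      then show ?thesis using V(6) by simp
    qed
    show ?thesis
    proof (rule hitting_time_majorant_from_exits[where c = "\<lambda>n. x / (real n + 2)" and d = "\<lambda>n. a"])
      show "\<exists>g\<in>borel_measurable N. (\<integral>\<^sup>+\<omega>. g \<omega> \<partial>N) \<le> ennreal (2 * V x) \<and>
         (AE \<omega> in N. \<forall>t\<ge>0. (\<forall>s\<in>{0..t}. x / (real n + 2) < Y s \<omega> \<and> Y s \<omega> < a) \<longrightarrow> ennreal t \<le> g \<omega>)" for n
      proof (rule exit)
        show c: "0 < x / (real n + 2)" using x by simp
        show "x \<in> {x / (real n + 2)..a}" using x xa by (simp add: field_simps)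
        show "1 \<le> V y" if "y \<in> {x / (real n + 2)..a}" for y
          using that c by (intro mono) (auto intro: less_le_trans[OF c])
      qed
      show "AE \<omega> in N. \<forall>t\<ge>0. ennreal t < hitting_time Y a \<omega> \<longrightarrow>
        (\<forall>\<^sub>F n in sequentially. \<forall>s\<in>{0..t}. x / (real n + 2) < Y s \<omega> \<and> Y s \<omega> < a)"
        using Yc Y0 Yp
      proof eventually_elim
        case (elim \<omega>)
        show ?case
        proof (intro allI impI)
          fix t :: real assume t: "t \<ge> 0" "ennreal t < hitting_time Y a \<omega>"
          have ct: "continuous_on {0..t} (\<lambda>s. Y s \<omega>)" by (rule continuous_on_subset[OF elim(1)]) auto
          have up: "Y s \<omega> < a" if s: "s \<in> {0..t}" for s
          proof (rule ccontr)
            assume "\<not> Y s \<omega> < a"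
            then have "\<exists>z. 0 \<le> z \<and> z \<le> s \<and> Y z \<omega> = a"
              using s elim(2) xa by (intro IVT') (auto intro: continuous_on_subset[OF elim(1)])
            then obtain z where z: "0 \<le> z" "z \<le> s" "Y z \<omega> = a" by blast
            have "z \<noteq> 0" using z elim(2) a by auto
            then show False using less_hitting_timeD[OF t(2), of z] z s by auto
          qed
          obtain s0 where s0: "s0 \<in> {0..t}" "\<And>s. s \<in> {0..t} \<Longrightarrow> Y s0 \<omega> \<le> Y s \<omega>"
            using continuous_attains_inf[OF compact_Icc _ ct] t by auto
          have pos: "Y s0 \<omega> > 0" using elim(3) s0(1) by auto
          have "\<forall>\<^sub>F n in sequentially. real n \<ge> x / Y s0 \<omega>"
            using filterlim_real_sequentially unfolding filterlim_at_top by blast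
          then show "\<forall>\<^sub>F n in sequentially. \<forall>s\<in>{0..t}. x / (real n + 2) < Y s \<omega> \<and> Y s \<omega> < a"
          proof eventually_elim
            case (elim n)
            have "x \<le> real n * Y s0 \<omega>" using elim pos by (simp add: field_simps)
            also have "\<dots> < (real n + 2) * Y s0 \<omega>" using pos by simp
            finally have "x / (real n + 2) < Y s0 \<omega>" by (simp add: field_simps)
            then show ?case using s0(2) up by force
          qed
        qed
      qed
    qed
  qed
qed

theorem theorem4p1:
  fixes q :: "real \<Rightarrow> real"
    and M :: "real \<Rightarrow> 'w measure"
    and B X :: "real \<Rightarrow> real \<Rightarrow> 'w \<Rightarrow> real"
  assumes "C1_on_nonneg q"
    and "\<And>x. x > 0 \<Longrightarrow> diffusion_until_zero (M x) (B x) q x (X x)"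
    and "(\<integral>\<^sup>+y\<in>{0..}. ennreal (exp (bigQ q y)) \<partial>lborel) = \<infinity>"
    and "(\<integral>\<^sup>+y\<in>{0..}. ennreal (exp (bigQ q y)) *
            (\<integral>\<^sup>+z\<in>{y..}. ennreal (exp (- bigQ q z)) \<partial>lborel) \<partial>lborel) = \<infinity>"
    and "((\<lambda>x. emeasure (mu q) {x..} * ennreal (integral {0..x} (\<lambda>y. exp (bigQ q y)))) \<longlongrightarrow> 0) at_top"
  shows "R_positive TYPE('v) q M X"
proof -
  have q: "continuous_on {0..} q"
    using assms(1) unfolding C1_on_nonneg_def by (auto intro: DERIV_continuous_on)
  \<comment> \<open>the smallness of \<open>B\<close> that \<open>hardy_estimate\<close> needs for all parameters up to \<open>lambda_c + 1\<close>\<close>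
  have B0: "1 / (16 * (lambda_c q + 1)) > 0" using lambda_c_nonneg[OF q] by simp
  obtain n m where nm: "n > 0"
    "\<And>x. x \<ge> n \<Longrightarrow> (m has_real_derivative - exp (- bigQ q x)) (at x within {0..})"
    "\<And>x. x \<ge> n \<Longrightarrow> m x \<ge> 0" "\<And>x. x \<ge> n \<Longrightarrow> m x * scale_fn q x \<le> 1 / (16 * (lambda_c q + 1))"
    using speed_measure_tail[OF q assms(5) B0] by blast
  have "16 * (1 / (16 * (lambda_c q + 1))) * (lambda_c q + 1) \<le> 1"
    using lambda_c_nonneg[OF q] by simp
  then obtain K where K: "\<And>x. x \<ge> 0 \<Longrightarrow> eta_sq_integral q (lambda_c q) x \<le> K"
    using ground_state_square_integrable[OF q nm(1) B0 nm(2-4)] by blast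
  show ?thesis
    unfolding R_positive_def positive_recurrent_def
  proof (intro allI impI)
    fix N :: "real \<Rightarrow> 'v measure" and Y x a
    assume Y: "\<forall>x>0. conditioned_process q x (M x) (X x) (N x) (Y x)" and x: "(x::real) > 0" and a: "(a::real) > 0"
    note maj = hitting_time_majorant[OF assms(1) K Y[rule_format, OF x] x]
    have "\<exists>g\<in>borel_measurable (N x). (\<integral>\<^sup>+\<omega>. g \<omega> \<partial>N x) < \<infinity> \<and> (AE \<omega> in N x. hitting_time (Y x) a \<omega> \<le> g \<omega>)"
    proof (cases "x = a")
      case False
      then show ?thesis using maj[of a] a by blast
    next
      case True
      \<comment> \<open>the target is the starting point: by the time the path has visited both \<open>a / 2\<close> and \<open>2 a\<close>, it has returned to \<open>a\<close>\<close>
      obtain g1 g2 where g: "g1 \<in> borel_measurable (N x)" "(\<integral>\<^sup>+\<omega>. g1 \<omega> \<partial>N x) < \<infinity>"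
        "AE \<omega> in N x. hitting_time (Y x) (a / 2) \<omega> \<le> g1 \<omega>"
        "g2 \<in> borel_measurable (N x)" "(\<integral>\<^sup>+\<omega>. g2 \<omega> \<partial>N x) < \<infinity>"
        "AE \<omega> in N x. hitting_time (Y x) (2 * a) \<omega> \<le> g2 \<omega>"
        using maj[of "a / 2"] maj[of "2 * a"] a True by auto
      have cont: "AE \<omega> in N x. continuous_on {0..} (\<lambda>t. Y x t \<omega>)"
        using Y x unfolding conditioned_process_def by blast
      have "AE \<omega> in N x. hitting_time (Y x) a \<omega> \<le> g1 \<omega> + g2 \<omega>"
        using g(3) g(6) cont
      proof eventually_elim
        case (elim \<omega>)
        have "hitting_time (Y x) a \<omega> \<le> hitting_time (Y x) (a / 2) \<omega> + hitting_time (Y x) (2 * a) \<omega>"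
          by (rule hitting_time_le_sum[where Y = "Y x", OF elim(3)]) (use a in auto)
        also have "\<dots> \<le> g1 \<omega> + g2 \<omega>" by (rule add_mono[OF elim(1,2)])
        finally show ?case .
      qed
      moreover have "(\<integral>\<^sup>+\<omega>. g1 \<omega> + g2 \<omega> \<partial>N x) < \<infinity>"
        using g by (subst nn_integral_add) auto
      moreover have "(\<lambda>\<omega>. g1 \<omega> + g2 \<omega>) \<in> borel_measurable (N x)" using g by measurable
      ultimately show ?thesis by blast
    qed
    then obtain g where g: "(\<integral>\<^sup>+\<omega>. g \<omega> \<partial>N x) < \<infinity>" "AE \<omega> in N x. hitting_time (Y x) a \<omega> \<le> g \<omega>" by blast
    have "(\<integral>\<^sup>+\<omega>. hitting_time (Y x) a \<omega> \<partial>N x) \<le> (\<integral>\<^sup>+\<omega>. g \<omega> \<partial>N x)"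
      by (rule nn_integral_mono_AE[OF g(2)])
    with g(1) show "(\<integral>\<^sup>+\<omega>. hitting_time (Y x) a \<omega> \<partial>N x) < \<infinity>" by (rule le_less_trans[rotated])
  qed
qed

end
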